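(* Let $\Lambda$ be a compact set in the space $\{h:\overline{\mathbb{C}}\to\overline{\mathbb{C}}\mid h\text{ holomorphic},\ \deg(h)\ge2\}$ endowed with the topology induced by uniform convergence on $\overline{\mathbb{C}}$. Let $G$ be the rational semigroup generated by the set $\Lambda$. Then there exists a positive constant $C$ such that each subsemigroup $H$ of $G$ satisfies the condition that $J(H)$ is $C$-uniformly perfect. Furthermore, for any subsemigroup $H$ of $G$, if a point $z_0\in J(H)$ is such that there exists an element $h\in H$ with $h(z_0)=z_0$ and $h'(z_0)=0$, then $z_0\in\operatorname{int}J(H)$.
   Context: $\overline{\mathbb{C}}$ is the Riemann sphere. A rational semigroup is a semigroup of non-constant rational maps $\overline{\mathbb{C}}\to\overline{\mathbb{C}}$ with composition as the operation. For a rational semigroup $H$, the Fatou set is $F(H)=\{z\in\overline{\mathbb{C}}: H\text{ is normal in a neighborhood of }z\}$ and the Julia set is $J(H)=\overline{\mathbb{C}}\setminus F(H)$. For $C>0$, a closed subset $K$ of $\overline{\mathbb{C}}$ is $C$-uniformly perfect if $\#K\ge2$ and every doubly connected domain $A\subset\overline{\mathbb{C}}\setminus K$ such that both connected components of $\overline{\mathbb{C}}\setminus A$ meet $K$ has modulus $\operatorname{mod}A<C$. *)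

theory Defs
  imports "HOL-Complex_Analysis.Complex_Analysis" "HOL-Computational_Algebra.Computational_Algebra"
begin

section \<open>The Riemann sphere\<close>

datatype rsphere = Fin complex | Infty

text \<open>Inverse stereographic projection onto the unit sphere of \<open>\<complex> \<times> \<real>\<close>. The distance on the
  Riemann sphere is the chordal one.\<close>

fun stereo :: "rsphere \<Rightarrow> complex \<times> real" where
  "stereo (Fin z) = (2 * z / of_real (1 + (cmod z)\<^sup>2), ((cmod z)\<^sup>2 - 1) / ((cmod z)\<^sup>2 + 1))"
| "stereo Infty = (0, 1)"

lemma stereo_snd_Fin: "1 - snd (stereo (Fin z)) = 2 / (1 + (cmod z)\<^sup>2)"
proof -
  have "1 + (cmod z)\<^sup>2 > 0"
    by (simp add: add_pos_nonneg)
  then show ?thesis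
    by (simp add: field_simps)
qed

lemma stereo_Fin_neq: "stereo (Fin z) \<noteq> stereo Infty"
proof
  assume "stereo (Fin z) = stereo Infty"
  then have "1 - snd (stereo (Fin z)) = 0"
    by simp
  moreover have "1 + (cmod z)\<^sup>2 > 0"
    by (simp add: add_pos_nonneg)
  ultimately show False
    unfolding stereo_snd_Fin by simp
qed

lemma stereo_Fin_inject:
  assumes "stereo (Fin z) = stereo (Fin w)"
  shows "z = w"
proof -
  have pos: "1 + (cmod z)\<^sup>2 > 0" "1 + (cmod w)\<^sup>2 > 0"
    by (simp_all add: add_pos_nonneg)
  have "2 / (1 + (cmod z)\<^sup>2) = 2 / (1 + (cmod w)\<^sup>2)"
    using assms stereo_snd_Fin by metis
  then have eq: "1 + (cmod z)\<^sup>2 = 1 + (cmod w)\<^sup>2"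
    using pos by (simp add: field_simps)
  have "2 * z / of_real (1 + (cmod z)\<^sup>2) = 2 * w / of_real (1 + (cmod w)\<^sup>2)"
    using assms by simp
  then have "2 * z / of_real (1 + (cmod z)\<^sup>2) = 2 * w / of_real (1 + (cmod z)\<^sup>2)"
    unfolding eq .
  moreover have "complex_of_real (1 + (cmod z)\<^sup>2) \<noteq> 0"
    using pos(1) by (metis less_irrefl of_real_eq_0_iff)
  ultimately show ?thesis
    by (metis divide_cancel_right mult_cancel_left zero_neq_numeral)
qed

lemma inj_stereo: "inj stereo"
proof (rule injI)
  fix x y
  assume "stereo x = stereo y"
  then show "x = y"
    using stereo_Fin_neq stereo_Fin_inject by (cases x; cases y) metis+
qed

instantiation rsphere :: metric_space
begin

definition dist_rsphere :: "rsphere \<Rightarrow> rsphere \<Rightarrow> real"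
  where "dist_rsphere x y = dist (stereo x) (stereo y)"

definition uniformity_rsphere :: "(rsphere \<times> rsphere) filter"
  where "uniformity_rsphere = (INF e\<in>{0<..}. principal {(x, y). dist x y < e})"

definition open_rsphere :: "rsphere set \<Rightarrow> bool"
  where "open_rsphere U \<longleftrightarrow> (\<forall>x\<in>U. eventually (\<lambda>(x', y). x' = x \<longrightarrow> y \<in> U) uniformity)"

instance
proof
  show "uniformity = (INF e\<in>{0<..}. principal {(x :: rsphere, y). dist x y < e})"
    by (rule uniformity_rsphere_def)
  show "open U \<longleftrightarrow> (\<forall>x\<in>U. eventually (\<lambda>(x', y). x' = x \<longrightarrow> y \<in> U) uniformity)"
    for U :: "rsphere set"
    by (rule open_rsphere_def)
  show "dist x y = 0 \<longleftrightarrow> x = y" for x y :: rsphere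
    by (simp add: dist_rsphere_def inj_eq[OF inj_stereo])
  show "dist x y \<le> dist x z + dist y z" for x y z :: rsphere
    by (simp add: dist_rsphere_def dist_triangle2)
qed

end

section \<open>Holomorphic maps between open subsets of the sphere\<close>

text \<open>The atlas has two charts, \<open>z\<close> on the plane and \<open>1/z\<close> near \<open>\<infinity>\<close>. The function
  \<^term>\<open>chart a\<close> is the one used at the point \<open>a\<close>, and \<^term>\<open>param a\<close> is its inverse. The value
  of a chart at the point outside its domain is a dummy.\<close>

fun chart_plane :: "rsphere \<Rightarrow> complex" where
  "chart_plane (Fin z) = z"
| "chart_plane Infty = 0"

fun chart_infty :: "rsphere \<Rightarrow> complex" where
  "chart_infty (Fin z) = inverse z"
| "chart_infty Infty = 0"

fun chart :: "rsphere \<Rightarrow> rsphere \<Rightarrow> complex" where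
  "chart (Fin a) = chart_plane"
| "chart Infty = chart_infty"

fun param :: "rsphere \<Rightarrow> complex \<Rightarrow> rsphere" where
  "param (Fin a) w = Fin w"
| "param Infty w = (if w = 0 then Infty else Fin (inverse w))"

definition local_rep :: "(rsphere \<Rightarrow> rsphere) \<Rightarrow> rsphere \<Rightarrow> complex \<Rightarrow> complex"
  where "local_rep f a = (\<lambda>w. chart (f a) (f (param a w)))"

text \<open>Intended for open \<open>S\<close>. By continuity, \<open>f\<close> maps a neighbourhood of \<open>a\<close> into the domain of
  the chart at \<open>f a\<close>, so that dummy values do not matter.\<close>

definition sphere_holomorphic_on :: "(rsphere \<Rightarrow> rsphere) \<Rightarrow> rsphere set \<Rightarrow> bool"
  where "sphere_holomorphic_on f S \<longleftrightarrow>
    continuous_on S f \<and> (\<forall>a\<in>S. local_rep f a analytic_on {chart a a})"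

text \<open>If \<open>f a = a\<close>, the same chart is used in source and target, so this is then the multiplier
  of the fixed point \<open>a\<close>, also when \<open>a = \<infinity>\<close>.\<close>

definition sphere_deriv :: "(rsphere \<Rightarrow> rsphere) \<Rightarrow> rsphere \<Rightarrow> complex"
  where "sphere_deriv f a = deriv (local_rep f a) (chart a a)"

section \<open>Degree\<close>

text \<open>The map \<open>p/q\<close> for coprime \<open>p\<close> and \<open>q\<close>. Its value at \<open>\<infinity>\<close> is read off from the homogenizations
  of \<open>p\<close> and \<open>q\<close> in degree \<^term>\<open>max (degree p) (degree q)\<close>. The case \<open>q = 0\<close> (then \<open>p\<close> is
  a nonzero constant) is the constant map \<open>\<infinity>\<close>.\<close>

fun rat_map :: "complex poly \<Rightarrow> complex poly \<Rightarrow> rsphere \<Rightarrow> rsphere" where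
  "rat_map p q (Fin z) = (if poly q z = 0 then Infty else Fin (poly p z / poly q z))"
| "rat_map p q Infty =
    (let n = max (degree p) (degree q)
     in if coeff q n = 0 then Infty else Fin (coeff p n / coeff q n))"

text \<open>Every holomorphic self-map of the sphere is of the form \<^term>\<open>rat_map p q\<close> with \<open>p\<close> and \<open>q\<close>
  coprime and unique up to a common constant factor. Maps that are not of this form get degree 0.\<close>

definition sphere_degree :: "(rsphere \<Rightarrow> rsphere) \<Rightarrow> nat"
  where "sphere_degree f =
    (if \<exists>p q. coprime p q \<and> f = rat_map p q
     then THE d. \<exists>p q. coprime p q \<and> f = rat_map p q \<and> d = max (degree p) (degree q)
     else 0)"

section \<open>Semigroups of maps, Fatou and Julia sets\<close>

inductive_set generated_semigroup :: "('a \<Rightarrow> 'a) set \<Rightarrow> ('a \<Rightarrow> 'a) set" for L where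
  gen: "h \<in> L \<Longrightarrow> h \<in> generated_semigroup L"
| comp: "f \<in> generated_semigroup L \<Longrightarrow> g \<in> generated_semigroup L \<Longrightarrow> f \<circ> g \<in> generated_semigroup L"

definition subsemigroup :: "('a \<Rightarrow> 'a) set \<Rightarrow> ('a \<Rightarrow> 'a) set \<Rightarrow> bool"
  where "subsemigroup H G \<longleftrightarrow> H \<noteq> {} \<and> H \<subseteq> G \<and> (\<forall>f\<in>H. \<forall>g\<in>H. f \<circ> g \<in> H)"

definition normal_on :: "(rsphere \<Rightarrow> rsphere) set \<Rightarrow> rsphere set \<Rightarrow> bool"
  where "normal_on H U \<longleftrightarrow>
    (\<forall>f :: nat \<Rightarrow> rsphere \<Rightarrow> rsphere. range f \<subseteq> H \<longrightarrow>
      (\<exists>(r :: nat \<Rightarrow> nat) g. strict_mono r \<and>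
        (\<forall>K. compact K \<and> K \<subseteq> U \<longrightarrow> uniform_limit K (f \<circ> r) g sequentially)))"

definition fatou :: "(rsphere \<Rightarrow> rsphere) set \<Rightarrow> rsphere set"
  where "fatou H = {z. \<exists>U. open U \<and> z \<in> U \<and> normal_on H U}"

definition julia :: "(rsphere \<Rightarrow> rsphere) set \<Rightarrow> rsphere set"
  where "julia H = - fatou H"

section \<open>Modulus and uniform perfectness\<close>

definition doubly_connected_domain :: "rsphere set \<Rightarrow> bool"
  where "doubly_connected_domain A \<longleftrightarrow> open A \<and> connected A \<and> A \<noteq> {} \<and> card (components (- A)) = 2"

definition round_annulus :: "real \<Rightarrow> ereal \<Rightarrow> rsphere set"
  where "round_annulus r1 r2 = Fin ` {z. r1 < cmod z \<and> ereal (cmod z) < r2}"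

definition round_modulus :: "real \<Rightarrow> ereal \<Rightarrow> ereal"
  where "round_modulus r1 r2 =
    (if r1 = 0 \<or> r2 = \<infinity> then \<infinity> else ereal (ln (real_of_ereal r2 / r1) / (2 * pi)))"

definition conformally_equivalent :: "rsphere set \<Rightarrow> rsphere set \<Rightarrow> bool"
  where "conformally_equivalent A B \<longleftrightarrow>
    (\<exists>\<phi> \<psi>. sphere_holomorphic_on \<phi> A \<and> sphere_holomorphic_on \<psi> B \<and> \<phi> ` A = B \<and> \<psi> ` B = A \<and>
      (\<forall>z\<in>A. \<psi> (\<phi> z) = z) \<and> (\<forall>w\<in>B. \<phi> (\<psi> w) = w))"

text \<open>A doubly connected domain is conformally equivalent to some round annulus, and the modulus of
  that annulus is uniquely determined. The supremum is therefore over a singleton; it only serves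
  to select its element.\<close>

definition modulus :: "rsphere set \<Rightarrow> ereal"
  where "modulus A = Sup {round_modulus r1 r2 | r1 r2.
    0 \<le> r1 \<and> ereal r1 < r2 \<and> conformally_equivalent A (round_annulus r1 r2)}"

definition uniformly_perfect :: "real \<Rightarrow> rsphere set \<Rightarrow> bool"
  where "uniformly_perfect C K \<longleftrightarrow>
    closed K \<and> (\<exists>a\<in>K. \<exists>b\<in>K. a \<noteq> b) \<and>
    (\<forall>A. doubly_connected_domain A \<and> A \<subseteq> - K \<and> (\<forall>c\<in>components (- A). c \<inter> K \<noteq> {}) \<longrightarrow>
      modulus A < ereal C)"

end

theory Submission
  imports Defs
begin

text \<open>
  Everything is derived from equicontinuity. To a sequence \<open>\<gamma>\<close> in \<open>\<Lambda>\<close> belongs a non-autonomous Julia set,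
  the set of points where the compositions \<open>\<gamma>\<^sub>m \<circ> \<dots> \<circ> \<gamma>\<^sub>0\<close> fail to be equicontinuous. It is not empty,
  since otherwise some composition would be uniformly close to the identity, hence injective. It
  contains three points at mutual distance at least \<open>\<delta>\<close>, with \<open>\<delta>\<close> depending only on \<open>\<Lambda>\<close>: were it
  concentrated in one or two tiny balls, then so would be the fibres of the maps, which would
  therefore contract these balls quadratically.

  Now let \<open>A\<close> be a very wide annulus in \<open>F(H)\<close>. By Montel's theorem, each piece of \<open>J(H)\<close> cut off by
  \<open>A\<close> meets the Julia set of a sequence \<open>\<gamma>\<close> that spells a word of some \<open>h \<in> H\<close> followed by a periodic
  word of some \<open>h0 \<in> H\<close>, and \<open>A\<close> avoids that Julia set. So all partial compositions omit three well
  separated points on \<open>A\<close>, and by Schottky's theorem they map the core curve of \<open>A\<close> to tiny curves.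
  Inductively the small side of the core curve is mapped into tiny balls all the time, as its size
  cannot jump from tiny to huge in one step. Then the compositions are equicontinuous there, a
  contradiction.

  Near a superattracting fixed point \<open>h\<close> is \<open>z\<^sup>n exp (l z)\<close>, which lifts to the expanding map
  \<open>n u + l (exp u)\<close>. If there were Fatou points arbitrarily close, then the lift would inflate a small
  disc of them to a huge one, and \<open>F(H)\<close> would contain wide round annuli separating \<open>J(H)\<close>.
\<close>

section \<open>Chordal geometry of the sphere\<close>

text \<open>The constants must depend on the generating set alone, while elements of H are words of
  unbounded length. Estimates are therefore made one generator at a time, although the partial words
  met on the way need not belong to H, so that F(H) says nothing about them directly. This is why a
  sequence of generators gets a Julia set of its own: it is completely invariant under the shift,
  and for a periodic word of some h0 in H it misses F(H), because each partial composition is one of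
  finitely many maps after a power of h0. Two properties of the generators are extracted from
  compactness and degree: joint uniform equicontinuity, and fibres that are finite but, over a dense
  set of values, not singletons. The separation constant has its origin here: a fibre inside a ball
  of radius \<delta> forces two distinct points with equal value at distance O(\<delta>), hence a
  derivative O(\<delta>) and an image of size O(\<delta>^2), which is much less than \<delta> once
  \<delta> is small.\<close>

lemma isometry_continuous:
  fixes f :: "'a::metric_space \<Rightarrow> 'b::metric_space"
  assumes "\<And>x y. dist (f x) (f y) = dist x y"
  shows "continuous_on S f"
proof -
  have "(1::real)-lipschitz_on S f"
    by (rule lipschitz_onI) (auto simp: assms)
  then show ?thesis
    by (rule lipschitz_on_continuous_on)
qed

lemma one_plus_cmod_pos: "1 + (cmod z)\<^sup>2 > 0"
  by (simp add: add_pos_nonneg)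

lemma dist_Fin_Fin:
  "dist (Fin z) (Fin w) = 2 * cmod (z - w) / (sqrt (1 + (cmod z)\<^sup>2) * sqrt (1 + (cmod w)\<^sup>2))"
proof -
  define A B where "A = 1 + (cmod z)\<^sup>2" and "B = 1 + (cmod w)\<^sup>2"
  have AB: "A > 0" "B > 0"
    by (auto simp: A_def B_def one_plus_cmod_pos)
  have f: "2 * z / of_real A - 2 * w / of_real B = of_real (2 / (A * B)) * (z * of_real B - w * of_real A)"
    using AB by (simp add: field_simps)
  have s: "((cmod z)\<^sup>2 - 1) / ((cmod z)\<^sup>2 + 1) - ((cmod w)\<^sup>2 - 1) / ((cmod w)\<^sup>2 + 1) = 2 / (A * B) * (A - B)"
  proof -
    have "((cmod z)\<^sup>2 - 1) / ((cmod z)\<^sup>2 + 1) = (A - 2) / A" "((cmod w)\<^sup>2 - 1) / ((cmod w)\<^sup>2 + 1) = (B - 2) / B"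
      by (simp_all add: A_def B_def add.commute)
    note e = this
    show ?thesis
      unfolding e using AB by (simp add: field_simps)
  qed
  \<comment> \<open>Up to the factor 4 / (A B)^2 the left side is the squared distance: the first
    summand is the horizontal part, the second the difference of heights.\<close>
  have id: "(cmod (z * of_real B - w * of_real A))\<^sup>2 + (A - B)\<^sup>2 = A * B * (cmod (z - w))\<^sup>2"
    unfolding A_def B_def cmod_power2
    by (simp add: power2_eq_square algebra_simps)
  have "(dist (Fin z) (Fin w))\<^sup>2 = (cmod (of_real (2 / (A * B)) * (z * of_real B - w * of_real A)))\<^sup>2 + (2 / (A * B) * (A - B))\<^sup>2"
    unfolding f[symmetric] s[symmetric]
    by (simp add: dist_rsphere_def dist_Pair_Pair dist_norm norm_Pair A_def B_def)
  also have "\<dots> = (2 / (A * B))\<^sup>2 * ((cmod (z * of_real B - w * of_real A))\<^sup>2 + (A - B)\<^sup>2)"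
    unfolding norm_mult norm_of_real power_mult_distrib power2_abs by (simp add: algebra_simps)
  also have "\<dots> = (2 * cmod (z - w) / (sqrt A * sqrt B))\<^sup>2"
    unfolding id using AB by (simp add: power2_eq_square field_simps)
  finally have "dist (Fin z) (Fin w) = 2 * cmod (z - w) / (sqrt A * sqrt B)"
    by (rule power2_eq_imp_eq) (use AB in auto)
  then show ?thesis
    by (simp add: A_def B_def)
qed

lemma dist_Fin_Infty: "dist (Fin z) Infty = 2 / sqrt (1 + (cmod z)\<^sup>2)"
proof -
  define A where "A = 1 + (cmod z)\<^sup>2"
  have A: "A > 0"
    by (auto simp: A_def one_plus_cmod_pos)
  have s: "((cmod z)\<^sup>2 - 1) / ((cmod z)\<^sup>2 + 1) - 1 = - 2 / A"
  proof -
    have "((cmod z)\<^sup>2 - 1) / ((cmod z)\<^sup>2 + 1) = (A - 2) / A"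
      by (simp_all add: A_def add.commute)
    then show ?thesis
      using A by (simp add: field_simps)
  qed
  have "(dist (Fin z) Infty)\<^sup>2 = (cmod (2 * z / of_real A))\<^sup>2 + (- 2 / A)\<^sup>2"
    unfolding s[symmetric] by (simp add: dist_rsphere_def dist_Pair_Pair dist_norm norm_Pair A_def)
  also have "\<dots> = 4 * (A - 1) / A\<^sup>2 + 4 / A\<^sup>2"
  proof -
    have "cmod (2 * z / of_real A) = 2 * cmod z / A"
      unfolding norm_divide norm_of_real using A by (simp add: norm_mult)
    then show ?thesis
      by (simp add: power_divide power_mult_distrib A_def)
  qed
  also have "\<dots> = (2 / sqrt A)\<^sup>2"
    using A by (simp add: power2_eq_square field_simps)
  finally have "dist (Fin z) Infty = 2 / sqrt A"
    by (rule power2_eq_imp_eq) (use A in auto)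
  then show ?thesis
    by (simp add: A_def)
qed

lemma dist_Infty_Fin: "dist Infty (Fin z) = 2 / sqrt (1 + (cmod z)\<^sup>2)"
  using dist_Fin_Infty by (simp add: dist_commute)

lemma dist_Fin_le: "dist (Fin z) (Fin w) \<le> 2 * cmod (z - w)"
proof -
  have "1 \<le> sqrt (1 + (cmod z)\<^sup>2) * sqrt (1 + (cmod w)\<^sup>2)"
    by (metis mult_mono' mult_1 real_sqrt_ge_1_iff le_add_same_cancel1 zero_le_power2 zero_le_one)
  then show ?thesis
    unfolding dist_Fin_Fin
    by (metis divide_le_eq_1 mult_left_mono div_by_1 frac_le norm_ge_zero order_refl mult_nonneg_nonneg zero_le_numeral zero_less_one)
qed

lemma dist_Fin_ge:
  assumes "cmod z \<le> 1" "cmod w \<le> 1"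
  shows "cmod (z - w) \<le> dist (Fin z) (Fin w)"
proof -
  have *: "sqrt (1 + (cmod z)\<^sup>2) \<le> sqrt 2" if "cmod z \<le> 1" for z
    using that by (simp add: power_le_one)
  have "sqrt (1 + (cmod z)\<^sup>2) * sqrt (1 + (cmod w)\<^sup>2) \<le> sqrt 2 * sqrt 2"
    by (intro mult_mono * assms) auto
  then have "sqrt (1 + (cmod z)\<^sup>2) * sqrt (1 + (cmod w)\<^sup>2) \<le> 2"
    by simp
  moreover have "0 < sqrt (1 + (cmod z)\<^sup>2) * sqrt (1 + (cmod w)\<^sup>2)"
    by (simp add: one_plus_cmod_pos)
  ultimately have "2 * cmod (z - w) / 2 \<le> dist (Fin z) (Fin w)"
    unfolding dist_Fin_Fin by (intro divide_left_mono) auto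
  then show ?thesis by simp
qed

lemma dist_rsphere_le_2: "dist x y \<le> (2::real)" for x y :: rsphere
proof -
  have n: "norm (stereo x) = 1" for x
  proof (cases x)
    case (Fin z)
    have "(norm (stereo x - stereo Infty))\<^sup>2 = 4 / (1 + (cmod z)\<^sup>2)"
      using dist_Fin_Infty[of z] Fin by (simp add: dist_rsphere_def dist_norm power_divide one_plus_cmod_pos add_nonneg_nonneg)
    moreover have "(norm (stereo x - stereo Infty))\<^sup>2 = (norm (stereo x))\<^sup>2 + 1 - 2 * snd (stereo x)"
      by (cases "stereo x") (simp add: norm_Pair, simp add: power2_eq_square algebra_simps)
    moreover have "snd (stereo x) = 1 - 2 / (1 + (cmod z)\<^sup>2)"
      using stereo_snd_Fin[of z] Fin by simp
    ultimately have "(norm (stereo x))\<^sup>2 = 1"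
      by (simp add: algebra_simps)
    then show ?thesis
      by (simp add: power2_eq_1_iff) (metis norm_ge_zero neg_0_le_iff_le not_one_le_zero)
  qed (simp add: norm_Pair)
  show ?thesis
    unfolding dist_rsphere_def using dist_triangle[of "stereo x" "stereo y" 0] n by (simp add: dist_norm)
qed

lemma dist_Fin0_less_1:
  assumes "dist (Fin 0) x < 1"
  obtains z where "x = Fin z" "cmod z < 1"
proof (cases x)
  case (Fin z)
  have "cmod z < 1"
  proof (rule ccontr)
    assume "\<not> cmod z < 1"
    then have z: "cmod z \<ge> 1" by simp
    then have "sqrt (1 + (cmod z)\<^sup>2) \<le> sqrt ((2 * cmod z)\<^sup>2)"
    proof -
      have "(cmod z)\<^sup>2 \<ge> 1" using z by simp
      then have "1 + (cmod z)\<^sup>2 \<le> (2 * cmod z)\<^sup>2"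
        by (simp add: power_mult_distrib)
      then show ?thesis
        by (rule real_sqrt_le_mono)
    qed
    then have "sqrt (1 + (cmod z)\<^sup>2) \<le> 2 * cmod z"
      by (simp only: real_sqrt_abs abs_mult abs_norm_cancel abs_numeral)
    then have "1 \<le> dist (Fin 0) (Fin z)"
      using z by (simp add: dist_Fin_Fin one_plus_cmod_pos)
    with assms Fin show False by simp
  qed
  with Fin that show ?thesis by blast
next
  case Infty
  with assms show ?thesis by (simp add: dist_Fin_Infty)
qed

lemma continuous_on_Fin: "continuous_on S Fin"
proof -
  have "(2::real)-lipschitz_on S Fin"
    by (rule lipschitz_onI) (use dist_Fin_le in \<open>auto simp: dist_norm\<close>)
  then show ?thesis
    by (rule lipschitz_on_continuous_on)
qed

section \<open>Inversion as a chordal isometry; topology of the sphere\<close>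

definition sphere_inv :: "rsphere \<Rightarrow> rsphere" where
  "sphere_inv x = (case x of Infty \<Rightarrow> Fin 0 | Fin z \<Rightarrow> if z = 0 then Infty else Fin (inverse z))"

lemma sphere_inv_inv [simp]: "sphere_inv (sphere_inv x) = x"
  by (auto simp: sphere_inv_def split: rsphere.splits)

lemma cmod_inverse_sq:
  assumes "z \<noteq> 0"
  shows "sqrt (1 + (cmod (inverse z))\<^sup>2) = sqrt (1 + (cmod z)\<^sup>2) / cmod z"
proof -
  have "1 + (cmod (inverse z))\<^sup>2 = (1 + (cmod z)\<^sup>2) / (cmod z)\<^sup>2"
    using assms by (simp add: norm_divide power_divide field_simps)
  then show ?thesis
    by (simp add: real_sqrt_divide)
qed

lemma dist_sphere_inv: "dist (sphere_inv x) (sphere_inv y) = dist x y"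
proof -
  have z0: "dist (Fin 0) (Fin (inverse z)) = dist Infty (Fin z)" if "z \<noteq> 0" for z
    unfolding dist_Fin_Fin dist_Infty_Fin cmod_inverse_sq[OF that] using that by (simp add: norm_inverse)
  have z1: "dist (Fin (inverse z)) (Fin (inverse w)) = dist (Fin z) (Fin w)" if "z \<noteq> 0" "w \<noteq> 0" for z w
  proof -
    have "cmod (inverse z - inverse w) = cmod (z - w) / (cmod z * cmod w)"
      using that by (simp add: field_simps norm_divide[symmetric] norm_mult[symmetric] norm_minus_commute del: norm_mult norm_divide)
    then show ?thesis
      using that by (simp add: dist_Fin_Fin cmod_inverse_sq)
  qed
  have z2: "dist Infty (Fin (inverse z)) = dist (Fin 0) (Fin z)" if "z \<noteq> 0" for z
    using z0[of "inverse z"] that by simp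
  show ?thesis
    using z0 z1 z2 by (cases x; cases y) (auto simp: sphere_inv_def dist_commute)
qed

lemma continuous_on_sphere_inv: "continuous_on S sphere_inv"
  by (rule isometry_continuous[OF dist_sphere_inv])

text \<open>Two overlapping continuous images of the closed disc, from which the sphere inherits
  compactness and connectedness.\<close>

lemma rsphere_two_discs: "UNIV = Fin ` cball 0 1 \<union> sphere_inv ` Fin ` cball 0 1"
proof -
  have "x \<in> Fin ` cball 0 1 \<union> sphere_inv ` Fin ` cball 0 1" for x
  proof (cases x)
    case (Fin z)
    show ?thesis
    proof (cases "cmod z \<le> 1")
      case False
      then have "x = sphere_inv (Fin (inverse z))" "cmod (inverse z) \<le> 1"
        using Fin by (auto simp: sphere_inv_def norm_inverse inverse_le_1_iff)
      then show ?thesis by auto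
    qed (use Fin in auto)
  next
    case Infty
    then have "x = sphere_inv (Fin 0)" by (simp add: sphere_inv_def)
    then show ?thesis by auto
  qed
  then show ?thesis by blast
qed

lemma compact_UNIV_rsphere: "compact (UNIV :: rsphere set)"
  unfolding rsphere_two_discs
  by (intro compact_Un compact_continuous_image continuous_on_Fin continuous_on_sphere_inv compact_cball)

lemma connected_UNIV_rsphere: "connected (UNIV :: rsphere set)"
  unfolding rsphere_two_discs
proof (rule connected_Un)
  have "Fin 1 = sphere_inv (Fin 1)" by (simp add: sphere_inv_def)
  then show "Fin ` cball 0 1 \<inter> sphere_inv ` Fin ` cball 0 1 \<noteq> {}"
    by (metis IntI cball_eq_empty emptyE image_eqI mem_cball_0 norm_one order_refl)
qed (intro connected_continuous_image continuous_on_Fin continuous_on_sphere_inv connected_cball)+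

lemma compact_rsphere_iff_closed: "compact S \<longleftrightarrow> closed S" for S :: "rsphere set"
  using compact_UNIV_rsphere compact_Int_closed compact_imp_closed by (metis inf_top_left)

subsection \<open>Rotations\<close>

text \<open>An element of PSU(2): the Moebius map (z - c) / (1 + cnj c z), which takes c to 0 and
  has the map of parameter -c as its inverse.\<close>

definition sphere_rot :: "complex \<Rightarrow> rsphere \<Rightarrow> rsphere" where
  "sphere_rot c x = (case x of
      Infty \<Rightarrow> if c = 0 then Infty else Fin (inverse (cnj c))
    | Fin z \<Rightarrow> if 1 + cnj c * z = 0 then Infty else Fin ((z - c) / (1 + cnj c * z)))"

lemma one_plus_cnj_mult: "1 + cnj c * c = of_real (1 + (cmod c)\<^sup>2)"
  by (simp add: complex_norm_square[symmetric] mult.commute del: of_real_power)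

lemma one_plus_cnj_mult_neq_0: "1 + cnj c * c \<noteq> 0"
  unfolding one_plus_cnj_mult of_real_eq_0_iff using one_plus_cmod_pos[of c] by simp

lemma cnj_root:
  assumes "1 + cnj c * z = 0"
  shows "z = - inverse (cnj c)"
  using inverse_unique[of "cnj c" "- z"] assms by (simp add: add_eq_0_iff)

text \<open>The matrix with rows (1, -c) and (cnj c, 1) is unitary up to the factor sqrt (1 +
  |c|^2); this is its effect on the norm of the vector (z, 1). It is the reason why
  \<open>sphere_rot\<close> is an isometry.\<close>

lemma sphere_rot_identity: "(cmod (z - c))\<^sup>2 + (cmod (1 + cnj c * z))\<^sup>2 = (1 + (cmod c)\<^sup>2) * (1 + (cmod z)\<^sup>2)"
  unfolding cmod_power2 by (simp add: power2_eq_square algebra_simps)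

lemma sphere_rot_norm:
  assumes "1 + cnj c * z \<noteq> 0"
  shows "sqrt (1 + (cmod ((z - c) / (1 + cnj c * z)))\<^sup>2)
    = sqrt (1 + (cmod c)\<^sup>2) * sqrt (1 + (cmod z)\<^sup>2) / cmod (1 + cnj c * z)"
proof -
  have "1 + (cmod ((z - c) / (1 + cnj c * z)))\<^sup>2 = ((1 + (cmod c)\<^sup>2) * (1 + (cmod z)\<^sup>2)) / (cmod (1 + cnj c * z))\<^sup>2"
    unfolding sphere_rot_identity[symmetric] using assms
    by (simp add: norm_divide power_divide field_simps)
  then show ?thesis
    by (simp add: real_sqrt_divide real_sqrt_mult)
qed

lemma dist_sphere_rot: "dist (sphere_rot c x) (sphere_rot c y) = dist x y"
proof -
  have c1: "sqrt (1 + (cmod c)\<^sup>2) * sqrt (1 + (cmod c)\<^sup>2) = 1 + (cmod c)\<^sup>2"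
    by (simp add: one_plus_cmod_pos less_imp_le add_nonneg_nonneg)
  have c2: "sqrt (1 + (cmod c)\<^sup>2) > 0" for c
    by (simp add: one_plus_cmod_pos)
  have c4: "cmod (1 + cnj c * c) = 1 + (cmod c)\<^sup>2"
    unfolding one_plus_cnj_mult norm_of_real using one_plus_cmod_pos[of c] by simp
  have ff: "dist (sphere_rot c (Fin z)) (sphere_rot c (Fin w)) = dist (Fin z) (Fin w)"
    if z: "1 + cnj c * z \<noteq> 0" and w: "1 + cnj c * w \<noteq> 0" for z w
  proof -
    have "(z - c) / (1 + cnj c * z) - (w - c) / (1 + cnj c * w)
        = (z - w) * (1 + cnj c * c) / ((1 + cnj c * z) * (1 + cnj c * w))"
      using z w by (simp add: field_simps)
    then have "cmod ((z - c) / (1 + cnj c * z) - (w - c) / (1 + cnj c * w))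
        = cmod (z - w) * (sqrt (1 + (cmod c)\<^sup>2) * sqrt (1 + (cmod c)\<^sup>2)) / (cmod (1 + cnj c * z) * cmod (1 + cnj c * w))"
      by (simp only: norm_mult norm_divide c4 c1)
    moreover have "2 * (d * (s * s) / (u * v)) / ((s * a / u) * (s * b / v)) = 2 * d / (a * b)"
      if "s > 0" "a > 0" "b > 0" "u > 0" "v > 0" for d s a b u v :: real
      using that by (simp add: field_simps)
    ultimately show ?thesis
      using z w c2[of c] c2[of z] c2[of w]
      by (simp only: sphere_rot_def rsphere.case if_False dist_Fin_Fin sphere_rot_norm[OF z] sphere_rot_norm[OF w] zero_less_norm_iff not_False_eq_True)
  qed
  have fi: "dist (sphere_rot c (Fin z)) (sphere_rot c (Fin w)) = dist (Fin z) (Fin w)"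
    if z: "1 + cnj c * z \<noteq> 0" and w: "1 + cnj c * w = 0" for z w
  proof -
    have c: "cnj c \<noteq> 0" using w by auto
    have w2: "w = - inverse (cnj c)" using cnj_root[OF w] .
    have nw: "sqrt (1 + (cmod w)\<^sup>2) = sqrt (1 + (cmod c)\<^sup>2) / cmod c"
      using cmod_inverse_sq[of "cnj c"] c unfolding w2 by (simp add: norm_inverse)
    have "z - w = (1 + cnj c * z) / cnj c" using c unfolding w2 by (simp add: field_simps)
    then have nzw: "cmod (z - w) = cmod (1 + cnj c * z) / cmod c" by (simp add: norm_divide)
    show ?thesis
      using z w c c2[of c] c2[of z] by (simp add: sphere_rot_def dist_Fin_Fin dist_Fin_Infty sphere_rot_norm nw nzw)
  qed
  have gi: "dist (sphere_rot c (Fin z)) (sphere_rot c Infty) = dist (Fin z) Infty" for z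
  proof (cases "c = 0")
    case True
    then show ?thesis by (simp add: sphere_rot_def)
  next
    case c: False
    have nw: "sqrt (1 + (cmod (inverse (cnj c)))\<^sup>2) = sqrt (1 + (cmod c)\<^sup>2) / cmod c"
      using cmod_inverse_sq[of "cnj c"] c by simp
    show ?thesis
    proof (cases "1 + cnj c * z = 0")
      case True
      have w2: "z = - inverse (cnj c)" using cnj_root[OF True] .
      show ?thesis using True c nw by (simp add: sphere_rot_def dist_Infty_Fin dist_Fin_Infty w2)
    next
      case z: False
      have "(z - c) / (1 + cnj c * z) - inverse (cnj c) = - (1 + cnj c * c) / (cnj c * (1 + cnj c * z))"
        using z c by (simp add: field_simps)
      then have "cmod ((z - c) / (1 + cnj c * z) - inverse (cnj c))
        = (sqrt (1 + (cmod c)\<^sup>2) * sqrt (1 + (cmod c)\<^sup>2)) / (cmod c * cmod (1 + cnj c * z))"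
        by (simp only: norm_mult norm_divide norm_minus_cancel c4 c1 complex_mod_cnj)
      moreover have "2 * ((s * s) / (n * u)) / ((s * a / u) * (s / n)) = 2 / a"
        if "s > 0" "a > 0" "n > 0" "u > 0" for s a n u :: real
        using that by (simp add: field_simps)
      ultimately show ?thesis
        using z c c2[of c] c2[of z]
        by (simp only: sphere_rot_def rsphere.case if_False dist_Fin_Fin dist_Fin_Infty
            sphere_rot_norm[OF z] nw zero_less_norm_iff not_False_eq_True)
    qed
  qed
  have w: "w = z" if "1 + cnj c * z = 0" "1 + cnj c * w = 0" for z w
    using that by (metis add_left_cancel mult_cancel_left add.right_neutral mult_zero_left zero_neq_one)
  show ?thesis
  proof (cases x; cases y)
    fix z w assume "x = Fin z" "y = Fin w"
    then show ?thesis
      using ff[of z w] fi[of z w] fi[of w z] w[of z w]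
      by (cases "1 + cnj c * z = 0"; cases "1 + cnj c * w = 0") (auto simp: dist_commute)
  qed (use gi in \<open>auto simp: dist_commute\<close>)
qed

lemma sphere_rot_minus: "sphere_rot (- c) (sphere_rot c x) = x"
proof -
  note c3 = one_plus_cnj_mult_neq_0[of c]
  show ?thesis
  proof (cases x)
    case (Fin z)
    show ?thesis
    proof (cases "1 + cnj c * z = 0")
      case True
      then have "c \<noteq> 0" by auto
      then show ?thesis
        using cnj_root[OF True] Fin \<open>c \<noteq> 0\<close> by (simp add: sphere_rot_def)
    next
      case False
      have d: "1 - cnj c * ((z - c) / (1 + cnj c * z)) = (1 + cnj c * c) / (1 + cnj c * z)"
        using False by (simp add: field_simps)
      have n: "(z - c) / (1 + cnj c * z) + c = z * (1 + cnj c * c) / (1 + cnj c * z)"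
        using False by (simp add: field_simps)
      define u where "u = (z - c) / (1 + cnj c * z)"
      have "1 + cnj (- c) * u = (1 + cnj c * c) / (1 + cnj c * z)"
        "u - (- c) = z * (1 + cnj c * c) / (1 + cnj c * z)"
        using d n by (simp_all add: u_def)
      moreover have "sphere_rot c x = Fin u"
        using False by (simp add: sphere_rot_def u_def Fin)
      ultimately show ?thesis
        unfolding Fin using False c3 by (simp add: sphere_rot_def)
    qed
  next
    case Infty
    then show ?thesis
      by (simp add: sphere_rot_def)
  qed
qed

section \<open>Holomorphy of the inversion and of the rotations\<close>

lemma sphere_holomorphic_inv: "sphere_holomorphic_on sphere_inv UNIV"
proof -
  have "local_rep sphere_inv a analytic_on {chart a a}" for a
  proof (cases a)
    case (Fin z)
    show ?thesis
    proof (cases "z = 0")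
      case True
      then have "local_rep sphere_inv a = (\<lambda>w. w)"
        using Fin by (auto simp: local_rep_def sphere_inv_def)
      then show ?thesis by simp
    next
      case False
      then have "local_rep sphere_inv a = inverse"
        using Fin by (auto simp: local_rep_def sphere_inv_def)
      then show ?thesis using False Fin by (auto intro!: analytic_intros)
    qed
  next
    case Infty
    then have "local_rep sphere_inv a = (\<lambda>w. w)"
      by (auto simp: local_rep_def sphere_inv_def)
    then show ?thesis by simp
  qed
  then show ?thesis
    by (simp add: sphere_holomorphic_on_def continuous_on_sphere_inv)
qed

lemma sphere_holomorphic_rot: "sphere_holomorphic_on (sphere_rot c) UNIV"
proof -
  have "local_rep (sphere_rot c) a analytic_on {chart a a}" for a
  proof (cases a)
    case (Fin z)
    show ?thesis
    proof (cases "1 + cnj c * z = 0")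
      case True
      then have l: "local_rep (sphere_rot c) a = (\<lambda>w. (1 + cnj c * w) / (w - c))"
        using Fin by (auto simp: local_rep_def sphere_rot_def)
      have "z \<noteq> c" using True one_plus_cnj_mult_neq_0[of c] by blast
      then show ?thesis using Fin unfolding l by (auto intro!: analytic_intros)
    next
      case False
      then have l: "local_rep (sphere_rot c) a = (\<lambda>w. (w - c) / (1 + cnj c * w))"
        using Fin by (auto simp: local_rep_def sphere_rot_def)
      show ?thesis using False Fin unfolding l by (auto intro!: analytic_intros)
    qed
  next
    case Infty
    show ?thesis
    proof (cases "c = 0")
      case True
      then have "local_rep (sphere_rot c) a = (\<lambda>w. w)"
        using Infty by (auto simp: local_rep_def sphere_rot_def)
      then show ?thesis by simp
    next
      case False
      have "local_rep (sphere_rot c) a w = (1 - c * w) / (w + cnj c)" for w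
      proof (cases "w = 0")
        case True
        then show ?thesis using False Infty by (auto simp: local_rep_def sphere_rot_def field_simps)
      next
        case w: False
        have "1 + cnj c * inverse w = (w + cnj c) / w" "inverse w - c = (1 - c * w) / w"
          using w by (auto simp: field_simps)
        then show ?thesis using w False Infty by (simp add: local_rep_def sphere_rot_def)
      qed
      then have l: "local_rep (sphere_rot c) a = (\<lambda>w. (1 - c * w) / (w + cnj c))"
        by blast
      show ?thesis using False Infty unfolding l by (auto intro!: analytic_intros)
    qed
  qed
  then show ?thesis
    by (simp add: sphere_holomorphic_on_def isometry_continuous[OF dist_sphere_rot])
qed

section \<open>Holomorphic maps from plane domains into the sphere\<close>

text \<open>The chart is taken at the value \<open>f z\<close>, so that a pole is a point where 1/f
  is analytic. On open S these are the meromorphic functions, together with functions that are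
  constantly \<open>Infty\<close> on components.\<close>

definition sph_hol :: "(complex \<Rightarrow> rsphere) \<Rightarrow> complex set \<Rightarrow> bool"
  where "sph_hol f S \<longleftrightarrow> continuous_on S f \<and> (\<forall>z\<in>S. (\<lambda>w. chart (f z) (f w)) analytic_on {z})"

lemma sph_hol_subset: "sph_hol f S \<Longrightarrow> T \<subseteq> S \<Longrightarrow> sph_hol f T"
  by (auto simp: sph_hol_def intro: continuous_on_subset)

lemma sph_hol_finite:
  assumes "sph_hol f S" "Infty \<notin> f ` S"
  obtains g where "g holomorphic_on S" "\<And>z. z \<in> S \<Longrightarrow> f z = Fin (g z)"
proof
  have fin: "\<exists>a. f z = Fin a" if "z \<in> S" for z
    using assms(2) that by (cases "f z") force+
  have "(\<lambda>w. chart_plane (f w)) analytic_on {z}" if "z \<in> S" for z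
    using assms(1) that fin[OF that] by (force simp: sph_hol_def)
  then have "(\<lambda>w. chart_plane (f w)) analytic_on S"
    using analytic_on_analytic_at by blast
  then show "(\<lambda>w. chart_plane (f w)) holomorphic_on S"
    by (rule analytic_imp_holomorphic)
  show "f z = Fin (chart_plane (f z))" if "z \<in> S" for z
    using fin[OF that] by auto
qed

lemma sph_hol_Fin:
  assumes "open S" "g holomorphic_on S"
  shows "sph_hol (\<lambda>z. Fin (g z)) S"
proof -
  have "continuous_on S (Fin \<circ> g)"
    by (intro continuous_on_compose continuous_on_Fin holomorphic_on_imp_continuous_on assms)
  moreover have "g analytic_on {z}" if "z \<in> S" for z
    using assms that analytic_at by blast
  ultimately show ?thesis
    by (simp add: sph_hol_def o_def)
qed

lemma param_chart:
  assumes "a \<noteq> Infty \<Longrightarrow> x \<noteq> Infty" "a = Infty \<Longrightarrow> x \<noteq> Fin 0"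
  shows "param a (chart a x) = x"
  using assms by (cases a; cases x) auto

lemma sph_hol_compose:
  assumes h: "sphere_holomorphic_on h V" and f: "sph_hol f S" and "f ` S \<subseteq> V" "open S"
  shows "sph_hol (\<lambda>z. h (f z)) S"
proof -
  have "continuous_on S (h \<circ> f)"
    using assms by (intro continuous_on_compose) (auto simp: sph_hol_def sphere_holomorphic_on_def intro: continuous_on_subset)
  moreover have "(\<lambda>w. chart (h (f z)) (h (f w))) analytic_on {z}" if z: "z \<in> S" for z
  proof -
    \<comment> \<open>Continuity keeps f, near z, off the one point where the chart at
      \<open>f z\<close> has a dummy value, so that \<open>param\<close> inverts the chart along
      f.\<close>
    have c: "(f \<longlongrightarrow> f z) (nhds z)"
      using f z \<open>open S\<close> by (metis sph_hol_def continuous_on_eq_continuous_at continuous_at tendsto_at_iff_tendsto_nhds isCont_def)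
    have "\<forall>\<^sub>F w in nhds z. (f z \<noteq> Infty \<longrightarrow> f w \<noteq> Infty) \<and> (f z = Infty \<longrightarrow> f w \<noteq> Fin 0)"
    proof (cases "f z = Infty")
      case True
      then have "\<forall>\<^sub>F w in nhds z. f w \<noteq> Fin 0"
        by (intro tendsto_imp_eventually_ne[OF c]) simp
      then show ?thesis using True by simp
    next
      case False
      then have "\<forall>\<^sub>F w in nhds z. f w \<noteq> Infty"
        by (intro tendsto_imp_eventually_ne[OF c]) simp
      then show ?thesis using False by simp
    qed
    then have ev: "\<forall>\<^sub>F w in nhds z. chart (h (f z)) (h (f w)) = (local_rep h (f z) \<circ> (\<lambda>w. chart (f z) (f w))) w"
      by eventually_elim (simp add: local_rep_def param_chart)
    have "local_rep h (f z) \<circ> (\<lambda>w. chart (f z) (f w)) analytic_on {z}"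
      using f h z assms(3) by (intro analytic_on_compose) (auto simp: sph_hol_def sphere_holomorphic_on_def)
    then show ?thesis
      using analytic_at_cong[OF ev refl] by (simp add: o_def)
  qed
  ultimately show ?thesis
    by (simp add: sph_hol_def o_def)
qed

lemma sph_hol_reparam:
  assumes f: "sph_hol f T" and g: "g holomorphic_on S" and "g ` S \<subseteq> T" "open S"
  shows "sph_hol (\<lambda>z. f (g z)) S"
proof -
  have "continuous_on S (f \<circ> g)"
    using f holomorphic_on_imp_continuous_on[OF g] assms(3)
    by (intro continuous_on_compose) (auto simp: sph_hol_def intro: continuous_on_subset)
  moreover have "(\<lambda>w. chart (f (g z)) (f (g w))) analytic_on {z}" if z: "z \<in> S" for z
  proof -
    have "g analytic_on {z}"
      using g z assms(4) by (intro holomorphic_on_imp_analytic_at)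
    then have "(\<lambda>w. chart (f (g z)) (f w)) \<circ> g analytic_on {z}"
      using f z assms(3) by (intro analytic_on_compose) (auto simp: sph_hol_def)
    then show ?thesis by (simp add: o_def)
  qed
  ultimately show ?thesis
    by (simp add: sph_hol_def o_def)
qed

text \<open>Stated through test maps, so that it is closed under composition without any reference to charts.\<close>
definition sphere_map :: "(rsphere \<Rightarrow> rsphere) \<Rightarrow> bool"
  where "sphere_map h \<longleftrightarrow> continuous_on UNIV h \<and> (\<forall>f S. open S \<longrightarrow> sph_hol f S \<longrightarrow> sph_hol (\<lambda>z. h (f z)) S)"

lemma sphere_holomorphic_imp_sphere_map: "sphere_holomorphic_on h UNIV \<Longrightarrow> sphere_map h"
  unfolding sphere_map_def using sph_hol_compose[of h UNIV] by (simp add: sphere_holomorphic_on_def)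

lemma sphere_map_compose: "sphere_map f \<Longrightarrow> sphere_map g \<Longrightarrow> sphere_map (f \<circ> g)"
  unfolding sphere_map_def o_def using continuous_on_compose2[of UNIV f UNIV g] by simp

lemma sphere_map_id: "sphere_map id"
  by (auto simp: sphere_map_def)

lemma sphere_mapD: "sphere_map h \<Longrightarrow> open S \<Longrightarrow> sph_hol f S \<Longrightarrow> sph_hol (\<lambda>z. h (f z)) S"
  by (auto simp: sphere_map_def)

lemma sphere_map_continuous: "sphere_map h \<Longrightarrow> continuous_on S h"
  by (auto simp: sphere_map_def intro: continuous_on_subset)

section \<open>Isometric normalization of points, and discs as charts\<close>

definition rotation :: "(rsphere \<Rightarrow> rsphere) \<Rightarrow> bool"
  where "rotation R \<longleftrightarrow> sphere_map R \<and> (\<forall>x y. dist (R x) (R y) = dist x y)"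

lemma rotation_dist: "rotation R \<Longrightarrow> dist (R x) (R y) = dist x y"
  by (simp add: rotation_def)

lemma rotation_compose: "rotation R \<Longrightarrow> rotation Q \<Longrightarrow> rotation (R \<circ> Q)"
  by (simp add: rotation_def sphere_map_compose)

lemma rotation_sphere_inv: "rotation sphere_inv"
  by (simp add: rotation_def dist_sphere_inv sphere_holomorphic_inv sphere_holomorphic_imp_sphere_map)

lemma rotation_to_0:
  obtains R R' where "rotation R" "rotation R'" "\<And>x. R (R' x) = x" "\<And>x. R' (R x) = x" "R a = Fin 0"
proof (cases a)
  case (Fin c)
  have r: "rotation (sphere_rot c)" for c
    by (simp add: rotation_def dist_sphere_rot sphere_holomorphic_rot sphere_holomorphic_imp_sphere_map)
  note z = one_plus_cnj_mult_neq_0[of c]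
  have "sphere_rot c a = Fin 0"
    using z by (simp add: sphere_rot_def Fin)
  moreover have "sphere_rot c (sphere_rot (- c) x) = x" for x
    using sphere_rot_minus[of "- c" x] by simp
  ultimately show ?thesis
    using r sphere_rot_minus[of c] that by blast
next
  case Infty
  have "sphere_inv a = Fin 0"
    by (simp add: Infty sphere_inv_def)
  then show ?thesis
    using rotation_sphere_inv sphere_inv_inv that by blast
qed

lemma rotation_to_Infty:
  obtains R R' where "rotation R" "rotation R'" "\<And>x. R (R' x) = x" "\<And>x. R' (R x) = x" "R a = Infty"
proof -
  obtain R R' where R: "rotation R" "rotation R'" "\<And>x. R (R' x) = x" "\<And>x. R' (R x) = x" "R a = Fin 0"
    using rotation_to_0[of a] by blast
  have i0: "sphere_inv (Fin 0) = Infty"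
    by (simp add: sphere_inv_def)
  show ?thesis
    by (rule that[of "sphere_inv \<circ> R" "R' \<circ> sphere_inv"]) (simp_all add: R rotation_sphere_inv rotation_compose i0)
qed

lemma rotation_map: "rotation R \<Longrightarrow> sphere_map R"
  by (simp add: rotation_def)

text \<open>A rotated copy of the plane, centred at \<open>x\<close>, with uniform control of the metric on the unit disc.\<close>
definition disc_chart :: "(complex \<Rightarrow> rsphere) \<Rightarrow> rsphere \<Rightarrow> bool"
  where "disc_chart P x \<longleftrightarrow> sph_hol P UNIV \<and> P 0 = x \<and> (\<forall>z w. dist (P z) (P w) \<le> 2 * cmod (z - w)) \<and>
    (\<forall>z w. cmod z \<le> 1 \<longrightarrow> cmod w \<le> 1 \<longrightarrow> cmod (z - w) \<le> dist (P z) (P w)) \<and>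
    (\<forall>y. dist x y < 1 \<longrightarrow> (\<exists>z. y = P z \<and> cmod z < 1 \<and> cmod z \<le> dist x y)) \<and>
    (\<forall>f S. open S \<longrightarrow> sph_hol f S \<longrightarrow> f ` S \<subseteq> ball x 1 \<longrightarrow>
      (\<exists>g. g holomorphic_on S \<and> (\<forall>z\<in>S. f z = P (g z) \<and> cmod (g z) < 1)))"

lemma disc_chartD:
  assumes "disc_chart P x"
  shows "sph_hol P UNIV" "P 0 = x" "dist (P z) (P w) \<le> 2 * cmod (z - w)"
    "cmod z \<le> 1 \<Longrightarrow> cmod w \<le> 1 \<Longrightarrow> cmod (z - w) \<le> dist (P z) (P w)"
    "dist x y < 1 \<Longrightarrow> \<exists>z. y = P z \<and> cmod z < 1 \<and> cmod z \<le> dist x y"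
    "open S \<Longrightarrow> sph_hol f S \<Longrightarrow> f ` S \<subseteq> ball x 1 \<Longrightarrow>
      \<exists>g. g holomorphic_on S \<and> (\<forall>z\<in>S. f z = P (g z) \<and> cmod (g z) < 1)"
  using assms unfolding disc_chart_def by blast+

lemma ex_disc_chart:
  obtains P where "disc_chart P x"
proof -
  obtain R R' where R: "rotation R" "rotation R'" "\<And>x. R (R' x) = x" "\<And>x. R' (R x) = x" "R x = Fin 0"
    using rotation_to_0[of x] by blast
  define P where "P = (\<lambda>z. R' (Fin z))"
  have d: "dist (P z) (P w) = dist (Fin z) (Fin w)" for z w
    using R by (simp add: P_def rotation_dist)
  have P0: "P 0 = x"
    unfolding P_def using R(4)[of x] R(5) by simp
  have n: "\<exists>z. y = P z \<and> cmod z < 1 \<and> cmod z \<le> dist x y" if "dist x y < 1" for y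
  proof -
    have "dist (Fin 0) (R y) < 1"
      using that rotation_dist[OF R(1), of x y] R(5) by simp
    then obtain z where z: "R y = Fin z" "cmod z < 1"
      by (rule dist_Fin0_less_1)
    then have y: "y = P z"
      using R(4)[of y] by (simp add: P_def)
    have "cmod (0 - z) \<le> dist (Fin 0) (Fin z)"
      using z by (intro dist_Fin_ge) auto
    then have "cmod z \<le> dist x y"
      using d[of 0 z] by (simp add: P0 y)
    then show ?thesis using y z by blast
  qed
  show thesis
  proof (rule that[of P], unfold disc_chart_def, intro conjI allI impI)
    show "sph_hol P UNIV"
      unfolding P_def by (rule sphere_mapD[OF rotation_map[OF R(2)]]) (auto intro!: sph_hol_Fin holomorphic_intros)
    show "dist (P z) (P w) \<le> 2 * cmod (z - w)" for z w
      using d dist_Fin_le by simp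
    show "cmod z \<le> 1 \<Longrightarrow> cmod w \<le> 1 \<Longrightarrow> cmod (z - w) \<le> dist (P z) (P w)" for z w
      using d dist_Fin_ge by simp
    show "\<exists>g. g holomorphic_on S \<and> (\<forall>z\<in>S. f z = P (g z) \<and> cmod (g z) < 1)"
      if S: "open S" "sph_hol f S" "f ` S \<subseteq> ball x 1" for f S
    proof -
      have l: "sph_hol (\<lambda>z. R (f z)) S"
        using sphere_mapD[OF rotation_map[OF R(1)]] S by blast
      have r: "\<exists>w. R (f z) = Fin w \<and> cmod w < 1" if "z \<in> S" for z
      proof -
        have "dist (Fin 0) (R (f z)) < 1"
          using that S(3) rotation_dist[OF R(1), of x "f z"] R(5) by auto
        then show ?thesis using dist_Fin0_less_1 by metis
      qed
      then have "Infty \<notin> (\<lambda>z. R (f z)) ` S"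
        by force
      with l obtain g where g: "g holomorphic_on S" "\<And>z. z \<in> S \<Longrightarrow> R (f z) = Fin (g z)"
        using sph_hol_finite by blast
      have "f z = P (g z) \<and> cmod (g z) < 1" if "z \<in> S" for z
        using r[OF that] g(2)[OF that] R(4)[of "f z"] by (auto simp: P_def)
      with g show ?thesis by blast
    qed
  qed (use P0 n in auto)
qed

text \<open>Once c is rotated to infinity, the complement of the ball is a Euclidean disc about
  0.\<close>

lemma connected_Compl_cball_rsphere:
  fixes c :: rsphere
  assumes "r > 0"
  shows "connected (- cball c r)"
proof -
  obtain R R' where R: "rotation R" "rotation R'" "\<And>x. R (R' x) = x" "\<And>x. R' (R x) = x" "R c = Infty"
    using rotation_to_Infty[of c] by blast
  \<comment> \<open>For r > 2 this is negative, and so is its \<open>sqrt\<close>; the Euclidean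
    ball is then empty, as is the complement of a chordal ball of that size.\<close>
  define s where "s = (2 / r)\<^sup>2 - 1"
  have iff: "dist Infty (Fin z) > r \<longleftrightarrow> z \<in> ball 0 (sqrt s)" for z
  proof -
    have "dist Infty (Fin z) > r \<longleftrightarrow> sqrt (1 + (cmod z)\<^sup>2) < 2 / r"
      using assms one_plus_cmod_pos[of z] by (simp add: dist_Infty_Fin field_simps)
    also have "\<dots> \<longleftrightarrow> sqrt (1 + (cmod z)\<^sup>2) < sqrt ((2 / r)\<^sup>2)"
      using assms by (simp add: real_sqrt_abs)
    also have "\<dots> \<longleftrightarrow> (cmod z)\<^sup>2 < s"
      unfolding real_sqrt_less_iff s_def by linarith
    also have "\<dots> \<longleftrightarrow> sqrt ((cmod z)\<^sup>2) < sqrt s"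
      unfolding real_sqrt_less_iff ..
    finally show ?thesis by simp
  qed
  have "- cball c r = R' ` Fin ` ball 0 (sqrt s)"
  proof (intro equalityI subsetI)
    fix y assume "y \<in> - cball c r"
    then have y: "dist Infty (R y) > r"
      using R(5) rotation_dist[OF R(1), of c y] by simp
    then obtain z where z: "R y = Fin z"
      using assms by (cases "R y") auto
    with y iff have "z \<in> ball 0 (sqrt s)" by metis
    moreover have "y = R' (Fin z)" using z R(4)[of y] by simp
    ultimately show "y \<in> R' ` Fin ` ball 0 (sqrt s)" by blast
  next
    fix y assume "y \<in> R' ` Fin ` ball 0 (sqrt s)"
    then obtain z where z: "y = R' (Fin z)" "z \<in> ball 0 (sqrt s)" by blast
    have "dist c y = dist Infty (Fin z)"
      using z R(3) R(5) rotation_dist[OF R(1), of c y] by simp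
    with iff[of z] z show "y \<in> - cball c r" by (simp add: not_le)
  qed
  moreover have "connected (R' ` Fin ` ball 0 (sqrt s))"
    using rotation_map[OF R(2)] by (intro connected_continuous_image continuous_on_Fin connected_ball sphere_map_continuous)
  ultimately show ?thesis by simp
qed

subsection \<open>Schottky's theorem on the sphere\<close>

lemma bounded_holomorphic_deriv:
  assumes f: "f holomorphic_on ball a r" and B: "\<And>z. z \<in> ball a r \<Longrightarrow> cmod (f z) \<le> B"
    and x: "x \<in> ball a (r / 2)"
  shows "cmod (deriv f x) \<le> 4 * B / r"
proof -
  have r: "r > 0"
    using x by (metis ball_eq_empty empty_iff half_gt_zero_iff not_le)
  have sub: "cball x (r / 4) \<subseteq> ball a r"
  proof
    fix y assume "y \<in> cball x (r / 4)"
    then have "dist a y \<le> dist a x + r / 4"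
      using dist_triangle[of a y x] by (simp add: dist_commute)
    then show "y \<in> ball a r" using x r by simp
  qed
  have "cmod ((deriv ^^ 1) f x) \<le> fact 1 * B / (r / 4) ^ 1"
  proof (rule Cauchy_inequality)
    show "f holomorphic_on ball x (r / 4)" "continuous_on (cball x (r / 4)) f"
      using f sub by (meson holomorphic_on_subset ball_subset_cball order_trans holomorphic_on_imp_continuous_on)+
    show "cmod (f y) \<le> B" if "cmod (x - y) = r / 4" for y
      using sub that r by (intro B) (auto simp: dist_norm)
  qed (use r in auto)
  then show ?thesis using r by (simp add: field_simps)
qed

lemma bounded_holomorphic_lipschitz:
  assumes f: "f holomorphic_on ball a r" and B: "\<And>z. z \<in> ball a r \<Longrightarrow> cmod (f z) \<le> B"
    and zw: "z \<in> ball a (r / 2)" "w \<in> ball a (r / 2)"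
  shows "cmod (f z - f w) \<le> 4 * B / r * cmod (z - w)"
proof -
  have r: "r > 0"
    using zw(1) by (metis ball_eq_empty empty_iff half_gt_zero_iff not_le)
  have "(f has_field_derivative deriv f x) (at x within ball a (r / 2))" if x: "x \<in> ball a (r / 2)" for x
  proof -
    have "x \<in> ball a r" using x r by simp
    from holomorphic_derivI[OF f open_ball this] show ?thesis
      by (rule has_field_derivative_at_within)
  qed
  then show ?thesis
    using zw bounded_holomorphic_deriv[OF f B]
    by (intro field_differentiable_bound[OF convex_ball, of a "r/2" f "deriv f"]) auto
qed

text \<open>This is the price, in the chordal metric, of undoing the normalization that moves two
  finite omitted values to 0 and 1. It comes from comparing 1 + |w|^2 with 1 + |a + c w|^2, whose
  ratio is at most Q.\<close>

lemma dist_affine_le: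
  assumes "c \<noteq> 0"
  shows "dist (Fin (a + c * w)) (Fin (a + c * w')) \<le> (cmod c + 2 * (1 + (cmod a)\<^sup>2) / cmod c) * dist (Fin w) (Fin w')"
proof -
  define Q where "Q = 1 + 2 * (1 + (cmod a)\<^sup>2) / (cmod c)\<^sup>2"
  have Q: "Q > 0" unfolding Q_def using assms by (intro add_pos_nonneg) auto
  have s: "sqrt (1 + (cmod w)\<^sup>2) \<le> sqrt Q * sqrt (1 + (cmod (a + c * w))\<^sup>2)" for w
  proof -
    have "cmod c * cmod w \<le> cmod (a + c * w) + cmod a"
      using norm_triangle_ineq4[of "a + c * w" a] by (simp add: norm_mult)
    then have "(cmod c * cmod w)\<^sup>2 \<le> (cmod (a + c * w) + cmod a)\<^sup>2"
      by (intro power_mono) auto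
    also have "\<dots> \<le> 2 * ((cmod (a + c * w))\<^sup>2 + (cmod a)\<^sup>2)"
      using sum_squares_bound[of "cmod (a + c * w)" "cmod a"] by (simp add: power2_sum)
    also have "\<dots> \<le> 2 * ((1 + (cmod a)\<^sup>2) * (1 + (cmod (a + c * w))\<^sup>2))"
      by (simp add: algebra_simps)
    finally have "(cmod w)\<^sup>2 \<le> 2 * (1 + (cmod a)\<^sup>2) / (cmod c)\<^sup>2 * (1 + (cmod (a + c * w))\<^sup>2)"
      using assms by (simp add: power_mult_distrib field_simps)
    moreover have "1 + (cmod w)\<^sup>2 \<le> Q * (1 + (cmod (a + c * w))\<^sup>2)"
      if "(cmod w)\<^sup>2 \<le> 2 * (1 + (cmod a)\<^sup>2) / (cmod c)\<^sup>2 * (1 + (cmod (a + c * w))\<^sup>2)"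
    proof -
      have "1 \<le> 1 + (cmod (a + c * w))\<^sup>2" by simp
      from add_mono[OF this that] show ?thesis by (simp only: Q_def distrib_right mult_1)
    qed
    ultimately have "sqrt (1 + (cmod w)\<^sup>2) \<le> sqrt (Q * (1 + (cmod (a + c * w))\<^sup>2))"
      by (intro real_sqrt_le_mono)
    then show ?thesis by (simp add: real_sqrt_mult)
  qed
  define t where "t = (\<lambda>w::complex. sqrt (1 + (cmod w)\<^sup>2))"
  have t: "t w > 0" for w by (simp add: t_def one_plus_cmod_pos)
  have "t w * t w' \<le> (sqrt Q * t (a + c * w)) * (sqrt Q * t (a + c * w'))"
    using s[of w] s[of w'] t[of w] t[of w'] t[of "a + c * w"] Q
    by (intro mult_mono) (auto simp: t_def)
  also have "\<dots> = Q * (t (a + c * w) * t (a + c * w'))"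
    using Q by simp
  finally have le: "t w * t w' \<le> Q * (t (a + c * w) * t (a + c * w'))" .
  have "dist (Fin (a + c * w)) (Fin (a + c * w')) = 2 * (cmod c * cmod (w - w')) / (t (a + c * w) * t (a + c * w'))"
    unfolding dist_Fin_Fin t_def by (simp add: norm_mult[symmetric] algebra_simps)
  also have "\<dots> \<le> cmod c * Q * (2 * cmod (w - w') / (t w * t w'))"
  proof -
    have "2 * (cmod c * cmod (w - w')) * (t w * t w') \<le> 2 * (cmod c * cmod (w - w')) * (Q * (t (a + c * w) * t (a + c * w')))"
      by (intro mult_left_mono le) auto
    then show ?thesis
      using t[of w] t[of w'] t[of "a + c * w"] t[of "a + c * w'"]
      by (simp add: field_simps)
  qed
  also have "cmod c * Q = cmod c + 2 * (1 + (cmod a)\<^sup>2) / cmod c"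
    unfolding Q_def using assms by (simp add: field_simps power2_eq_square)
  finally show ?thesis by (simp add: dist_Fin_Fin t_def)
qed

text \<open>Omitting such a triple is the quantitative version of omitting three values: the bounds
  then depend on d only and not on the triple.\<close>

definition sep3 :: "real \<Rightarrow> rsphere set \<Rightarrow> bool"
  where "sep3 d S \<longleftrightarrow> (\<exists>a\<in>S. \<exists>b\<in>S. \<exists>c\<in>S. d \<le> dist a b \<and> d \<le> dist a c \<and> d \<le> dist b c)"

lemma sep3_mono: "sep3 d S \<Longrightarrow> S \<subseteq> T \<Longrightarrow> sep3 d T"
  unfolding sep3_def by blast

text \<open>If |F 0| is at most 1, Schottky's theorem bounds F near 0 and Cauchy's estimate makes it
  Lipschitz. Otherwise pass to 1/F, which omits 0 and 1 as well; inversion does not change chordal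
  distances.\<close>

lemma Schottky_lipschitz:
  obtains B where "B > 0" "\<And>F z. F holomorphic_on ball 0 1 \<Longrightarrow> 0 \<notin> F ` ball 0 1 \<Longrightarrow> 1 \<notin> F ` ball 0 1 \<Longrightarrow>
      cmod z < 1/8 \<Longrightarrow> dist (Fin (F z)) (Fin (F 0)) \<le> B * cmod z"
proof -
  define B1 :: real where "B1 = exp (pi * exp (pi * (2 + 2 * 1 + 12 * (1/2) / (1 - 1/2))))"
  have small: "dist (Fin (F z)) (Fin (F 0)) \<le> 32 * B1 * cmod z"
    if F: "F holomorphic_on ball 0 1" "0 \<notin> F ` ball 0 1" "1 \<notin> F ` ball 0 1" and F0: "cmod (F 0) \<le> 1"
      and z: "cmod z < 1/8" for F z
  proof -
    have "cmod (F w) \<le> B1" if w: "w \<in> ball 0 (1/4)" for w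
    proof -
      \<comment> \<open>The function F (z / 2) is holomorphic up to the boundary of the unit disc;
        the argument 2 w then has modulus at most t = 1/2.\<close>
      have "cmod (F (2 * w / 2)) \<le> exp (pi * exp (pi * (2 + 2 * 1 + 12 * (1/2) / (1 - 1/2))))"
      proof (rule Schottky[where f="\<lambda>z. F (z / 2)" and z="2 * w" and t="1/2" and r=1])
        have im: "(\<lambda>z::complex. z / 2) ` cball 0 1 \<subseteq> ball 0 1" by auto
        have "F \<circ> (\<lambda>z. z / 2) holomorphic_on cball 0 1"
          by (rule holomorphic_on_compose_gen[OF _ F(1) im]) (intro holomorphic_intros, simp)
        then show "(\<lambda>z. F (z / 2)) holomorphic_on cball 0 1" by (simp add: o_def)
        show "\<not> (F (u / 2) = 0 \<or> F (u / 2) = 1)" if "u \<in> cball 0 1" for u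
          using that im F(2,3) by (metis image_eqI image_subset_iff)
      qed (use F0 w in \<open>auto simp: norm_mult\<close>)
      then show ?thesis by (simp add: B1_def)
    qed
    then have "cmod (F z - F 0) \<le> 4 * B1 / (1/4) * cmod (z - 0)"
      using z by (intro bounded_holomorphic_lipschitz[where a=0] holomorphic_on_subset[OF F(1)]) auto
    then have "2 * cmod (F z - F 0) \<le> 32 * B1 * cmod z" by simp
    then show ?thesis using dist_Fin_le order_trans by blast
  qed
  show thesis
  proof (rule that[of "32 * B1"])
    show "dist (Fin (F z)) (Fin (F 0)) \<le> 32 * B1 * cmod z"
      if F: "F holomorphic_on ball 0 1" "0 \<notin> F ` ball 0 1" "1 \<notin> F ` ball 0 1" "cmod z < 1/8" for F z
    proof (cases "cmod (F 0) \<le> 1")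
      case False
      have nz: "F w \<noteq> 0" if "w \<in> ball 0 1" for w using F(2) that by force
      have "dist (Fin (inverse (F z))) (Fin (inverse (F 0))) \<le> 32 * B1 * cmod z"
      proof (rule small)
        show "(\<lambda>z. inverse (F z)) holomorphic_on ball 0 1"
          using F(1) nz by (intro holomorphic_intros) auto
        show "0 \<notin> (\<lambda>z. inverse (F z)) ` ball 0 1" "1 \<notin> (\<lambda>z. inverse (F z)) ` ball 0 1"
          using F(3) nz by (force simp: image_iff)+
        show "cmod (inverse (F 0)) \<le> 1" using False by (simp add: norm_inverse inverse_le_1_iff)
      qed (use F in auto)
      moreover have "dist (Fin (inverse (F z))) (Fin (inverse (F 0))) = dist (Fin (F z)) (Fin (F 0))"
        using dist_sphere_inv[of "Fin (F z)" "Fin (F 0)"] nz[of z] nz[of 0] F(4) by (simp add: sphere_inv_def)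
      ultimately show ?thesis by simp
    qed (use F small in auto)
  qed (simp add: B1_def)
qed

text \<open>Rotate the third omitted point to infinity and move the other two to 0 and 1 by an
  affine map; the separation d keeps the distortion of this normalization bounded.\<close>

lemma sphere_Schottky:
  assumes "d > 0"
  obtains K where "K > 0" "\<And>f r a z. sph_hol f (ball a r) \<Longrightarrow> sep3 d (- f ` ball a r) \<Longrightarrow>
      cmod (z - a) < r / 8 \<Longrightarrow> dist (f z) (f a) \<le> K * cmod (z - a) / r"
proof -
  obtain B where B: "B > 0" "\<And>F z. F holomorphic_on ball 0 1 \<Longrightarrow> 0 \<notin> F ` ball 0 1 \<Longrightarrow> 1 \<notin> F ` ball 0 1 \<Longrightarrow>
      cmod z < 1/8 \<Longrightarrow> dist (Fin (F z)) (Fin (F 0)) \<le> B * cmod z"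
    using Schottky_lipschitz by blast
  \<comment> \<open>The first factor bounds the constant of \<open>dist_affine_le\<close>: after the
    rotation both finite omitted values have modulus at most 2 / d, and their distance lies between
    d / 2 and 4 / d.\<close>
  define K where "K = (4 / d + 2 * (1 + (2 / d)\<^sup>2) / (d / 2)) * B"
  have K: "K > 0"
    unfolding K_def using assms B(1) by (intro mult_pos_pos add_pos_nonneg) auto
  have unit: "dist (f z) (f 0) \<le> K * cmod z"
    if f: "sph_hol f (ball 0 1)" and sep: "sep3 d (- f ` ball 0 1)" and z: "cmod z < 1/8" for f z
  proof -
    obtain a b c where abc: "a \<notin> f ` ball 0 1" "b \<notin> f ` ball 0 1" "c \<notin> f ` ball 0 1"
      "d \<le> dist a b" "d \<le> dist a c" "d \<le> dist b c"
      using sep unfolding sep3_def by blast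
    obtain R R' where R: "rotation R" "rotation R'" "\<And>x. R (R' x) = x" "\<And>x. R' (R x) = x" "R c = Infty"
      using rotation_to_Infty[of c] by blast
    have Rinj: "R x = R y \<Longrightarrow> x = y" for x y using R(4) by metis
    have fin: "\<exists>u. R x = Fin u \<and> cmod u \<le> 2 / d" if "d \<le> dist x c" for x
    proof -
      have D: "dist (R x) Infty \<ge> d" using that R(5) rotation_dist[OF R(1), of x c] by simp
      then obtain u where u: "R x = Fin u" using assms by (cases "R x") auto
      have "cmod u \<le> sqrt (1 + (cmod u)\<^sup>2)" by (rule real_le_rsqrt) simp
      moreover have "sqrt (1 + (cmod u)\<^sup>2) \<le> 2 / d"
        using D assms one_plus_cmod_pos[of u] by (simp add: u dist_Fin_Infty field_simps)
      ultimately show ?thesis using u by force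
    qed
    obtain \<alpha> where \<alpha>: "R a = Fin \<alpha>" "cmod \<alpha> \<le> 2 / d" using fin abc(5) by blast
    obtain \<beta> where \<beta>: "R b = Fin \<beta>" "cmod \<beta> \<le> 2 / d" using fin abc(6) by blast
    have "d \<le> dist (Fin \<alpha>) (Fin \<beta>)" using abc(4) rotation_dist[OF R(1), of a b] \<alpha> \<beta> by simp
    then have dab: "d / 2 \<le> cmod (\<beta> - \<alpha>)" using dist_Fin_le[of \<alpha> \<beta>] by (simp add: norm_minus_commute)
    then have ne: "\<beta> - \<alpha> \<noteq> 0" using assms by auto
    have "sph_hol (\<lambda>z. R (f z)) (ball 0 1)"
      using sphere_mapD[OF rotation_map[OF R(1)]] f by blast
    moreover have "Infty \<notin> (\<lambda>z. R (f z)) ` ball 0 1"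
    proof
      assume "Infty \<in> (\<lambda>z. R (f z)) ` ball 0 1"
      then obtain z where z: "z \<in> ball 0 1" "Infty = R (f z)" by (rule imageE)
      then have "R (f z) = R c" by (simp only: R(5))
      then have "f z = c" by (rule Rinj)
      with z(1) abc(3) show False by blast
    qed
    ultimately obtain g where g: "g holomorphic_on ball 0 1" "\<And>z. z \<in> ball 0 1 \<Longrightarrow> R (f z) = Fin (g z)"
      using sph_hol_finite by blast
    define F where "F = (\<lambda>z. (g z - \<alpha>) / (\<beta> - \<alpha>))"
    have F: "F holomorphic_on ball 0 1"
      unfolding F_def using ne by (intro holomorphic_intros g) auto
    have gF: "g z = \<alpha> + (\<beta> - \<alpha>) * F z" for z
      unfolding F_def using ne by (simp add: field_simps)
    have F01: "F z \<noteq> 0" "F z \<noteq> 1" if "z \<in> ball 0 1" for z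
    proof -
      have "f z \<noteq> a" "f z \<noteq> b" using that abc by blast+
      then have "R (f z) \<noteq> R a" "R (f z) \<noteq> R b" using Rinj by metis+
      then have "g z \<noteq> \<alpha>" "g z \<noteq> \<beta>" using g(2)[OF that] \<alpha> \<beta> by auto
      then show "F z \<noteq> 0" "F z \<noteq> 1" unfolding F_def using ne by auto
    qed
    have "dist (f z) (f 0) = dist (Fin (g z)) (Fin (g 0))"
      using rotation_dist[OF R(1), of "f z" "f 0"] g(2)[of z] g(2)[of 0] z by simp
    also have "\<dots> \<le> (cmod (\<beta> - \<alpha>) + 2 * (1 + (cmod \<alpha>)\<^sup>2) / cmod (\<beta> - \<alpha>)) * dist (Fin (F z)) (Fin (F 0))"
      unfolding gF by (rule dist_affine_le[OF ne])
    also have "\<dots> \<le> (4 / d + 2 * (1 + (2 / d)\<^sup>2) / (d / 2)) * (B * cmod z)"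
    proof (rule mult_mono)
      show "cmod (\<beta> - \<alpha>) + 2 * (1 + (cmod \<alpha>)\<^sup>2) / cmod (\<beta> - \<alpha>) \<le> 4 / d + 2 * (1 + (2 / d)\<^sup>2) / (d / 2)"
      proof (rule add_mono)
        show "cmod (\<beta> - \<alpha>) \<le> 4 / d" using norm_triangle_ineq4[of \<beta> \<alpha>] \<alpha>(2) \<beta>(2) by simp
        show "2 * (1 + (cmod \<alpha>)\<^sup>2) / cmod (\<beta> - \<alpha>) \<le> 2 * (1 + (2 / d)\<^sup>2) / (d / 2)"
          using dab assms \<alpha>(2) by (intro frac_le mult_left_mono add_left_mono power_mono) auto
      qed
      show "dist (Fin (F z)) (Fin (F 0)) \<le> B * cmod z" using F F01 z by (intro B(2)) auto
    qed (use assms in auto)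
    finally show ?thesis by (simp add: K_def mult.assoc)
  qed
  show thesis
  proof (rule that[OF K])
    fix f and r :: real and a z
    assume f: "sph_hol f (ball a r)" and s: "sep3 d (- f ` ball a r)" and z: "cmod (z - a) < r / 8"
    have r: "r > 0" using z norm_ge_zero[of "z - a"] by linarith
    have im: "(\<lambda>w. a + of_real r * w) ` ball 0 1 \<subseteq> ball a r"
      using r by (auto simp: dist_norm norm_mult)
    have "sph_hol (\<lambda>w. f (a + of_real r * w)) (ball 0 1)"
      by (rule sph_hol_reparam[OF f _ im]) (auto intro!: holomorphic_intros)
    moreover have "sep3 d (- (\<lambda>w. f (a + of_real r * w)) ` ball 0 1)"
      by (rule sep3_mono[OF s]) (use im in auto)
    ultimately have "dist (f (a + of_real r * ((z - a) / of_real r))) (f (a + of_real r * 0)) \<le> K * cmod ((z - a) / of_real r)"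
      using z r by (intro unit) (auto simp: norm_divide field_simps)
    then show "dist (f z) (f a) \<le> K * cmod (z - a) / r"
      using r by (simp add: norm_divide)
  qed
qed

section \<open>Equicontinuity and local properties of maps of the sphere\<close>

definition eqc :: "('a::metric_space \<Rightarrow> 'b::metric_space) set \<Rightarrow> 'a \<Rightarrow> bool"
  where "eqc \<F> x \<longleftrightarrow> (\<forall>e>0. \<exists>d>0. \<forall>f\<in>\<F>. \<forall>w. dist w x < d \<longrightarrow> dist (f w) (f x) < e)"

text \<open>Montel's theorem in the form used throughout: each f may omit a triple of its own, as
  long as all triples are d-separated.\<close>

lemma sep3_imp_eqc:
  assumes "d > 0" "open U" "x \<in> U" and \<F>: "\<And>f. f \<in> \<F> \<Longrightarrow> sphere_map f" "\<And>f. f \<in> \<F> \<Longrightarrow> sep3 d (- f ` U)"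
  shows "eqc \<F> x"
proof -
  obtain K where K: "K > 0" "\<And>f r a z. sph_hol f (ball a r) \<Longrightarrow> sep3 d (- f ` ball a r) \<Longrightarrow>
      cmod (z - a) < r / 8 \<Longrightarrow> dist (f z) (f a) \<le> K * cmod (z - a) / r"
    using sphere_Schottky[OF assms(1)] by blast
  obtain P where "disc_chart P x"
    by (rule ex_disc_chart)
  note P = disc_chartD[OF this]
  obtain r where r: "r > 0" "ball x (2 * r) \<subseteq> U"
  proof -
    obtain s where "s > 0" "ball x s \<subseteq> U"
      using assms(2,3) open_contains_ball by blast
    then show thesis using that[of "s/2"] by simp
  qed
  have im: "P ` ball 0 r \<subseteq> U"
  proof
    fix y assume "y \<in> P ` ball 0 r"
    then obtain z where z: "y = P z" "cmod z < r" by auto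
    have "dist x y \<le> 2 * cmod z" using P(3)[of 0 z] P(2) z(1) by simp
    then show "y \<in> U" using z r by auto
  qed
  show ?thesis
    unfolding eqc_def
  proof (intro allI impI)
    fix e :: real assume e: "e > 0"
    define \<delta> where "\<delta> = min 1 (min (r / 8) (e * r / K))"
    have \<delta>: "\<delta> > 0" using e r K(1) by (simp add: \<delta>_def)
    show "\<exists>d>0. \<forall>f\<in>\<F>. \<forall>w. dist w x < d \<longrightarrow> dist (f w) (f x) < e"
    proof (intro exI[of _ \<delta>] conjI \<delta> ballI allI impI)
      fix f w assume f: "f \<in> \<F>" and w: "dist w x < \<delta>"
      have "dist x w < 1" using w by (simp add: \<delta>_def dist_commute)
      then obtain z where z: "w = P z" "cmod z \<le> dist x w" using P(5) by blast
      have z8: "cmod z < r / 8" "cmod z < e * r / K" using z w by (auto simp: \<delta>_def dist_commute)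
      have "sph_hol (\<lambda>z. f (P z)) (ball 0 r)"
        using sphere_mapD[OF \<F>(1)[OF f] open_ball sph_hol_subset[OF P(1)]] by simp
      moreover have "sep3 d (- (\<lambda>z. f (P z)) ` ball 0 r)"
        by (rule sep3_mono[OF \<F>(2)[OF f]]) (use im in auto)
      ultimately have "dist (f (P z)) (f (P 0)) \<le> K * cmod (z - 0) / r"
        using z8 by (intro K(2)) auto
      also have "\<dots> < e" using z8(2) K(1) r(1) by (simp add: field_simps)
      finally show "dist (f w) (f x) < e" using z P(2) by simp
    qed
  qed
qed

text \<open>With c rotated to 0, the points 1, -1 and infinity lie at distance at least sqrt 2 from
  it and from each other. Hence images inside balls of radius 1 qualify for
  \<open>sep3_imp_eqc\<close>.\<close>

lemma small_image_sep3:
  assumes "S \<subseteq> cball c 1"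
  shows "sep3 1 (- S)"
proof -
  obtain R R' where R: "rotation R" "rotation R'" "\<And>x. R (R' x) = x" "\<And>x. R' (R x) = x" "R c = Fin 0"
    using rotation_to_0[of c] by blast
  have c: "c = R' (Fin 0)" using R(4)[of c] R(5) by simp
  have s2: "1 < sqrt 2" by simp
  have out: "R' x \<in> - S" if "1 < dist (Fin 0) x" for x
  proof -
    have "dist c (R' x) = dist (Fin 0) x" unfolding c by (rule rotation_dist[OF R(2)])
    then show ?thesis using assms that by (metis ComplI mem_cball not_le subsetD)
  qed
  have "2 / sqrt 2 = sqrt 2" by (simp add: real_div_sqrt)
  then have "R' (Fin 1) \<in> - S" "R' (Fin (-1)) \<in> - S" "R' Infty \<in> - S"
    by (intro out; simp add: dist_Fin_Fin dist_Fin_Infty)+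
  moreover have "1 \<le> dist (R' (Fin 1)) (R' (Fin (-1)))" "1 \<le> dist (R' (Fin 1)) (R' Infty)" "1 \<le> dist (R' (Fin (-1))) (R' Infty)"
    unfolding rotation_dist[OF R(2)] by (simp_all add: dist_Fin_Fin dist_Fin_Infty \<open>2 / sqrt 2 = sqrt 2\<close>)
  ultimately show ?thesis unfolding sep3_def by blast
qed

text \<open>Finite fibres prevent the map from being constant near any point, so the open mapping
  theorem applies in charts.\<close>

lemma sphere_map_open:
  assumes h: "sphere_map h" and fin: "\<And>b. finite (h -` {b})" and U: "open U"
  shows "open (h ` U)"
  unfolding open_contains_ball
proof
  fix y assume "y \<in> h ` U"
  then obtain x where x: "x \<in> U" "y = h x" by blast
  obtain P where "disc_chart P x"
    by (rule ex_disc_chart)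
  note P = disc_chartD[OF this]
  obtain Q where "disc_chart Q (h x)"
    by (rule ex_disc_chart)
  note Q = disc_chartD[OF this]
  have "open (U \<inter> h -` ball (h x) 1)"
    using U sphere_map_continuous[OF h, of UNIV] by (intro open_Int open_vimage) auto
  moreover have "x \<in> U \<inter> h -` ball (h x) 1" using x by simp
  ultimately obtain s where s: "s > 0" "ball x s \<subseteq> U \<inter> h -` ball (h x) 1"
    unfolding open_contains_ball by blast
  define \<rho> where "\<rho> = min 1 (s / 2)"
  have \<rho>: "\<rho> > 0" "\<rho> \<le> 1" using s by (auto simp: \<rho>_def)
  have im: "P z \<in> U \<and> h (P z) \<in> ball (h x) 1" if "z \<in> ball 0 \<rho>" for z
  proof -
    have "dist x (P z) < s" using P(3)[of 0 z] P(2) that by (auto simp: \<rho>_def)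
    then show ?thesis using s(2) by auto
  qed
  have hol: "sph_hol (\<lambda>z. h (P z)) (ball 0 \<rho>)"
    using sphere_mapD[OF h open_ball sph_hol_subset[OF P(1)]] by simp
  have sub: "(\<lambda>z. h (P z)) ` ball 0 \<rho> \<subseteq> ball (h x) 1" using im by blast
  obtain g where g: "g holomorphic_on ball 0 \<rho>" "\<And>z. z \<in> ball 0 \<rho> \<Longrightarrow> h (P z) = Q (g z) \<and> cmod (g z) < 1"
    using Q(6)[OF open_ball hol sub] by blast
  have g0: "g 0 = 0"
  proof -
    have "Q (g 0) = Q 0" "cmod (g 0) < 1" using g(2)[of 0] \<rho> P(2) Q(2) by auto
    then show ?thesis using Q(4)[of "g 0" 0] by simp
  qed
  have "\<not> g constant_on ball 0 \<rho>"
  proof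
    assume "g constant_on ball 0 \<rho>"
    then have "g z = 0" if "z \<in> ball 0 \<rho>" for z
      using that g0 \<rho>(1) unfolding constant_on_def by (metis centre_in_ball)
    then have "P ` ball 0 \<rho> \<subseteq> h -` {h x}" using g(2) Q(2) by auto
    then have "finite (P ` ball 0 \<rho>)" using fin finite_subset by blast
    moreover have "inj_on P (ball 0 \<rho>)"
    proof (rule inj_onI)
      fix z w assume "z \<in> ball 0 \<rho>" "w \<in> ball 0 \<rho>" "P z = P w"
      then show "z = w" using P(4)[of z w] \<rho>(2) by simp
    qed
    ultimately have "finite (ball (0::complex) \<rho>)" using finite_imageD by blast
    then show False
      using \<rho>(1) not_open_singleton finite_imp_not_open by (metis ball_eq_empty not_le open_ball)
  qed
  then have "open (g ` ball 0 \<rho>)"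
    by (intro open_mapping_thm[OF g(1)]) auto
  moreover have "0 \<in> g ` ball 0 \<rho>" using g0 \<rho>(1) by (metis centre_in_ball image_eqI)
  ultimately obtain \<epsilon> where \<epsilon>: "\<epsilon> > 0" "ball 0 \<epsilon> \<subseteq> g ` ball 0 \<rho>"
    unfolding open_contains_ball by blast
  show "\<exists>e>0. ball y e \<subseteq> h ` U"
  proof (intro exI[of _ "min 1 \<epsilon>"] conjI subsetI)
    fix v assume v: "v \<in> ball y (min 1 \<epsilon>)"
    then obtain z where z: "v = Q z" "cmod z \<le> dist (h x) v" using Q(5)[of v] x by auto
    then have "z \<in> ball 0 \<epsilon>" using v x by simp
    then obtain u where u: "u \<in> ball 0 \<rho>" "z = g u" using \<epsilon>(2) by blast
    then have "v = h (P u)" "P u \<in> U" using g(2) im z by auto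
    then show "v \<in> h ` U" by blast
  qed (use \<epsilon> in auto)
qed

lemma sphere_map_surj:
  assumes h: "sphere_map h" and fin: "\<And>b. finite (h -` {b})"
  shows "surj h"
proof -
  have "open (h ` UNIV)" using sphere_map_open[OF h fin open_UNIV] .
  moreover have "closed (h ` UNIV)"
    by (intro compact_imp_closed compact_continuous_image sphere_map_continuous h compact_UNIV_rsphere)
  ultimately show ?thesis
    using connected_UNIV_rsphere unfolding connected_clopen by auto
qed

text \<open>Two points with the same image are closer than 1/16, hence visible in one chart. There
  the map minus the identity is at most 1/32 on a disc of radius 1/4, so by Cauchy it has Lipschitz
  constant 1/2 < 1 on the half disc, too small to let the two points collide.\<close>

lemma near_identity_imp_inj:
  assumes h: "sphere_map h" and near: "\<And>x. dist (h x) x < 1 / 32"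
  shows "inj h"
proof (rule injI, rule ccontr)
  fix x y assume eq: "h x = h y" and ne: "x \<noteq> y"
  obtain P where "disc_chart P x"
    by (rule ex_disc_chart)
  note P = disc_chartD[OF this]
  have "dist x y \<le> dist (h x) x + dist (h y) y"
    using dist_triangle2[of x y "h x"] eq by (simp add: dist_commute)
  then have xy: "dist x y < 1 / 16" using near[of x] near[of y] by linarith
  then obtain w where w: "y = P w" "cmod w < 1 / 16" using P(5)[of y] by force
  have w0: "w \<noteq> 0" using w ne P(2) by auto
  have "h (P z) \<in> ball x 1" if "z \<in> ball 0 (1/4)" for z
    using near[of "P z"] P(3)[of 0 z] P(2) that dist_triangle[of x "h (P z)" "P z"] by (simp add: dist_commute)
  then have sub: "(\<lambda>z. h (P z)) ` ball 0 (1/4) \<subseteq> ball x 1" by blast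
  have hol: "sph_hol (\<lambda>z. h (P z)) (ball 0 (1/4))"
    using sphere_mapD[OF h open_ball sph_hol_subset[OF P(1)]] by simp
  obtain g where g: "g holomorphic_on ball 0 (1/4)" "\<And>z. z \<in> ball 0 (1/4) \<Longrightarrow> h (P z) = P (g z) \<and> cmod (g z) < 1"
    using P(6)[OF open_ball hol sub] by blast
  have "cmod ((g w - w) - (g 0 - 0)) \<le> 4 * (1/32) / (1/4) * cmod (w - 0)"
  proof (rule bounded_holomorphic_lipschitz[where a=0])
    show "(\<lambda>w. g w - w) holomorphic_on ball 0 (1/4)" by (intro holomorphic_intros g)
    show "cmod (g z - z) \<le> 1 / 32" if "z \<in> ball 0 (1/4)" for z
      using P(4)[of "g z" z] g(2)[OF that] near[of "P z"] that by (simp add: less_imp_le)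
  qed (use w in auto)
  moreover have "g w = g 0"
  proof -
    have "P (g w) = P (g 0)" "cmod (g w) < 1" "cmod (g 0) < 1" using g(2)[of w] g(2)[of 0] w P(2) eq by auto
    then show ?thesis using P(4)[of "g w" "g 0"] by simp
  qed
  ultimately show False using w0 by (simp add: norm_minus_commute)
qed

text \<open>The last clause asks for values with two distinct preimages densely in the target: a
  totally ramified value has a single preimage itself, but values arbitrarily near it have
  several.\<close>

definition branched :: "(rsphere \<Rightarrow> rsphere) \<Rightarrow> bool"
  where "branched h \<longleftrightarrow> sphere_map h \<and> (\<forall>b. finite (h -` {b})) \<and>
    (\<forall>U. open U \<longrightarrow> U \<noteq> {} \<longrightarrow> (\<exists>x y. x \<noteq> y \<and> h x = h y \<and> h x \<in> U))"

section \<open>Nearby preimages force quadratic contraction\<close>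

text \<open>The radius 2 \<delta> exceeds the output \<delta> / 4, so the estimate can be iterated
  along an orbit whose fibres stay concentrated.\<close>

definition contracts :: "real \<Rightarrow> (rsphere \<Rightarrow> rsphere) \<Rightarrow> bool"
  where "contracts \<delta> h \<longleftrightarrow> (\<forall>a z. h -` {h a} \<subseteq> cball a \<delta> \<longrightarrow> dist a z \<le> 2 * \<delta> \<longrightarrow> dist (h a) (h z) \<le> \<delta> / 4)"

lemma contractsD: "contracts \<delta> h \<Longrightarrow> h -` {h a} \<subseteq> cball a \<delta> \<Longrightarrow> dist a z \<le> 2 * \<delta> \<Longrightarrow> dist (h a) (h z) \<le> \<delta> / 4"
  by (simp add: contracts_def)

text \<open>Values close to \<open>h a\<close> have their whole fibre near a, and some of them have
  two distinct preimages there. In charts this gives g z1 = g z2, so g' is O(\<delta>) at z1 and, by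
  a Lipschitz bound for g', on the whole 2 \<delta>-disc; integrating once more gives a displacement
  O(\<delta>^2).\<close>

lemma contraction_near_critical:
  assumes br: "\<And>h. h \<in> L \<Longrightarrow> branched h"
    and unif: "\<And>e. e > 0 \<Longrightarrow> \<exists>d>0. \<forall>h\<in>L. \<forall>x y. dist x y < d \<longrightarrow> dist (h x) (h y) < e"
  obtains \<delta>0 where "\<delta>0 > 0" "\<delta>0 \<le> 1 / 2" "\<forall>\<delta> h. 0 < \<delta> \<longrightarrow> \<delta> \<le> \<delta>0 \<longrightarrow> h \<in> L \<longrightarrow> contracts \<delta> h"
proof -
  obtain d where d: "d > 0" "\<And>h x y. h \<in> L \<Longrightarrow> dist x y < d \<Longrightarrow> dist (h x) (h y) < 1 / 2"
    using unif[of "1/2"] by auto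
  define r where "r = min 1 (d / 2)"
  have r: "r > 0" "r \<le> 1" "2 * r \<le> d" using d(1) by (auto simp: r_def)
  \<comment> \<open>The final bound is 1024 \<delta>^2 / r^2, and it is at most \<delta> / 4 exactly
    when 4096 \<delta> is at most r^2.\<close>
  define \<delta>0 where "\<delta>0 = r\<^sup>2 / 4096"
  have "r\<^sup>2 \<le> 1" using r by (simp add: power_le_one)
  then have \<delta>0: "\<delta>0 > 0" "\<delta>0 \<le> 1 / 2" using r by (simp_all add: \<delta>0_def)
  show thesis
  proof (rule that[OF \<delta>0], unfold contracts_def, intro allI impI)
    fix \<delta> h a z
    assume \<delta>: "0 < \<delta>" "\<delta> \<le> \<delta>0" and h: "h \<in> L" and fib: "h -` {h a} \<subseteq> cball a \<delta>" and z: "dist a z \<le> 2 * \<delta>"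
    have "r\<^sup>2 \<le> r" using r by (simp add: power2_eq_square mult_left_le)
    then have \<delta>r: "4096 * \<delta> \<le> r\<^sup>2" "4096 * \<delta> \<le> r" using \<delta>(2) by (auto simp: \<delta>0_def)
    have sm: "sphere_map h" using br[OF h] by (simp add: branched_def)
    \<comment> \<open>A compact set that misses \<open>h a\<close>, as the fibre is inside the
      smaller ball. Values off B have all their preimages within 2 \<delta> of a.\<close>
    define B where "B = h ` (- ball a (2 * \<delta>))"
    have "closed B"
      unfolding B_def
      by (intro compact_imp_closed compact_continuous_image sphere_map_continuous sm) (simp add: compact_rsphere_iff_closed closed_Compl)
    moreover have "h a \<notin> B"
    proof
      assume "h a \<in> B"
      then obtain x where x: "h a = h x" "x \<notin> ball a (2 * \<delta>)" unfolding B_def by blast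
      then have "x \<in> cball a \<delta>" using fib by auto
      then show False using x(2) \<delta>(1) by simp
    qed
    ultimately have "open (ball (h a) (1/2) - B)" "h a \<in> ball (h a) (1/2) - B"
      by (auto simp: open_Diff)
    then obtain x1 x2 where x: "x1 \<noteq> x2" "h x1 = h x2" "h x1 \<in> ball (h a) (1/2) - B"
      using br[OF h] unfolding branched_def by blast
    have "w \<in> ball a (2 * \<delta>)" if "h w = h x1" for w
    proof (rule ccontr)
      assume "w \<notin> ball a (2 * \<delta>)"
      then have "h w \<in> B" unfolding B_def by blast
      then show False using x(3) that by simp
    qed
    then have "x1 \<in> ball a (2 * \<delta>)" "x2 \<in> ball a (2 * \<delta>)" using x(2) by metis+
    then have xa: "dist a x1 < 2 * \<delta>" "dist a x2 < 2 * \<delta>" by auto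
    have \<delta>1: "2 * \<delta> < 1" using \<delta>r r \<delta> by linarith
    obtain P where "disc_chart P a"
      by (rule ex_disc_chart)
    note P = disc_chartD[OF this]
    obtain Q where "disc_chart Q (h x1)"
      by (rule ex_disc_chart)
    note Q = disc_chartD[OF this]
    obtain z1 where z1: "x1 = P z1" "cmod z1 \<le> 2 * \<delta>" using P(5)[of x1] xa \<delta>1 by force
    obtain z2 where z2: "x2 = P z2" "cmod z2 \<le> 2 * \<delta>" using P(5)[of x2] xa \<delta>1 by force
    have ne: "z1 \<noteq> z2" using x z1 z2 by auto
    have in_ball: "h (P w) \<in> ball (h x1) 1" if "w \<in> ball 0 r" for w
    proof -
      have "dist a (P w) \<le> 2 * cmod w" using P(3)[of 0 w] P(2) by simp
      then have "dist (h a) (h (P w)) < 1 / 2" using that r by (intro d(2) h) auto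
      moreover have "dist (h a) (h x1) < 1 / 2" using x(3) by simp
      ultimately show ?thesis using dist_triangle3[of "h x1" "h (P w)" "h a"] by simp
    qed
    have hol: "sph_hol (\<lambda>z. h (P z)) (ball 0 r)"
      using sphere_mapD[OF sm open_ball sph_hol_subset[OF P(1)]] by simp
    have sub: "(\<lambda>z. h (P z)) ` ball 0 r \<subseteq> ball (h x1) 1" using in_ball by blast
    obtain g where g: "g holomorphic_on ball 0 r" "\<And>z. z \<in> ball 0 r \<Longrightarrow> h (P z) = Q (g z) \<and> cmod (g z) < 1"
      using Q(6)[OF open_ball hol sub] by blast
    have small: "w \<in> ball 0 r" "w \<in> ball 0 (r / 2)" "w \<in> ball 0 (r / 2 / 2)" if "cmod w \<le> 2 * \<delta>" for w
      using that \<delta>r \<delta>(1) r by auto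
    have gz: "g z1 = g z2"
    proof -
      have "Q (g z1) = Q (g z2)" "cmod (g z1) < 1" "cmod (g z2) < 1"
        using g(2)[OF small(1)[OF z1(2)]] g(2)[OF small(1)[OF z2(2)]] x(2) z1 z2 by auto
      then show ?thesis using Q(4)[of "g z1" "g z2"] by simp
    qed
    have d1: "cmod (deriv g w) \<le> 4 / r" if "w \<in> ball 0 (r / 2)" for w
      using bounded_holomorphic_deriv[OF g(1), of 1 w] g(2) that by (simp add: less_imp_le)
    have hol': "deriv g holomorphic_on ball 0 (r / 2)"
      by (rule holomorphic_on_subset[OF holomorphic_deriv[OF g(1) open_ball]]) (use r in auto)
    have d2: "cmod (deriv g v - deriv g w) \<le> 4 * (4 / r) / (r / 2) * cmod (v - w)"
      if "cmod v \<le> 2 * \<delta>" "cmod w \<le> 2 * \<delta>" for v w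
      by (rule bounded_holomorphic_lipschitz[OF hol' d1]) (use small that in auto)
    have d3: "cmod (deriv g v - deriv g w) \<le> 128 * \<delta> / r\<^sup>2"
      if "cmod v \<le> 2 * \<delta>" "cmod w \<le> 2 * \<delta>" for v w
    proof -
      have "cmod (v - w) \<le> 4 * \<delta>" using norm_triangle_ineq4[of v w] that by linarith
      then have "4 * (4 / r) / (r / 2) * cmod (v - w) \<le> 4 * (4 / r) / (r / 2) * (4 * \<delta>)"
        using r by (intro mult_left_mono) auto
      also have "\<dots> = 128 * \<delta> / r\<^sup>2" by (simp add: power2_eq_square)
      finally show ?thesis using d2[OF that] by linarith
    qed
    have hd: "(g has_field_derivative deriv g w) (at w within cball 0 (2 * \<delta>))" if "w \<in> cball 0 (2 * \<delta>)" for w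
      using holomorphic_derivI[OF g(1) open_ball, of w] small(1)[of w] that has_field_derivative_at_within by auto
    \<comment> \<open>as \<open>g z1 = g z2\<close>, the derivative nearly vanishes at \<open>z1\<close>\<close>
    have "cmod ((g z1 - deriv g z1 * z1) - (g z2 - deriv g z1 * z2)) \<le> 128 * \<delta> / r\<^sup>2 * cmod (z1 - z2)"
    proof (rule field_differentiable_bound[where S="cball 0 (2 * \<delta>)" and f'="\<lambda>w. deriv g w - deriv g z1"])
      show "((\<lambda>z. g z - deriv g z1 * z) has_field_derivative deriv g w - deriv g z1) (at w within cball 0 (2 * \<delta>))"
        if "w \<in> cball 0 (2 * \<delta>)" for w
        using hd[OF that] by (auto intro!: derivative_eq_intros)
    qed (use d3 z1 z2 in auto)
    then have "cmod (deriv g z1) * cmod (z1 - z2) \<le> 128 * \<delta> / r\<^sup>2 * cmod (z1 - z2)"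
      by (simp add: gz norm_mult[symmetric] algebra_simps norm_minus_commute)
    then have dz1: "cmod (deriv g z1) \<le> 128 * \<delta> / r\<^sup>2" by (rule mult_right_le_imp_le) (use ne in simp)
    have d4: "cmod (deriv g w) \<le> 256 * \<delta> / r\<^sup>2" if "cmod w \<le> 2 * \<delta>" for w
          proof -
      have "256 * \<delta> / r\<^sup>2 = 128 * \<delta> / r\<^sup>2 + 128 * \<delta> / r\<^sup>2" by simp
      then show ?thesis
        using d3[OF that z1(2)] dz1 norm_triangle_sub[of "deriv g w" "deriv g z1"] by linarith
    qed
    obtain \<zeta> where \<zeta>: "z = P \<zeta>" "cmod \<zeta> \<le> 2 * \<delta>" using P(5)[of z] z \<delta>1 by force
    have "cmod (g 0 - g \<zeta>) \<le> 256 * \<delta> / r\<^sup>2 * cmod (0 - \<zeta>)"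
      by (rule field_differentiable_bound[where S="cball 0 (2 * \<delta>)" and f'="deriv g"]) (use hd d4 \<zeta> \<delta> in auto)
    also have "\<dots> \<le> 256 * \<delta> / r\<^sup>2 * (2 * \<delta>)" using \<zeta> \<delta> by (intro mult_left_mono) auto
    finally have "2 * cmod (g 0 - g \<zeta>) \<le> 1024 * \<delta> / r\<^sup>2 * \<delta>" by simp
    also have "\<dots> \<le> 1 / 4 * \<delta>"
      using \<delta>r r \<delta> by (intro mult_right_mono) (auto simp: field_simps)
    finally have "dist (Q (g 0)) (Q (g \<zeta>)) \<le> \<delta> / 4" using Q(3)[of "g 0" "g \<zeta>"] by simp
    then show "dist (h a) (h z) \<le> \<delta> / 4"
      using g(2)[OF small(1)[OF \<zeta>(2)]] g(2)[of 0] r P(2) \<zeta>(1) by simp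
  qed
qed

section \<open>Rational maps of degree at least two are branched\<close>

lemma coprime_poly_no_common_root:
  fixes p q :: "complex poly"
  assumes "coprime p q"
  shows "\<not> (poly p z = 0 \<and> poly q z = 0)"
proof
  assume "poly p z = 0 \<and> poly q z = 0"
  then have "[:- z, 1:] dvd p" "[:- z, 1:] dvd q" by (simp_all add: poly_eq_0_iff_dvd)
  then have "is_unit [:- z, 1:]" using assms coprime_common_divisor by blast
  then show False by (auto simp: is_unit_iff_degree)
qed

text \<open>The roots of q are peeled off one by one: none of them is a root of p, so each is a root
  of s. This is Euclid's lemma, with coprimality expressed through roots.\<close>

lemma dvd_mult_no_common_root:
  fixes p q s :: "complex poly"
  assumes "\<And>z. \<not> (poly p z = 0 \<and> poly q z = 0)" "q dvd p * s"
  shows "q dvd s"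
  using assms
proof (induction "degree q" arbitrary: q s)
  case 0
  show ?case
  proof (cases "q = 0")
    case True
    then have "p \<noteq> 0" using 0 by auto
    then show ?thesis using 0 True by simp
  next
    case False
    then have "is_unit q" using 0 by (simp add: is_unit_iff_degree)
    then show ?thesis by (rule unit_imp_dvd)
  qed
next
  case (Suc n)
  then have "\<not> constant (poly q)" by (simp add: constant_degree)
  then obtain x where x: "poly q x = 0" using fundamental_theorem_of_algebra by blast
  then obtain q1 where q1: "q = [:- x, 1:] * q1" unfolding poly_eq_0_iff_dvd by (rule dvdE)
  obtain k where k: "p * s = q * k" using Suc.prems(2) by (rule dvdE)
  then have "poly p x * poly s x = 0" using x by (metis mult_zero_left poly_mult)
  then have "poly s x = 0" using Suc.prems(1)[of x] x by simp
  then obtain s1 where s1: "s = [:- x, 1:] * s1" unfolding poly_eq_0_iff_dvd by (rule dvdE)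
  have "[:- x, 1:] * (p * s1) = [:- x, 1:] * (q1 * k)"
    using k unfolding q1 s1 by (simp only: mult.assoc mult.left_commute)
  then have "p * s1 = q1 * k" by (subst (asm) mult_left_cancel) auto
  then have "q1 dvd p * s1" by simp
  moreover have "q1 \<noteq> 0" using Suc.hyps(2) q1 by auto
  then have "degree q = Suc (degree q1)" unfolding q1 by (subst degree_mult_eq) auto
  then have "n = degree q1" using Suc.hyps(2) by simp
  moreover have "\<not> (poly p z = 0 \<and> poly q1 z = 0)" for z
    using Suc.prems(1)[of z] by (auto simp: q1)
  ultimately have "q1 dvd s1" using Suc.hyps(1) by blast
  then show ?case unfolding q1 s1 by (rule mult_dvd_mono[OF dvd_refl])
qed

text \<open>Cross-multiplication gives p q' = p' q, also at poles, where both sides vanish. By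
  coprimality numerators divide each other, and so do denominators. This justifies the definite
  description in \<open>sphere_degree\<close>.\<close>

lemma rat_map_degree_unique:
  assumes "coprime p q" "coprime p' q'" "rat_map p q = rat_map p' q'"
  shows "max (degree p) (degree q) = max (degree p') (degree q')"
proof -
  have "poly (p * q') z = poly (p' * q) z" for z
  proof -
    have "rat_map p q (Fin z) = rat_map p' q' (Fin z)" using assms(3) by simp
    then show ?thesis by (auto split: if_splits simp: field_simps)
  qed
  then have eq: "p * q' = p' * q" by (simp add: poly_eq_poly_eq_iff[symmetric] fun_eq_iff)
  note roots = coprime_poly_no_common_root[OF assms(1)] coprime_poly_no_common_root[OF assms(2)]
  have "q dvd p * q'" unfolding eq by simp
  then have 1: "q dvd q'" by (rule dvd_mult_no_common_root[rotated]) (rule roots)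
  have "q' dvd p' * q" unfolding eq[symmetric] by simp
  then have 2: "q' dvd q" by (rule dvd_mult_no_common_root[rotated]) (rule roots)
  have "p dvd q * p'" using eq by (metis dvd_triv_left mult.commute)
  then have 3: "p dvd p'" by (rule dvd_mult_no_common_root[rotated]) (use roots in blast)
  have "p' dvd q' * p" using eq by (metis dvd_triv_left mult.commute)
  then have 4: "p' dvd p" by (rule dvd_mult_no_common_root[rotated]) (use roots in blast)
  have deg: "degree a = degree b" if "a dvd b" "b dvd a" for a b :: "complex poly"
  proof (cases "a = 0 \<or> b = 0")
    case False
    then show ?thesis using that dvd_imp_degree_le[of a b] dvd_imp_degree_le[of b a] by simp
  qed (use that in auto)
  show ?thesis using deg[OF 1 2] deg[OF 3 4] by simp
qed

lemma sphere_degree_ge_2: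
  assumes "2 \<le> sphere_degree f"
  obtains p q where "coprime p q" "f = rat_map p q" "2 \<le> max (degree p) (degree q)"
proof -
  obtain p q where pq: "coprime p q" "f = rat_map p q"
    using assms unfolding sphere_degree_def by (auto split: if_splits)
  have "sphere_degree f = (THE d. \<exists>p q. coprime p q \<and> f = rat_map p q \<and> d = max (degree p) (degree q))"
    unfolding sphere_degree_def using pq by auto
  also have "\<dots> = max (degree p) (degree q)"
    by (rule the_equality) (use pq rat_map_degree_unique in blast)+
  finally show thesis using that pq assms by simp
qed

lemma dvd_pderiv_imp_degree_0:
  fixes q :: "complex poly"
  assumes "q dvd pderiv q"
  shows "degree q = 0"
proof (rule ccontr)
  assume d: "degree q \<noteq> 0"
  then have "pderiv q \<noteq> 0" by (simp add: pderiv_eq_0_iff)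
  then have "degree q \<le> degree (pderiv q)" using assms by (rule dvd_imp_degree_le[rotated])
  then show False using d by (simp add: degree_pderiv)
qed

text \<open>For all but finitely many c the polynomial p - c q has degree n at least 2 and two
  distinct roots: a double root would make c a critical value.\<close>

lemma rat_map_branched:
  assumes hol: "sphere_holomorphic_on f UNIV" and deg: "2 \<le> sphere_degree f"
  shows "branched f"
proof -
  obtain p q where cop: "coprime p q" and f: "f = rat_map p q" and n2: "2 \<le> max (degree p) (degree q)"
    using sphere_degree_ge_2[OF deg] by metis
  define n where "n = max (degree p) (degree q)"
  have n: "2 \<le> n" "degree p \<le> n" "degree q \<le> n" using n2 by (auto simp: n_def)
  have nonconst: "p - smult c q \<noteq> 0" for c
  proof
    assume "p - smult c q = 0"
    then have p: "p = smult c q" by simp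
    then have "q dvd p" by (simp add: dvd_smult)
    then have "is_unit q" using cop by (metis coprime_common_divisor dvd_refl)
    then have "degree q = 0" using dvd_imp_degree_le[of q 1] by simp
    then show False using p n2 by (simp split: if_splits)
  qed
  have q0: "q \<noteq> 0"
  proof
    assume "q = 0"
    then have "degree p = 0" using cop dvd_imp_degree_le[of p 1] by simp
    then show False using \<open>q = 0\<close> n2 by simp
  qed
  have fin: "finite (f -` {b})" for b
  proof -
    obtain r where r: "r \<noteq> 0" "\<And>z. f (Fin z) = b \<Longrightarrow> poly r z = 0"
    proof (cases b)
      case (Fin c)
      show thesis
        by (rule that[OF nonconst[of c]]) (auto simp: f Fin field_simps split: if_splits)
    next
      case Infty
      show thesis by (rule that[OF q0]) (auto simp: f Infty split: if_splits)
    qed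
    have "x \<in> insert Infty (Fin ` {z. poly r z = 0})" if "x \<in> f -` {b}" for x
      using that r(2) by (cases x) auto
    moreover have "finite (insert Infty (Fin ` {z. poly r z = 0}))"
      using poly_roots_finite[OF r(1)] by blast
    ultimately show ?thesis by (meson finite_subset subsetI)
  qed
  \<comment> \<open>The numerator of the derivative of p / q. Were it zero, p and q would divide
    their own derivatives and both be constant.\<close>
  define W where "W = pderiv p * q - p * pderiv q"
  have W: "W \<noteq> 0"
  proof
    assume "W = 0"
    then have eq: "pderiv p * q = p * pderiv q" by (simp add: W_def)
    note roots = coprime_poly_no_common_root[OF cop]
    have "q dvd p * pderiv q" unfolding eq[symmetric] by simp
    then have "q dvd pderiv q" by (rule dvd_mult_no_common_root[rotated]) (rule roots)
    moreover have "p dvd q * pderiv p" using eq by (metis dvd_triv_left mult.commute)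
    then have "p dvd pderiv p" by (rule dvd_mult_no_common_root[rotated]) (use roots in blast)
    ultimately show False using n2 dvd_pderiv_imp_degree_0 by fastforce
  qed
  \<comment> \<open>The value at infinity, where the degree of p - c q drops, and the critical
    values. A zero denominator contributes the value 0, which merely enlarges the set.\<close>
  define bad where "bad = insert (coeff p n / coeff q n) ((\<lambda>z. poly p z / poly q z) ` {z. poly W z = 0})"
  have bad: "finite bad" unfolding bad_def using poly_roots_finite[OF W] by blast
  have two: "\<exists>x y. x \<noteq> y \<and> f x = Fin c \<and> f y = Fin c" if c: "c \<notin> bad" for c
  proof -
    define r where "r = p - smult c q"
    have "coeff r n \<noteq> 0"
    proof
      assume "coeff r n = 0"
      then have e: "coeff p n = c * coeff q n" by (simp add: r_def)
      have "coeff q n \<noteq> 0"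
      proof
        assume "coeff q n = 0"
        then have "coeff p n = 0" "coeff q n = 0" using e by auto
        moreover have "n \<noteq> 0" using n by simp
        ultimately show False unfolding n_def
          by (metis leading_coeff_0_iff max_def degree_0)
      qed
      then have "c = coeff p n / coeff q n" using e by simp
      then show False using c by (simp add: bad_def)
    qed
    then have dr: "degree r \<ge> 2" using n le_degree by (metis order_trans)
    then have "\<not> constant (poly r)" by (simp add: constant_degree)
    then obtain z1 where z1: "poly r z1 = 0" using fundamental_theorem_of_algebra by blast
    then obtain s where s: "r = [:- z1, 1:] * s" unfolding poly_eq_0_iff_dvd by (auto elim: dvdE)
    have "s \<noteq> 0" using s dr by auto
    then have "degree r = degree s + 1" unfolding s by (subst degree_mult_eq) auto
    then have "\<not> constant (poly s)" using dr by (simp add: constant_degree)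
    then obtain z2 where z2: "poly s z2 = 0" using fundamental_theorem_of_algebra by blast
    have r2: "poly r z2 = 0" using z2 s by simp
    have val: "poly q z \<noteq> 0 \<and> poly p z = c * poly q z" if "poly r z = 0" for z
    proof -
      have e: "poly p z = c * poly q z" using that by (simp add: r_def)
      then show ?thesis using coprime_poly_no_common_root[OF cop, of z] by auto
    qed
    have "z1 \<noteq> z2"
    proof
      assume "z1 = z2"
      have "pderiv r = [:- z1, 1:] * pderiv s + s * pderiv [:- z1, 1:]"
        unfolding s by (rule pderiv_mult)
      then have "poly (pderiv r) z1 = 0" using z2 \<open>z1 = z2\<close> by (simp only: poly_add poly_mult) simp
      then have "poly (pderiv p) z1 = c * poly (pderiv q) z1" by (simp add: r_def pderiv_diff pderiv_smult)
      then have "poly W z1 = 0" using val[OF z1] by (simp add: W_def)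
      moreover have "c = poly p z1 / poly q z1" using val[OF z1] by simp
      ultimately show False using c unfolding bad_def by blast
    qed
    moreover have "f (Fin z1) = Fin c" "f (Fin z2) = Fin c" using val[OF z1] val[OF r2] by (auto simp: f)
    ultimately show ?thesis by blast
  qed
  have "\<exists>x y. x \<noteq> y \<and> f x = f y \<and> f x \<in> U" if U: "open U" "U \<noteq> {}" for U
  proof -
    obtain x where x: "x \<in> U" using U by blast
    obtain e where e: "e > 0" "ball x e \<subseteq> U" using U x open_contains_ball by blast
    have "open (Fin -` U)" using U(1) continuous_on_Fin[of UNIV] by (intro open_vimage) auto
    moreover have "Fin -` U \<noteq> {}"
    proof (cases x)
      case Infty
      obtain m :: nat where m: "2 / e < real m" using reals_Archimedean2 by blast
      have "real m \<le> sqrt (1 + (real m)\<^sup>2)" by (rule real_le_rsqrt) simp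
      then have "2 / e < sqrt (1 + (real m)\<^sup>2)" using m by linarith
      then have "2 / sqrt (1 + (real m)\<^sup>2) < e"
        using e(1) by (simp add: field_simps add_pos_nonneg)
      then have "Fin (of_nat m) \<in> ball x e" by (simp add: Infty dist_Infty_Fin)
      then show ?thesis using e by blast
    qed (use x in auto)
    ultimately have "infinite (Fin -` U)" using finite_imp_not_open by blast
    then obtain c where "c \<in> Fin -` U" "c \<notin> bad" using bad by (meson finite_subset subsetI)
    then show ?thesis using two[of c] by (metis vimageE)
  qed
  then show ?thesis
    unfolding branched_def using fin sphere_holomorphic_imp_sphere_map[OF hol] by blast
qed

section \<open>Equicontinuity versus normality\<close>

lemma eqcE:
  assumes "eqc F x" "e > 0"
  obtains d where "d > 0" "\<forall>f\<in>F. \<forall>w. dist w x < d \<longrightarrow> dist (f w) (f x) < e"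
  using assms unfolding eqc_def by meson

lemma eqc_mono:
  assumes "eqc G x" "F \<subseteq> G"
  shows "eqc F x"
  unfolding eqc_def
proof (intro allI impI)
  fix e :: real assume "e > 0"
  then obtain d where d: "d > 0" "\<forall>f\<in>G. \<forall>w. dist w x < d \<longrightarrow> dist (f w) (f x) < e"
    by (rule eqcE[OF assms(1)])
  note d = d(1) d(2)[rule_format]
  show "\<exists>d>0. \<forall>f\<in>F. \<forall>w. dist w x < d \<longrightarrow> dist (f w) (f x) < e"
  proof (intro exI[of _ d] conjI ballI allI impI)
    show "dist (f w) (f x) < e" if "f \<in> F" "dist w x < d" for f w
      using d(2)[OF subsetD[OF assms(2) that(1)] that(2)] .
  qed (rule d(1))
qed

lemma eqc_Un:
  assumes "eqc F x" "eqc G x"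
  shows "eqc (F \<union> G) x"
  unfolding eqc_def
proof (intro allI impI)
  fix e :: real assume e: "e > 0"
  obtain d1 where d1: "d1 > 0" "\<forall>f\<in>F. \<forall>w. dist w x < d1 \<longrightarrow> dist (f w) (f x) < e"
    by (rule eqcE[OF assms(1) e])
  note d1 = d1(1) d1(2)[rule_format]
  obtain d2 where d2: "d2 > 0" "\<forall>f\<in>G. \<forall>w. dist w x < d2 \<longrightarrow> dist (f w) (f x) < e"
    by (rule eqcE[OF assms(2) e])
  note d2 = d2(1) d2(2)[rule_format]
  show "\<exists>d>0. \<forall>f\<in>F \<union> G. \<forall>w. dist w x < d \<longrightarrow> dist (f w) (f x) < e"
  proof (intro exI[of _ "min d1 d2"] conjI ballI allI impI)
    show "dist (f w) (f x) < e" if "f \<in> F \<union> G" "dist w x < min d1 d2" for f w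
      using that d1(2)[of f w] d2(2)[of f w] by auto
  qed (use d1(1) d2(1) in simp)
qed

lemma eqc_UN:
  assumes "finite I" "\<And>i. i \<in> I \<Longrightarrow> eqc (F i) x"
  shows "eqc (\<Union>i\<in>I. F i) x"
  using assms
proof (induction I rule: finite_induct)
  case empty
  show ?case by (auto simp: eqc_def intro: exI[of _ 1])
next
  case (insert i I)
  then show ?case by (simp add: eqc_Un)
qed

lemma eqc_singleton:
  assumes "continuous_on UNIV f"
  shows "eqc {f} x"
  using assms unfolding eqc_def continuous_on_iff by auto

lemma eqc_compose_right:
  assumes "eqc F (h z)" "continuous_on UNIV h"
  shows "eqc ((\<lambda>f. f \<circ> h) ` F) z"
  unfolding eqc_def
proof (intro allI impI)
  fix e :: real assume "e > 0"
  then obtain d where d: "d > 0" "\<forall>f\<in>F. \<forall>w. dist w (h z) < d \<longrightarrow> dist (f w) (f (h z)) < e"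
    by (rule eqcE[OF assms(1)])
  note d = d(1) d(2)[rule_format]
  obtain d' where "d' > 0" "\<And>w. dist w z < d' \<Longrightarrow> dist (h w) (h z) < d"
    using assms(2) d(1) unfolding continuous_on_iff by (meson UNIV_I)
  then show "\<exists>d>0. \<forall>f\<in>(\<lambda>f. f \<circ> h) ` F. \<forall>w. dist w z < d \<longrightarrow> dist (f w) (f z) < e"
    using d(2) by auto
qed

lemma eqc_compose_left:
  assumes "eqc F z" "uniformly_continuous_on UNIV g"
  shows "eqc ((\<lambda>f. g \<circ> f) ` F) z"
  unfolding eqc_def
proof (intro allI impI)
  fix e :: real assume "e > 0"
  then obtain d where d: "d > 0" "\<And>x y. dist x y < d \<Longrightarrow> dist (g x) (g y) < e"
    using assms(2) unfolding uniformly_continuous_on_def by auto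
  obtain d' where d2: "d' > 0" "\<forall>f\<in>F. \<forall>w. dist w z < d' \<longrightarrow> dist (f w) (f z) < d"
    by (rule eqcE[OF assms(1) d(1)])
  note d2 = d2(1) d2(2)[rule_format]
  then show "\<exists>d>0. \<forall>f\<in>(\<lambda>f. g \<circ> f) ` F. \<forall>w. dist w z < d \<longrightarrow> dist (f w) (f z) < e"
    using d(2) by auto
qed

text \<open>Openness of h makes every point near \<open>h z\<close> the image of a point near
  z.\<close>

lemma eqc_push_open:
  assumes "eqc ((\<lambda>f. f \<circ> h) ` F) z" and op: "\<And>U. open U \<Longrightarrow> open (h ` U)"
  shows "eqc F (h z)"
  unfolding eqc_def
proof (intro allI impI)
  fix e :: real assume "e > 0"
  then obtain d where d: "d > 0" "\<And>f w. f \<in> F \<Longrightarrow> dist w z < d \<Longrightarrow> dist (f (h w)) (f (h z)) < e"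
    using assms(1) unfolding eqc_def by force
  have "open (h ` ball z d)" "h z \<in> h ` ball z d" using op d(1) by auto
  then obtain d' where d': "d' > 0" "ball (h z) d' \<subseteq> h ` ball z d"
    unfolding open_contains_ball by blast
  have "dist (f v) (f (h z)) < e" if "f \<in> F" "dist v (h z) < d'" for f v
  proof -
    have "v \<in> h ` ball z d" using d'(2) that(2) by (auto simp: dist_commute)
    then obtain w where "v = h w" "dist z w < d" by auto
    then show ?thesis using d(2)[OF that(1), of w] by (simp add: dist_commute)
  qed
  then show "\<exists>d>0. \<forall>f\<in>F. \<forall>w. dist w (h z) < d \<longrightarrow> dist (f w) (f (h z)) < e"
    using d'(1) by blast
qed

text \<open>Arzela-Ascoli for vector-valued functions, transported by the isometry
  \<open>stereo\<close>. The limit takes values on the unit sphere again, because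
  \<open>range stereo\<close> is closed.\<close>

lemma eqc_uniform_subsequence:
  fixes f :: "nat \<Rightarrow> rsphere \<Rightarrow> rsphere"
  assumes "compact K" and eq: "\<And>x. x \<in> K \<Longrightarrow> eqc (range f) x"
  obtains r g where "strict_mono (r :: nat \<Rightarrow> nat)" "uniform_limit K (f \<circ> r) g sequentially"
proof -
  have iso: "norm (stereo x - stereo y) = dist x y" for x y
    by (simp add: dist_rsphere_def dist_norm)
  have cst: "continuous_on S stereo" for S
    by (rule isometry_continuous) (simp add: dist_rsphere_def)
  have inv: "inv stereo (stereo x) = x" for x
    using inj_stereo by simp
  define F where "F = (\<lambda>n y. stereo (f n (inv stereo y)))"
  have "norm (F n x) \<le> 3" for n x
  proof -
    have "norm (stereo Infty) = 1" by (simp add: norm_Pair)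
    then have "norm (stereo y) \<le> 3" for y
      using norm_triangle_sub[of "stereo y" "stereo Infty"] iso[of y Infty] dist_rsphere_le_2[of y Infty] by linarith
    then show ?thesis by (simp add: F_def)
  qed
  moreover have "\<exists>d. 0 < d \<and> (\<forall>n y. y \<in> stereo ` K \<and> norm (x - y) < d \<longrightarrow> norm (F n x - F n y) < e)"
    if x: "x \<in> stereo ` K" and e: "0 < e" for x e
  proof -
    obtain k where k: "x = stereo k" "k \<in> K" using x by blast
    obtain d where d: "d > 0" "\<And>n w. dist w k < d \<Longrightarrow> dist (f n w) (f n k) < e"
      using eq[OF k(2)] e unfolding eqc_def by auto
    show ?thesis
      using d by (intro exI[of _ d]) (auto simp: F_def k(1) inv iso dist_commute)
  qed
  moreover have "compact (stereo ` K)"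
    by (intro compact_continuous_image cst assms(1))
  ultimately obtain g k where gk: "strict_mono (k :: nat \<Rightarrow> nat)"
    "\<And>e. 0 < e \<Longrightarrow> \<exists>N. \<forall>n x. n \<ge> N \<and> x \<in> stereo ` K \<longrightarrow> norm (F (k n) x - g x) < e"
    using Arzela_Ascoli[of "stereo ` K" F 3] by metis
  have ran: "g (stereo x) \<in> range stereo" if x: "x \<in> K" for x
  proof -
    have "closed (range stereo)"
      by (intro compact_imp_closed compact_continuous_image cst compact_UNIV_rsphere)
    moreover have "\<exists>y\<in>range stereo. dist y (g (stereo x)) < e" if "e > 0" for e
      using gk(2)[OF that] x unfolding F_def dist_norm by blast
    ultimately show ?thesis by (meson closed_approachable)
  qed
  show thesis
  proof (rule that[OF gk(1), of "\<lambda>x. inv stereo (g (stereo x))"])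
    show "uniform_limit K (f \<circ> k) (\<lambda>x. inv stereo (g (stereo x))) sequentially"
    proof (rule uniform_limitI)
      fix e :: real assume "e > 0"
      then obtain N where N: "\<And>n x. n \<ge> N \<Longrightarrow> x \<in> K \<Longrightarrow> norm (F (k n) (stereo x) - g (stereo x)) < e"
        using gk(2) by blast
      have "dist ((f \<circ> k) n x) (inv stereo (g (stereo x))) < e" if "n \<ge> N" "x \<in> K" for n x
        using N[OF that] f_inv_into_f[OF ran[OF that(2)]] inv[of x]
        by (simp add: F_def dist_rsphere_def dist_norm)
      then show "\<forall>\<^sub>F n in sequentially. \<forall>x\<in>K. dist ((f \<circ> k) n x) (inv stereo (g (stereo x))) < e"
        unfolding eventually_sequentially by blast
    qed
  qed
qed

text \<open>A failure of equicontinuity yields maps and points tending to z with values staying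
  apart; a subsequence with a uniform, hence continuous, limit excludes this.\<close>

lemma fatou_imp_eqc:
  assumes z: "z \<in> fatou H" and cont: "\<And>h. h \<in> H \<Longrightarrow> continuous_on UNIV h"
  shows "eqc H z"
proof (rule ccontr)
  assume "\<not> eqc H z"
  then obtain e where e: "e > 0" "\<And>d. d > 0 \<Longrightarrow> \<exists>f\<in>H. \<exists>w. dist w z < d \<and> e \<le> dist (f w) (f z)"
    unfolding eqc_def by (meson not_le)
  have "\<forall>n. \<exists>f w. f \<in> H \<and> dist w z < inverse (real (Suc n)) \<and> e \<le> dist (f w) (f z)"
    using e(2)[of "inverse (real (Suc _))"] by (metis inverse_positive_iff_positive of_nat_0_less_iff zero_less_Suc)
  then obtain f w where fw: "\<And>n. f n \<in> H" "\<And>n. dist (w n) z < inverse (real (Suc n))" "\<And>n. e \<le> dist (f n (w n)) (f n z)"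
    by metis
  obtain U where U: "open U" "z \<in> U" "normal_on H U" using z unfolding fatou_def by blast
  obtain s where s: "s > 0" "cball z s \<subseteq> U" using U open_contains_cball by blast
  have "compact (cball z s)" by (simp add: compact_rsphere_iff_closed)
  moreover have "range f \<subseteq> H" using fw(1) by blast
  ultimately obtain r g where r: "strict_mono (r :: nat \<Rightarrow> nat)" and ul: "uniform_limit (cball z s) (f \<circ> r) g sequentially"
    using U(3) s(2) unfolding normal_on_def by metis
  have "continuous_on (cball z s) g"
    by (rule uniform_limit_theorem[OF _ ul]) (use cont fw(1) in \<open>auto intro!: always_eventually intro: continuous_on_subset\<close>)
  then obtain d where d: "d > 0" "\<And>y. y \<in> cball z s \<Longrightarrow> dist y z < d \<Longrightarrow> dist (g y) (g z) < e / 3"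
    using s(1) e(1) unfolding continuous_on_iff by (metis centre_in_cball divide_pos_pos less_imp_le zero_less_numeral)
  have "\<forall>\<^sub>F n in sequentially. \<forall>y\<in>cball z s. dist ((f \<circ> r) n y) (g y) < e / 3"
    using uniform_limitD[OF ul, of "e / 3"] e(1) by simp
  moreover have "\<forall>\<^sub>F n in sequentially. inverse (real (Suc n)) < min d s"
    using LIMSEQ_inverse_real_of_nat d(1) s(1) by (intro order_tendstoD(2)) auto
  ultimately have "\<forall>\<^sub>F n in sequentially. False"
  proof eventually_elim
    case (elim n)
    have "inverse (real (Suc (r n))) \<le> inverse (real (Suc n))"
      using seq_suble[OF r, of n] by (intro le_imp_inverse_le) auto
    then have w: "dist (w (r n)) z < min d s" using fw(2)[of "r n"] elim(2) by linarith
    then have wm: "w (r n) \<in> cball z s" by (simp add: dist_commute)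
    have "dist (g (w (r n))) (g z) < e / 3" using d(2)[OF wm] w by simp
    moreover have "dist (f (r n) (w (r n))) (g (w (r n))) < e / 3" "dist (f (r n) z) (g z) < e / 3"
      using elim(1) wm s(1) by auto
    moreover have "dist (f (r n) (w (r n))) (f (r n) z) \<le> dist (f (r n) (w (r n))) (g (w (r n)))
        + dist (g (w (r n))) (g z) + dist (f (r n) z) (g z)"
      using dist_triangle[of "f (r n) (w (r n))" "f (r n) z" "g (w (r n))"]
        dist_triangle[of "g (w (r n))" "f (r n) z" "g z"] by (simp add: dist_commute)
    ultimately show False using fw(3)[of "r n"] by linarith
  qed
  then show False by simp
qed

lemma eqc_imp_fatou:
  assumes "open U" "z \<in> U" and eq: "\<And>x. x \<in> U \<Longrightarrow> eqc H x"
  shows "z \<in> fatou H"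
proof -
  obtain s where s: "s > 0" "cball z s \<subseteq> U" using assms(1,2) open_contains_cball by blast
  have c: "compact (cball z s)" by (simp add: compact_rsphere_iff_closed)
  \<comment> \<open>Normality asks for one subsequence that serves all compact subsets. Extracting
    it on the closed ball, which contains them all, avoids a diagonal argument.\<close>
  have "normal_on H (ball z s)"
    unfolding normal_on_def
  proof (intro allI impI)
    fix f :: "nat \<Rightarrow> rsphere \<Rightarrow> rsphere" assume f: "range f \<subseteq> H"
    have "eqc (range f) x" if "x \<in> cball z s" for x
      using eqc_mono[OF eq f] that s(2) by blast
    then obtain r g where rg: "strict_mono (r :: nat \<Rightarrow> nat)" "uniform_limit (cball z s) (f \<circ> r) g sequentially"
      using eqc_uniform_subsequence[OF c] by metis
    have "uniform_limit K (f \<circ> r) g sequentially" if "K \<subseteq> ball z s" for K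
      by (rule uniform_limit_on_subset[OF rg(2)]) (use that in auto)
    then show "\<exists>r g. strict_mono r \<and> (\<forall>K. compact K \<and> K \<subseteq> ball z s \<longrightarrow> uniform_limit K (f \<circ> r) g sequentially)"
      using rg(1) by blast
  qed
  then show ?thesis
    unfolding fatou_def using s(1) by (auto intro!: exI[of _ "ball z s"])
qed

lemma open_fatou: "open (fatou H)"
proof -
  have "fatou H = \<Union>{U. open U \<and> normal_on H U}" unfolding fatou_def by blast
  moreover have "open (\<Union>{U. open U \<and> normal_on H U})" by (rule open_Union) blast
  ultimately show ?thesis by simp
qed

lemma closed_julia: "closed (julia H)"
  unfolding julia_def by (rule closed_Compl[OF open_fatou])

section \<open>Non-autonomous iteration\<close>

primrec orb :: "(nat \<Rightarrow> 'a \<Rightarrow> 'a) \<Rightarrow> nat \<Rightarrow> 'a \<Rightarrow> 'a" where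
  "orb \<gamma> 0 = id"
| "orb \<gamma> (Suc m) = \<gamma> m \<circ> orb \<gamma> m"

definition shift :: "nat \<Rightarrow> (nat \<Rightarrow> 'b) \<Rightarrow> nat \<Rightarrow> 'b"
  where "shift l \<gamma> = (\<lambda>i. \<gamma> (l + i))"

lemma orb_add: "orb \<gamma> (l + m) = orb (shift l \<gamma>) m \<circ> orb \<gamma> l"
  by (induction m) (simp_all add: shift_def o_assoc)

lemma orb_cong: "(\<And>i. i < m \<Longrightarrow> \<gamma> i = \<gamma>' i) \<Longrightarrow> orb \<gamma> m = orb \<gamma>' m"
  by (induction m) simp_all

definition njulia :: "(nat \<Rightarrow> rsphere \<Rightarrow> rsphere) \<Rightarrow> rsphere set"
  where "njulia \<gamma> = {z. \<not> eqc (range (orb \<gamma>)) z}"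

definition open_sphere_map :: "(rsphere \<Rightarrow> rsphere) \<Rightarrow> bool"
  where "open_sphere_map h \<longleftrightarrow> sphere_map h \<and> (\<forall>U. open U \<longrightarrow> open (h ` U)) \<and> surj h"

lemma branched_imp_open_sphere_map: "branched h \<Longrightarrow> open_sphere_map h"
  using sphere_map_open[of h] sphere_map_surj[of h] unfolding branched_def open_sphere_map_def by metis

lemma open_sphere_map_compose:
  assumes "open_sphere_map f" "open_sphere_map g"
  shows "open_sphere_map (f \<circ> g)"
  unfolding open_sphere_map_def
proof (intro conjI allI impI)
  show "sphere_map (f \<circ> g)" "surj (f \<circ> g)"
    using assms sphere_map_compose[of f g] comp_surj[of g f] by (simp_all add: open_sphere_map_def)
  show "open ((f \<circ> g) ` U)" if "open U" for U
    using assms that by (metis open_sphere_map_def image_comp)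
qed

lemma open_sphere_map_id: "open_sphere_map id"
  by (simp add: open_sphere_map_def sphere_map_id)

lemma open_sphere_mapD:
  assumes "open_sphere_map h"
  shows "sphere_map h" "open U \<Longrightarrow> open (h ` U)" "surj h" "continuous_on S h" "uniformly_continuous_on UNIV h"
  using assms sphere_map_continuous compact_uniformly_continuous[OF _ compact_UNIV_rsphere]
  unfolding open_sphere_map_def by auto

lemma open_sphere_map_orb:
  assumes "\<And>i. open_sphere_map (\<gamma> i)"
  shows "open_sphere_map (orb \<gamma> m)"
  by (induction m) (simp_all only: orb.simps assms open_sphere_map_compose open_sphere_map_id)

text \<open>Complete invariance. Equicontinuity of the tail is pulled back by continuity, the
  finitely many compositions shorter than l being equicontinuous anyway, and is pushed forward by
  openness of \<open>orb \<gamma> l\<close>.\<close>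

lemma njulia_shift:
  assumes "\<And>i. open_sphere_map (\<gamma> i)"
  shows "orb \<gamma> l z \<in> njulia (shift l \<gamma>) \<longleftrightarrow> z \<in> njulia \<gamma>"
proof -
  have h: "open_sphere_map (orb \<gamma> m)" for m
    by (rule open_sphere_map_orb[OF assms])
  have "eqc (range (orb (shift l \<gamma>))) (orb \<gamma> l z) \<longleftrightarrow> eqc (range (orb \<gamma>)) z"
  proof
    assume L: "eqc (range (orb (shift l \<gamma>))) (orb \<gamma> l z)"
    have 1: "eqc ((\<lambda>f. f \<circ> orb \<gamma> l) ` range (orb (shift l \<gamma>))) z"
      by (rule eqc_compose_right[OF L open_sphere_mapD(4)[OF h]])
    have 2: "eqc (\<Union>m<l. {orb \<gamma> m}) z"
      by (intro eqc_UN eqc_singleton open_sphere_mapD(4)[OF h]) auto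
    show "eqc (range (orb \<gamma>)) z"
    proof (rule eqc_mono[OF eqc_Un[OF 1 2]], rule subsetI)
      fix f assume "f \<in> range (orb \<gamma>)"
      then obtain m where m: "f = orb \<gamma> m" by blast
      show "f \<in> (\<lambda>f. f \<circ> orb \<gamma> l) ` range (orb (shift l \<gamma>)) \<union> (\<Union>m<l. {orb \<gamma> m})"
      proof (cases "m < l")
        case False
        then have "f = orb (shift l \<gamma>) (m - l) \<circ> orb \<gamma> l"
          using m orb_add[of \<gamma> l "m - l"] by simp
        then show ?thesis by blast
      qed (use m in auto)
    qed
  next
    assume "eqc (range (orb \<gamma>)) z"
    then have "eqc ((\<lambda>f. f \<circ> orb \<gamma> l) ` range (orb (shift l \<gamma>))) z"
      by (rule eqc_mono) (use orb_add[of \<gamma> l, symmetric] in auto)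
    then show "eqc (range (orb (shift l \<gamma>))) (orb \<gamma> l z)"
      by (rule eqc_push_open) (rule open_sphere_mapD(2)[OF h])
  qed
  then show ?thesis by (simp add: njulia_def)
qed

text \<open>Both claims are derived from these two properties of the generators; the equicontinuity
  is what compactness provides.\<close>

locale branched_family =
  fixes L :: "(rsphere \<Rightarrow> rsphere) set"
  assumes branched: "h \<in> L \<Longrightarrow> branched h"
    and equicontinuous: "e > 0 \<Longrightarrow> \<exists>d>0. \<forall>h\<in>L. \<forall>x y. dist x y < d \<longrightarrow> dist (h x) (h y) < e"
begin

abbreviation G :: "(rsphere \<Rightarrow> rsphere) set"
  where "G \<equiv> generated_semigroup L"

lemma open_map: "h \<in> L \<Longrightarrow> open_sphere_map h"
  by (intro branched_imp_open_sphere_map branched)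

lemma orb_open_map: "range \<gamma> \<subseteq> L \<Longrightarrow> open_sphere_map (orb \<gamma> m)"
  by (rule open_sphere_map_orb) (auto intro: open_map)

lemma range_shift: "range \<gamma> \<subseteq> L \<Longrightarrow> range (shift l \<gamma>) \<subseteq> L"
  by (auto simp: shift_def)

lemma in_njulia_shift:
  "range \<gamma> \<subseteq> L \<Longrightarrow> orb \<gamma> l z \<in> njulia (shift l \<gamma>) \<longleftrightarrow> z \<in> njulia \<gamma>"
  by (rule njulia_shift) (auto intro: open_map)

lemma in_njulia_step:
  "range \<gamma> \<subseteq> L \<Longrightarrow> \<gamma> 0 z \<in> njulia (shift 1 \<gamma>) \<longleftrightarrow> z \<in> njulia \<gamma>"
  using in_njulia_shift[of \<gamma> 1 z] by simp

lemma njulia_nonempty: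
  assumes \<gamma>: "range \<gamma> \<subseteq> L"
  shows "njulia \<gamma> \<noteq> {}"
proof
  assume "njulia \<gamma> = {}"
  then have "eqc (range (orb \<gamma>)) x" for x by (auto simp: njulia_def)
  then obtain r g where r: "strict_mono (r :: nat \<Rightarrow> nat)" and ul: "uniform_limit UNIV (orb \<gamma> \<circ> r) g sequentially"
    using eqc_uniform_subsequence[OF compact_UNIV_rsphere] by metis
  obtain N where N: "\<And>n x. n \<ge> N \<Longrightarrow> dist ((orb \<gamma> \<circ> r) n x) (g x) < 1 / 64"
    using uniform_limitD[OF ul, of "1/64"] unfolding eventually_sequentially by auto
  define m where "m = r N"
  obtain j where j: "r (Suc N) = m + Suc j"
    using strict_monoD[OF r, of N "Suc N"] less_iff_Suc_add[of m "r (Suc N)"] by (auto simp: m_def)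
  define \<gamma>' where "\<gamma>' = shift m \<gamma>"
  have \<gamma>': "range \<gamma>' \<subseteq> L" using \<gamma> range_shift by (simp add: \<gamma>'_def)
  have "dist (orb \<gamma>' (Suc j) y) y < 1 / 32" for y
  proof -
    \<comment> \<open>Surjectivity of \<open>orb \<gamma> m\<close> turns closeness of two partial
      compositions into closeness of the word between them to the identity, at every point.\<close>
    obtain x where x: "y = orb \<gamma> m x" using open_sphere_mapD(3)[OF orb_open_map[OF \<gamma>]] by (metis surjD)
    have "dist (orb \<gamma> (m + Suc j) x) (g x) < 1 / 64" "dist (orb \<gamma> m x) (g x) < 1 / 64"
      using N[of N x] N[of "Suc N" x] j by (auto simp: m_def)
    then have "dist (orb \<gamma> (m + Suc j) x) (orb \<gamma> m x) < 1 / 32"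
      using dist_triangle2[of "orb \<gamma> (m + Suc j) x" "orb \<gamma> m x" "g x"] by linarith
    then show ?thesis by (simp only: orb_add \<gamma>'_def[symmetric] o_apply x)
  qed
  then have "inj (orb \<gamma>' (Suc j))"
    by (rule near_identity_imp_inj[OF open_sphere_mapD(1)[OF orb_open_map[OF \<gamma>']]])
  then have "inj (orb (shift 1 \<gamma>') j \<circ> \<gamma>' 0)"
    using orb_add[of \<gamma>' 1 j] by simp
  \<comment> \<open>An injective composition has an injective first factor, whereas every letter is
    branched.\<close>
  then have "inj (\<gamma>' 0)" by (rule inj_on_imageI2)
  moreover have "branched (\<gamma>' 0)" using \<gamma>' branched by blast
  then obtain x y where "x \<noteq> y" "\<gamma>' 0 x = \<gamma>' 0 y" unfolding branched_def by (meson UNIV_not_empty open_UNIV)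
  ultimately show False by (simp add: inj_eq)
qed

text \<open>By contraction the orbits of such small balls stay small, so that the Julia set would be empty.\<close>
lemma no_concentrated_fibres:
  assumes contr: "\<And>h. h \<in> L \<Longrightarrow> contracts \<delta> h"
    and \<delta>: "0 < \<delta>" "\<delta> \<le> 1 / 2"
    and PL: "\<And>\<gamma>. P \<gamma> \<Longrightarrow> range \<gamma> \<subseteq> L" and PS: "\<And>\<gamma>. P \<gamma> \<Longrightarrow> P (shift 1 \<gamma>)"
    and fib: "\<And>\<gamma> x. P \<gamma> \<Longrightarrow> x \<in> njulia \<gamma> \<Longrightarrow> \<gamma> 0 -` {\<gamma> 0 x} \<subseteq> cball x \<delta>"
    and P: "P \<gamma>"
  shows False
proof -
  have Pm: "P (shift m \<gamma>)" for m
  proof (induction m)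
    case 0
    then show ?case using P by (simp add: shift_def)
  next
    case (Suc m)
    have "shift (Suc m) \<gamma> = shift 1 (shift m \<gamma>)" by (simp add: shift_def fun_eq_iff)
    then show ?case using PS[OF Suc] by simp
  qed
  obtain x where x: "x \<in> njulia \<gamma>" using njulia_nonempty[OF PL[OF P]] by blast
  have small: "dist (orb \<gamma> m x) (orb \<gamma> m w) \<le> 2 * \<delta>" if "dist x w \<le> 2 * \<delta>" for m w
  proof (induction m)
    case 0
    then show ?case using that by simp
  next
    case (Suc m)
    have e: "shift m \<gamma> 0 = \<gamma> m" by (simp add: shift_def)
    have "orb \<gamma> m x \<in> njulia (shift m \<gamma>)"
      using in_njulia_shift[OF PL[OF P]] x by blast
    from fib[OF Pm this] have "dist (\<gamma> m (orb \<gamma> m x)) (\<gamma> m (orb \<gamma> m w)) \<le> \<delta> / 4"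
      using PL[OF P] Suc unfolding e by (intro contractsD[OF contr]) auto
    then show ?case using \<delta> by simp
  qed
  have "eqc (range (orb \<gamma>)) x"
  proof (rule sep3_imp_eqc[of 1 "ball x (2 * \<delta>)"])
    fix f assume "f \<in> range (orb \<gamma>)"
    then obtain m where m: "f = orb \<gamma> m" by blast
    show "sphere_map f" unfolding m by (rule open_sphere_mapD(1)[OF orb_open_map[OF PL[OF P]]])
    show "sep3 1 (- f ` ball x (2 * \<delta>))"
    proof (rule small_image_sep3[of _ "f x"])
      show "f ` ball x (2 * \<delta>) \<subseteq> cball (f x) 1"
      proof
        fix v assume "v \<in> f ` ball x (2 * \<delta>)"
        then obtain w where "v = f w" "dist x w \<le> 2 * \<delta>" by auto
        then show "v \<in> cball (f x) 1" using small[of w m] \<delta> m by simp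
      qed
    qed
  qed (use \<delta> in auto)
  then show False using x by (simp add: njulia_def)
qed

lemma preimage_in_njulia:
  assumes "range \<gamma> \<subseteq> L" "y \<in> njulia (shift 1 \<gamma>)"
  obtains x where "x \<in> njulia \<gamma>" "y = \<gamma> 0 x"
proof -
  have "surj (\<gamma> 0)" using open_sphere_mapD(3)[OF open_map] assms(1) by blast
  then obtain x where "y = \<gamma> 0 x" by (metis surjD)
  then show thesis using that in_njulia_step[OF assms(1), of x] assms(2) by blast
qed

text \<open>By complete invariance the fibre through a Julia point consists of Julia points, so a
  Julia set of diameter below \<delta> concentrates the fibres. By contraction the next Julia set is
  again that small, and \<open>no_concentrated_fibres\<close> applies.\<close>

lemma two_points:
  obtains \<delta> where "\<delta> > 0" "\<And>\<gamma>. range \<gamma> \<subseteq> L \<Longrightarrow> \<exists>x\<in>njulia \<gamma>. \<exists>y\<in>njulia \<gamma>. \<delta> \<le> dist x y"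
proof -
  obtain \<delta> where \<delta>: "\<delta> > 0" "\<delta> \<le> 1 / 2" and contr0: "\<forall>\<delta>' h. 0 < \<delta>' \<longrightarrow> \<delta>' \<le> \<delta> \<longrightarrow> h \<in> L \<longrightarrow> contracts \<delta>' h"
    by (rule contraction_near_critical[OF branched equicontinuous])
  note contr = contr0[rule_format, OF \<delta>(1) order_refl]
  define P where "P = (\<lambda>\<gamma>. range \<gamma> \<subseteq> L \<and> (\<forall>x\<in>njulia \<gamma>. \<forall>y\<in>njulia \<gamma>. dist x y < \<delta>))"
  have fib: "\<gamma> 0 -` {\<gamma> 0 x} \<subseteq> cball x \<delta>" if P: "P \<gamma>" and x: "x \<in> njulia \<gamma>" for \<gamma> x
  proof
    fix w assume "w \<in> \<gamma> 0 -` {\<gamma> 0 x}"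
    then have "w \<in> njulia \<gamma>"
      using in_njulia_step[of \<gamma>] P x by (metis P_def singletonD vimageE)
    then show "w \<in> cball x \<delta>" using P x unfolding P_def by (auto simp: less_imp_le)
  qed
  have step: "P (shift 1 \<gamma>)" if P: "P \<gamma>" for \<gamma>
    unfolding P_def
  proof (intro conjI ballI)
    have \<gamma>: "range \<gamma> \<subseteq> L" using P by (simp add: P_def)
    then show "range (shift 1 \<gamma>) \<subseteq> L" by (rule range_shift)
    fix u v assume "u \<in> njulia (shift 1 \<gamma>)" "v \<in> njulia (shift 1 \<gamma>)"
    then obtain x y where xy: "x \<in> njulia \<gamma>" "u = \<gamma> 0 x" "y \<in> njulia \<gamma>" "v = \<gamma> 0 y"
      using preimage_in_njulia[OF \<gamma>] by metis
    have "dist x y < \<delta>" using P xy by (simp add: P_def)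
    then have "dist u v \<le> \<delta> / 4"
      unfolding xy using \<delta> \<gamma> by (intro contractsD[OF contr] fib P xy) auto
    then show "dist u v < \<delta>" using \<delta> by simp
  qed
  have PL: "range \<gamma> \<subseteq> L" if "P \<gamma>" for \<gamma> using that by (simp add: P_def)
  have "\<not> P \<gamma>" for \<gamma>
  proof
    assume p: "P \<gamma>"
    show False
      by (rule no_concentrated_fibres[where P=P and \<delta>=\<delta> and \<gamma>=\<gamma>]) (fact contr \<delta> PL step fib p)+
  qed
  then show thesis
    using that[OF \<delta>(1)] by (auto simp: P_def not_less)
qed

text \<open>Without a \<delta>-separated triple the fibres are concentrated as well. Two far apart
  points of one fibre would be joined by a third Julia point, a preimage of a Julia point far from
  their common value.\<close>

lemma three_points:
  obtains \<delta> where "\<delta> > 0" "\<And>\<gamma>. range \<gamma> \<subseteq> L \<Longrightarrow> sep3 \<delta> (njulia \<gamma>)"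
proof -
  obtain \<delta>0 where \<delta>0: "\<delta>0 > 0" "\<delta>0 \<le> 1 / 2" and contr0: "\<forall>\<delta> h. 0 < \<delta> \<longrightarrow> \<delta> \<le> \<delta>0 \<longrightarrow> h \<in> L \<longrightarrow> contracts \<delta> h"
    by (rule contraction_near_critical[OF branched equicontinuous])
  obtain \<delta>2 where \<delta>2: "\<delta>2 > 0" "\<And>\<gamma>. range \<gamma> \<subseteq> L \<Longrightarrow> \<exists>x\<in>njulia \<gamma>. \<exists>y\<in>njulia \<gamma>. \<delta>2 \<le> dist x y"
    using two_points by metis
  \<comment> \<open>Points whose images are \<delta>2 / 2 apart are themselves \<eta> apart; this
    keeps the third point away from both points of the fibre.\<close>
  obtain \<eta> where \<eta>: "\<eta> > 0" "\<And>h x y. h \<in> L \<Longrightarrow> dist x y < \<eta> \<Longrightarrow> dist (h x) (h y) < \<delta>2 / 2"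
    using equicontinuous[of "\<delta>2 / 2"] \<delta>2(1) by (metis half_gt_zero)
  define \<delta> where "\<delta> = min \<delta>0 \<eta>"
  have \<delta>: "0 < \<delta>" "\<delta> \<le> 1 / 2" "\<delta> \<le> \<delta>0" "\<delta> \<le> \<eta>" using \<delta>0 \<eta> by (auto simp: \<delta>_def)
  note contr = contr0[rule_format, OF \<delta>(1,3)]
  define P where "P = (\<lambda>\<gamma>. range \<gamma> \<subseteq> L \<and> \<not> sep3 \<delta> (njulia \<gamma>))"
  have fib: "\<gamma> 0 -` {\<gamma> 0 x} \<subseteq> cball x \<delta>" if P: "P \<gamma>" and x: "x \<in> njulia \<gamma>" for \<gamma> x
  proof (rule subsetI, rule ccontr)
    fix w assume "w \<in> \<gamma> 0 -` {\<gamma> 0 x}" and far: "w \<notin> cball x \<delta>"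
    then have w: "\<gamma> 0 w = \<gamma> 0 x" by blast
    have \<gamma>: "range \<gamma> \<subseteq> L" using P by (simp add: P_def)
    have wJ: "w \<in> njulia \<gamma>"
      using in_njulia_step[OF \<gamma>] w x by metis
    obtain p q where pq: "p \<in> njulia (shift 1 \<gamma>)" "q \<in> njulia (shift 1 \<gamma>)" "\<delta>2 \<le> dist p q"
      using \<delta>2(2)[OF range_shift[OF \<gamma>]] by blast
    have "\<delta>2 / 2 \<le> dist (\<gamma> 0 x) p \<or> \<delta>2 / 2 \<le> dist (\<gamma> 0 x) q"
      using pq(3) dist_triangle3[of p q "\<gamma> 0 x"] by linarith
    then obtain b where b: "b \<in> njulia (shift 1 \<gamma>)" "\<delta>2 / 2 \<le> dist (\<gamma> 0 x) b" using pq by blast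
    obtain y where y: "y \<in> njulia \<gamma>" "b = \<gamma> 0 y" by (rule preimage_in_njulia[OF \<gamma> b(1)])
    have "\<gamma> 0 \<in> L" using \<gamma> by blast
    then have "\<eta> \<le> dist x y" "\<eta> \<le> dist w y"
      using \<eta>(2)[of "\<gamma> 0" x y] \<eta>(2)[of "\<gamma> 0" w y] b(2) w y(2) by (force simp: not_less[symmetric])+
    then have "sep3 \<delta> (njulia \<gamma>)"
      unfolding sep3_def using x wJ y(1) far \<delta>(4)
      by (intro bexI[of _ x] bexI[of _ w] bexI[of _ y]) auto
    then show False using P by (simp add: P_def)
  qed
  have step: "P (shift 1 \<gamma>)" if P: "P \<gamma>" for \<gamma>
  proof -
    have \<gamma>: "range \<gamma> \<subseteq> L" using P by (simp add: P_def)
    \<comment> \<open>By contraction, Julia points closer than \<delta> have images closer than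
      \<delta>; hence separated triples pull back, and their absence passes to the shift.\<close>
    have close: "\<delta> \<le> dist x y" if "\<delta> \<le> dist (\<gamma> 0 x) (\<gamma> 0 y)" "x \<in> njulia \<gamma>" for x y
    proof (rule ccontr)
      assume "\<not> \<delta> \<le> dist x y"
      then have "dist (\<gamma> 0 x) (\<gamma> 0 y) \<le> \<delta> / 4"
        using \<gamma> \<delta>(1) by (intro contractsD[OF contr] fib P that(2)) auto
      then show False using that(1) \<delta>(1) by linarith
    qed
    have "\<not> sep3 \<delta> (njulia (shift 1 \<gamma>))"
    proof
      assume "sep3 \<delta> (njulia (shift 1 \<gamma>))"
      then obtain a b c where abc: "a \<in> njulia (shift 1 \<gamma>)" "b \<in> njulia (shift 1 \<gamma>)" "c \<in> njulia (shift 1 \<gamma>)"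
        "\<delta> \<le> dist a b" "\<delta> \<le> dist a c" "\<delta> \<le> dist b c"
        unfolding sep3_def by blast
      obtain x where x: "x \<in> njulia \<gamma>" "a = \<gamma> 0 x" by (rule preimage_in_njulia[OF \<gamma> abc(1)])
      obtain y where y: "y \<in> njulia \<gamma>" "b = \<gamma> 0 y" by (rule preimage_in_njulia[OF \<gamma> abc(2)])
      obtain z where z: "z \<in> njulia \<gamma>" "c = \<gamma> 0 z" by (rule preimage_in_njulia[OF \<gamma> abc(3)])
      have "sep3 \<delta> (njulia \<gamma>)"
        unfolding sep3_def using x y z abc close by blast
      then show False using P by (simp add: P_def)
    qed
    then show ?thesis using range_shift[OF \<gamma>] by (simp add: P_def)
  qed
  have PL: "range \<gamma> \<subseteq> L" if "P \<gamma>" for \<gamma> using that by (simp add: P_def)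
  have "\<not> P \<gamma>" for \<gamma>
  proof
    assume p: "P \<gamma>"
    show False
      by (rule no_concentrated_fibres[where P=P and \<delta>=\<delta> and \<gamma>=\<gamma>]) (fact contr \<delta> PL step fib p)+
  qed
  then show thesis
    using that[OF \<delta>(1)] by (auto simp: P_def)
qed

subsection \<open>Finite and periodic words\<close>

text \<open>A sequence is read from the map that acts first, so a word for f o g lists the letters
  of g before those of f; the prescribed tail is attached behind f.\<close>

lemma word_prefix:
  assumes "h \<in> G" "range \<gamma>0 \<subseteq> L"
  shows "\<exists>\<gamma> l. l > 0 \<and> range \<gamma> \<subseteq> L \<and> orb \<gamma> l = h \<and> shift l \<gamma> = \<gamma>0"
  using assms
proof (induction arbitrary: \<gamma>0 rule: generated_semigroup.induct)
  case (gen h)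
  let ?g = "case_nat h \<gamma>0"
  have "range ?g \<subseteq> L" using gen by (auto simp: image_subset_iff split: nat.splits)
  moreover have "orb ?g 1 = h" "shift 1 ?g = \<gamma>0" by (auto simp: shift_def)
  ultimately show ?case by (intro exI[of _ ?g] exI[of _ "1::nat"]) simp
next
  case (comp f g)
  obtain \<gamma>1 l1 where 1: "l1 > 0" "range \<gamma>1 \<subseteq> L" "orb \<gamma>1 l1 = f" "shift l1 \<gamma>1 = \<gamma>0"
    using comp.IH(1)[OF comp.prems] by blast
  obtain \<gamma>2 l2 where 2: "l2 > 0" "range \<gamma>2 \<subseteq> L" "orb \<gamma>2 l2 = g" "shift l2 \<gamma>2 = \<gamma>1"
    using comp.IH(2)[OF 1(2)] by blast
  have "orb \<gamma>2 (l2 + l1) = f \<circ> g" using 1 2 by (simp add: orb_add)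
  moreover have "shift (l2 + l1) \<gamma>2 = shift l1 (shift l2 \<gamma>2)" by (simp add: shift_def add.assoc)
  ultimately show ?case using 1 2 by (intro exI[of _ \<gamma>2] exI[of _ "l2 + l1"]) simp
qed

lemma generated_open_map: "h \<in> G \<Longrightarrow> open_sphere_map h"
  by (induction rule: generated_semigroup.induct) (blast intro: open_map open_sphere_map_compose)+

lemma periodic_word:
  assumes "h \<in> G"
  obtains \<gamma> l where "l > 0" "range \<gamma> \<subseteq> L" "orb \<gamma> l = h" "shift l \<gamma> = \<gamma>"
proof -
  have "L \<noteq> {}" using assms by (induction rule: generated_semigroup.induct) auto
  then obtain h0 where "range (\<lambda>_::nat. h0) \<subseteq> L" by auto
  then obtain \<gamma>' l where \<gamma>': "l > 0" "range \<gamma>' \<subseteq> L" "orb \<gamma>' l = h"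
    using word_prefix[OF assms] by blast
  \<comment> \<open>The arbitrary tail is discarded and the first l letters are repeated.\<close>
  define \<gamma> where "\<gamma> = (\<lambda>i. \<gamma>' (i mod l))"
  have "orb \<gamma> l = h"
    unfolding \<gamma>'(3)[symmetric] by (rule orb_cong) (simp add: \<gamma>_def)
  moreover have "shift l \<gamma> = \<gamma>" by (simp add: shift_def \<gamma>_def)
  moreover have "range \<gamma> \<subseteq> L" using \<gamma>'(2) by (auto simp: \<gamma>_def)
  ultimately show thesis using that \<gamma>'(1) by blast
qed

text \<open>Splitting m modulo l writes each partial composition as one of l fixed words after a
  power of h, and the powers of h are in H or the identity. So equicontinuity of H carries over,
  though partial words lie outside H.\<close>

lemma eqc_imp_not_periodic_julia:
  assumes \<gamma>: "l > 0" "range \<gamma> \<subseteq> L" "orb \<gamma> l = h" "shift l \<gamma> = \<gamma>"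
    and H: "h \<in> H" "\<And>f g. f \<in> H \<Longrightarrow> g \<in> H \<Longrightarrow> f \<circ> g \<in> H" and y: "eqc H y"
  shows "y \<notin> njulia \<gamma>"
proof -
  have sh: "shift (k * l) \<gamma> = \<gamma>" for k
  proof (induction k)
    case (Suc k)
    have "shift (Suc k * l) \<gamma> = shift (k * l) (shift l \<gamma>)"
      by (simp add: shift_def fun_eq_iff add.commute add.left_commute)
    then show ?case using Suc \<gamma>(4) by simp
  qed (simp add: shift_def)
  have pw: "orb \<gamma> (k * l) \<in> insert id H" for k
  proof (induction k)
    case (Suc k)
    have "orb \<gamma> (Suc k * l) = orb \<gamma> l \<circ> orb \<gamma> (k * l)"
      using orb_add[of \<gamma> "k * l" l] sh by (simp add: add.commute)
    then show ?case using Suc H \<gamma>(3) by (metis comp_id insert_iff)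
  qed simp
  have "eqc (insert id H) y"
    using eqc_Un[OF eqc_singleton[of id] y] by simp
  then have "eqc (\<Union>i<l. (\<lambda>f. orb \<gamma> i \<circ> f) ` insert id H) y"
    by (intro eqc_UN eqc_compose_left open_sphere_mapD(5)[OF orb_open_map[OF \<gamma>(2)]]) auto
  moreover have "range (orb \<gamma>) \<subseteq> (\<Union>i<l. (\<lambda>f. orb \<gamma> i \<circ> f) ` insert id H)"
  proof
    fix f assume "f \<in> range (orb \<gamma>)"
    then obtain m where m: "f = orb \<gamma> m" by blast
    have "m = (m div l) * l + m mod l" by simp
    then have "f = orb \<gamma> (m mod l) \<circ> orb \<gamma> ((m div l) * l)"
      using orb_add[of \<gamma> "(m div l) * l" "m mod l"] sh m by simp
    then show "f \<in> (\<Union>i<l. (\<lambda>f. orb \<gamma> i \<circ> f) ` insert id H)"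
      using pw[of "m div l"] \<gamma>(1) by (intro UN_I[of "m mod l"]) auto
  qed
  ultimately show ?thesis
    unfolding njulia_def using eqc_mono by blast
qed

lemma eqc_forward:
  assumes "H \<subseteq> G" "\<And>f g. f \<in> H \<Longrightarrow> g \<in> H \<Longrightarrow> f \<circ> g \<in> H" "eqc H y" "h \<in> H"
  shows "eqc H (h y)"
proof (rule eqc_push_open[where h=h and F=H])
  show "eqc ((\<lambda>f. f \<circ> h) ` H) y"
    by (rule eqc_mono[OF assms(3)]) (use assms(2,4) in auto)
  show "open U \<Longrightarrow> open (h ` U)" for U
    using open_sphere_mapD(2)[OF generated_open_map] assms(1,4) by blast
qed

end

section \<open>Wide annuli in the Fatou set do not separate the Julia set\<close>

text \<open>The radii have ratio M^2, so the modulus is ln M / pi in the normalization of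
  \<open>round_modulus\<close>. The unit circle is the core curve.\<close>

abbreviation ann :: "real \<Rightarrow> complex set"
  where "ann M \<equiv> {z. 1 / M < cmod z \<and> cmod z < M}"

lemma open_ann: "open (ann M)"
  by (intro open_Collect_conj open_Collect_less continuous_intros)

lemma sphere_scale:
  assumes "t > 0"
  shows "(\<lambda>z. of_real t * z) ` sphere 0 1 = sphere (0::complex) t"
proof (intro equalityI subsetI)
  fix w :: complex assume "w \<in> sphere 0 t"
  then have "w / of_real t \<in> sphere 0 1" "w = of_real t * (w / of_real t)"
    using assms by (auto simp: norm_divide)
  then show "w \<in> (\<lambda>z. of_real t * z) ` sphere 0 1" by blast
qed (use assms in \<open>auto simp: norm_mult\<close>)

text \<open>In the coordinate \<open>log z\<close> the annulus is a wide strip, in which the unit circle has length \<open>2\<pi>\<close>.\<close>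
lemma annulus_circle_small:
  assumes "d > 0" "\<eta> > 0"
  obtains M where "M > 1" "\<forall>f z. sph_hol f (ann M) \<longrightarrow> sep3 d (- f ` ann M) \<longrightarrow> cmod z = 1 \<longrightarrow> dist (f z) (f 1) \<le> \<eta>"
proof -
  obtain K where K: "K > 0" "\<And>f r a z. sph_hol f (ball a r) \<Longrightarrow> sep3 d (- f ` ball a r) \<Longrightarrow>
      cmod (z - a) < r / 8 \<Longrightarrow> dist (f z) (f a) \<le> K * cmod (z - a) / r"
    using sphere_Schottky[OF assms(1)] by metis
  \<comment> \<open>The first entry puts the points i Arg z, of modulus at most pi, within the range
    R / 8 of \<open>sphere_Schottky\<close>; the second makes its bound at most \<eta>.\<close>
  define R where "R = max (9 * pi) (K * pi / \<eta>)"
  have R: "R > 0" "pi < R / 8" "K * pi / R \<le> \<eta>"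
  proof -
    have "9 * pi \<le> R" "K * pi / \<eta> \<le> R" by (simp_all add: R_def)
    then show "R > 0" "pi < R / 8" using pi_gt_zero by linarith+
    then show "K * pi / R \<le> \<eta>" using \<open>K * pi / \<eta> \<le> R\<close> assms(2) by (simp add: field_simps)
  qed
  define M where "M = exp R"
  have M: "M > 1" using R by (simp add: M_def)
  have im: "exp ` ball 0 R \<subseteq> ann M"
  proof
    fix w assume "w \<in> exp ` ball (0::complex) R"
    then obtain z where z: "w = exp z" "cmod z < R" by auto
    have "\<bar>Re z\<bar> < R" using abs_Re_le_cmod[of z] z(2) by linarith
    then have "exp (- R) < exp (Re z)" "exp (Re z) < exp R" by auto
    then show "w \<in> ann M" by (simp add: z(1) M_def exp_minus inverse_eq_divide)
  qed
  show thesis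
  proof (rule that[OF M], intro allI impI)
    fix f and z :: complex
    assume f: "sph_hol f (ann M)" and sep: "sep3 d (- f ` ann M)" and z: "cmod z = 1"
    have hol: "sph_hol (\<lambda>w. f (exp w)) (ball 0 R)"
      by (rule sph_hol_reparam[OF f _ im open_ball]) (intro holomorphic_intros)
    have sep': "sep3 d (- (\<lambda>w. f (exp w)) ` ball 0 R)"
      by (rule sep3_mono[OF sep]) (use im in auto)
    have ze: "z = exp (\<i> * of_real (Arg z))"
      using z Arg_eq[of z] by (metis norm_zero of_real_1 mult_1 zero_neq_one)
    have arg: "cmod (\<i> * of_real (Arg z)) \<le> pi"
      using Arg_bounded[of z] by (simp add: norm_mult abs_le_iff)
    have "dist (f (exp (\<i> * of_real (Arg z)))) (f (exp 0)) \<le> K * cmod (\<i> * of_real (Arg z) - 0) / R"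
      by (rule K(2)[OF hol sep']) (use arg R(2) in auto)
    also have "\<dots> \<le> K * pi / R"
      using arg K(1) R(1) by (intro divide_right_mono mult_left_mono) auto
    finally show "dist (f z) (f 1) \<le> \<eta>" using R(3) ze by simp
  qed
qed

text \<open>The closedness assumption puts the frontier of U into C, hence into the ball, whose
  connected complement therefore cannot be cut by U.\<close>

lemma small_frontier_dichotomy:
  fixes c :: rsphere
  assumes "\<eta> > 0" "open U" "closed (U \<union> C)" "C \<subseteq> cball c \<eta>"
  shows "U \<subseteq> cball c \<eta> \<or> - cball c \<eta> \<subseteq> U"
proof (rule ccontr)
  assume n: "\<not> ?thesis"
  have "connected (- cball c \<eta>)" using assms(1) by (rule connected_Compl_cball_rsphere)
  moreover have "open U" "open (- (U \<union> C))" by (fact assms(2), rule open_Compl[OF assms(3)])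
  moreover have "U \<inter> - (U \<union> C) \<inter> - cball c \<eta> = {}" "- cball c \<eta> \<subseteq> U \<union> - (U \<union> C)" using assms(4) by auto
  moreover have "U \<inter> - cball c \<eta> \<noteq> {}" "- (U \<union> C) \<inter> - cball c \<eta> \<noteq> {}"
    using n assms(4) by blast+
  ultimately show False using connectedD by blast
qed

context branched_family
begin

lemma fatou_eqc:
  assumes "H \<subseteq> G" "y \<in> fatou H"
  shows "eqc H y"
proof (rule fatou_imp_eqc[OF assms(2)])
  show "continuous_on UNIV h" if "h \<in> H" for h
    using that assms(1) generated_open_map open_sphere_mapD(4) by blast
qed

text \<open>The periodic word of any single element of H serves; this transfers the uniform triples
  to J(H).\<close>

lemma julia_contains_njulia:
  assumes H: "subsemigroup H G"
  obtains \<gamma> where "range \<gamma> \<subseteq> L" "njulia \<gamma> \<subseteq> julia H"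
proof -
  obtain h where h: "h \<in> H" and sub: "H \<subseteq> G" and cl: "\<And>f g. f \<in> H \<Longrightarrow> g \<in> H \<Longrightarrow> f \<circ> g \<in> H"
    using H unfolding subsemigroup_def by blast
  obtain \<gamma> l where \<gamma>: "l > 0" "range \<gamma> \<subseteq> L" "orb \<gamma> l = h" "shift l \<gamma> = \<gamma>"
    using periodic_word h sub by blast
  have "njulia \<gamma> \<subseteq> julia H"
    using eqc_imp_not_periodic_julia[OF \<gamma> h cl] fatou_eqc[OF sub] unfolding julia_def by blast
  with \<gamma>(2) show thesis by (rule that)
qed

lemma julia_three_points:
  obtains \<delta> where "\<delta> > 0" "\<forall>H. subsemigroup H G \<longrightarrow> sep3 \<delta> (julia H)"
proof -
  obtain \<delta> where \<delta>: "\<delta> > 0" "\<And>\<gamma>. range \<gamma> \<subseteq> L \<Longrightarrow> sep3 \<delta> (njulia \<gamma>)"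
    using three_points by metis
  show thesis
  proof (rule that[OF \<delta>(1)], intro allI impI)
    fix H assume "subsemigroup H G"
    then obtain \<gamma> where \<gamma>: "range \<gamma> \<subseteq> L" "njulia \<gamma> \<subseteq> julia H" by (rule julia_contains_njulia)
    show "sep3 \<delta> (julia H)" by (rule sep3_mono[OF \<delta>(2)[OF \<gamma>(1)] \<gamma>(2)])
  qed
qed

text \<open>The two sides of the core curve are given as an arbitrary open splitting of its
  complement, which takes the place of the Jordan curve theorem.\<close>

definition excludes_wide_annuli :: "real \<Rightarrow> bool"
  where "excludes_wide_annuli M \<longleftrightarrow> (\<forall>H \<psi> U V. subsemigroup H G \<longrightarrow> sph_hol \<psi> (ann M) \<longrightarrow>
    \<psi> ` ann M \<subseteq> fatou H \<longrightarrow> open U \<longrightarrow> open V \<longrightarrow> U \<inter> V = {} \<longrightarrow> U \<union> V = - \<psi> ` sphere 0 1 \<longrightarrow>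
    U \<inter> julia H = {} \<or> V \<inter> julia H = {})"

text \<open>All images of the core curve under partial compositions of words are short. The filled side of
  the curve thus never gets out of small balls, since it would have to pass through a medium size.\<close>
lemma no_wide_annulus:
  obtains M where "M > 1" "excludes_wide_annuli M"
proof -
  obtain \<delta> where \<delta>: "\<delta> > 0" "\<And>\<gamma>. range \<gamma> \<subseteq> L \<Longrightarrow> sep3 \<delta> (njulia \<gamma>)"
    using three_points by metis
  obtain d where d: "d > 0" "\<And>h x y. h \<in> L \<Longrightarrow> dist x y < d \<Longrightarrow> dist (h x) (h y) < 1 / 4"
    using equicontinuous[of "1/4"] by auto
  \<comment> \<open>A generator maps a ball of radius less than d into one of radius 1/4, which is
    too small to contain the complement of an \<eta>-ball.\<close>
  define \<eta> where "\<eta> = min (1 / 8) (d / 2)"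
  have \<eta>: "\<eta> > 0" "\<eta> \<le> 1 / 8" "\<eta> < d" using d(1) by (auto simp: \<eta>_def)
  obtain M where M: "M > 1" "\<forall>f z. sph_hol f (ann M) \<longrightarrow> sep3 \<delta> (- f ` ann M) \<longrightarrow> cmod z = 1 \<longrightarrow> dist (f z) (f 1) \<le> \<eta>"
    by (rule annulus_circle_small[OF \<delta>(1) \<eta>(1)])
  note M = M(1) M(2)[rule_format]
  have one: False if H: "subsemigroup H G" and \<psi>: "sph_hol \<psi> (ann M)" and F: "\<psi> ` ann M \<subseteq> fatou H"
    and U: "open U" "closed (U \<union> \<psi> ` sphere 0 1)" "U \<subseteq> cball (\<psi> 1) \<eta>" "U \<inter> julia H \<noteq> {}" for H \<psi> U
  proof -
    define C where "C = \<psi> ` sphere 0 1"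
    obtain h0 where h0: "h0 \<in> H" and sub: "H \<subseteq> G" and cl: "\<And>f g. f \<in> H \<Longrightarrow> g \<in> H \<Longrightarrow> f \<circ> g \<in> H"
      using H unfolding subsemigroup_def by blast
    obtain \<gamma>0 l0 where \<gamma>0: "l0 > 0" "range \<gamma>0 \<subseteq> L" "orb \<gamma>0 l0 = h0" "shift l0 \<gamma>0 = \<gamma>0"
      using periodic_word h0 sub by blast
    \<comment> \<open>Otherwise all maps in H would omit \<open>njulia \<gamma>0\<close> on U, and
      Montel's theorem would put U into F(H).\<close>
    have "\<exists>h\<in>H. h ` U \<inter> njulia \<gamma>0 \<noteq> {}"
    proof (rule ccontr)
      assume n: "\<not> ?thesis"
      have "eqc H y" if "y \<in> U" for y
      proof (rule sep3_imp_eqc[OF \<delta>(1) U(1) that])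
        fix f assume f: "f \<in> H"
        show "sphere_map f" using f sub generated_open_map open_sphere_mapD(1) by blast
        show "sep3 \<delta> (- f ` U)" by (rule sep3_mono[OF \<delta>(2)[OF \<gamma>0(2)]]) (use n f in blast)
      qed
      then have "U \<subseteq> fatou H" using eqc_imp_fatou[OF U(1)] by blast
      then show False using U(4) by (auto simp: julia_def)
    qed
    then obtain h x where h: "h \<in> H" and x: "x \<in> U" "h x \<in> njulia \<gamma>0" by blast
    obtain \<gamma> l where \<gamma>: "range \<gamma> \<subseteq> L" "orb \<gamma> l = h" "shift l \<gamma> = \<gamma>0"
      using word_prefix[OF _ \<gamma>0(2), of h] h sub by blast
    have xJ: "x \<in> njulia \<gamma>" using in_njulia_shift[OF \<gamma>(1), of l x] x(2) \<gamma> by simp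
    have FJ: "y \<notin> njulia \<gamma>" if "y \<in> fatou H" for y
    proof -
      have "eqc H (h y)" by (rule eqc_forward[OF sub cl fatou_eqc[OF sub that] h])
      then have "h y \<notin> njulia \<gamma>0" using eqc_imp_not_periodic_julia[OF \<gamma>0 h0 cl] by blast
      then show ?thesis using in_njulia_shift[OF \<gamma>(1), of l y] \<gamma> by simp
    qed
    have om: "open_sphere_map (orb \<gamma> m)" for m by (rule orb_open_map[OF \<gamma>(1)])
    have curve: "orb \<gamma> m ` C \<subseteq> cball (orb \<gamma> m (\<psi> 1)) \<eta>" for m
    proof -
      have hol: "sph_hol (\<lambda>z. orb \<gamma> m (\<psi> z)) (ann M)"
        by (rule sphere_mapD[OF open_sphere_mapD(1)[OF om] open_ann \<psi>])
      \<comment> \<open>By complete invariance, a value in this set taken on the annulus would come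
        from a point of \<open>njulia \<gamma>\<close> in F(H).\<close>
      have "njulia (shift m \<gamma>) \<subseteq> - (\<lambda>z. orb \<gamma> m (\<psi> z)) ` ann M"
        using in_njulia_shift[OF \<gamma>(1)] FJ F by blast
      then have sep: "sep3 \<delta> (- (\<lambda>z. orb \<gamma> m (\<psi> z)) ` ann M)"
        by (rule sep3_mono[OF \<delta>(2)[OF range_shift[OF \<gamma>(1)]]])
      show ?thesis
        using M(2)[OF hol sep] by (auto simp: C_def dist_commute)
    qed
    have small: "orb \<gamma> m ` U \<subseteq> cball (orb \<gamma> m (\<psi> 1)) \<eta>" for m
    proof (induction m)
      case 0
      then show ?case using U(3) by simp
    next
      case (Suc m)
      let ?f = "orb \<gamma> (Suc m)" let ?c = "?f (\<psi> 1)"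
      have "?f ` U \<subseteq> cball ?c (1/4)"
      proof
        fix y assume "y \<in> ?f ` U"
        then obtain u where u: "u \<in> U" "y = \<gamma> m (orb \<gamma> m u)" by auto
        have "dist (orb \<gamma> m (\<psi> 1)) (orb \<gamma> m u) < d" using Suc u(1) \<eta>(3) by fastforce
        then have "dist (\<gamma> m (orb \<gamma> m (\<psi> 1))) y < 1 / 4"
          unfolding u(2) using \<gamma>(1) by (intro d(2)) auto
        then show "y \<in> cball ?c (1/4)" by simp
      qed
      \<comment> \<open>The frontier of the image lies in the image of C, because U with C is
        compact. So the image is tiny or huge, and the bound 1/4 leaves only tiny.\<close>
      moreover have "?f ` U \<subseteq> cball ?c \<eta> \<or> - cball ?c \<eta> \<subseteq> ?f ` U"
      proof (rule small_frontier_dichotomy[OF \<eta>(1) _ _ curve])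
        show "open (?f ` U)" by (rule open_sphere_mapD(2)[OF om U(1)])
        have "compact (U \<union> C)" using U(2) by (simp add: C_def compact_rsphere_iff_closed)
        then have "compact (?f ` (U \<union> C))" by (intro compact_continuous_image open_sphere_mapD(4)[OF om])
        then show "closed (?f ` U \<union> ?f ` C)" by (simp add: image_Un compact_imp_closed)
      qed
      moreover have "\<not> - cball ?c \<eta> \<subseteq> cball ?c (1/4)"
      proof
        assume a: "- cball ?c \<eta> \<subseteq> cball ?c (1/4)"
        have "sep3 1 (- cball ?c 1)" by (rule small_image_sep3[OF order_refl])
        then obtain y where "y \<notin> cball ?c 1" unfolding sep3_def by blast
        then have "y \<in> - cball ?c \<eta>" "y \<notin> cball ?c (1/4)" using \<eta>(2) by auto
        then show False using a by blast
      qed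
      ultimately show ?case by blast
    qed
    have "eqc (range (orb \<gamma>)) x"
    proof (rule sep3_imp_eqc[of 1 U])
      fix f assume "f \<in> range (orb \<gamma>)"
      then obtain m where m: "f = orb \<gamma> m" by blast
      show "sphere_map f" unfolding m by (rule open_sphere_mapD(1)[OF om])
      have "cball (orb \<gamma> m (\<psi> 1)) \<eta> \<subseteq> cball (orb \<gamma> m (\<psi> 1)) 1" using \<eta>(2) by (intro subset_cball) simp
      then show "sep3 1 (- f ` U)" unfolding m using small[of m] by (intro small_image_sep3[of _ "orb \<gamma> m (\<psi> 1)"]) blast
    qed (use U x in auto)
    then show False using xJ by (simp add: njulia_def)
  qed
  show thesis
  proof (rule that[OF M(1)], unfold excludes_wide_annuli_def, intro allI impI, rule ccontr)
    fix H \<psi> U V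
    assume H: "subsemigroup H G" and \<psi>: "sph_hol \<psi> (ann M)" and F: "\<psi> ` ann M \<subseteq> fatou H"
      and UV: "open U" "open V" "U \<inter> V = {}" "U \<union> V = - \<psi> ` sphere 0 1" and meet: "\<not> (U \<inter> julia H = {} \<or> V \<inter> julia H = {})"
    then have J: "U \<inter> julia H \<noteq> {}" "V \<inter> julia H \<noteq> {}" by blast+
    obtain \<gamma> where \<gamma>: "range \<gamma> \<subseteq> L" "njulia \<gamma> \<subseteq> julia H" by (rule julia_contains_njulia[OF H])
    have "sep3 \<delta> (- \<psi> ` ann M)" by (rule sep3_mono[OF \<delta>(2)[OF \<gamma>(1)]]) (use F \<gamma>(2) in \<open>auto simp: julia_def\<close>)
    then have C: "\<psi> ` sphere 0 1 \<subseteq> cball (\<psi> 1) \<eta>" using M(2)[OF \<psi>] by (auto simp: dist_commute)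
    \<comment> \<open>The curve is already short, so by the dichotomy one of its two sides is tiny;
      \<open>one\<close> applies to that side.\<close>
    have "U \<union> \<psi> ` sphere 0 1 = - V" "V \<union> \<psi> ` sphere 0 1 = - U" using UV(3,4) by blast+
    then have cl: "closed (U \<union> \<psi> ` sphere 0 1)" "closed (V \<union> \<psi> ` sphere 0 1)" using UV(1,2) by (simp_all add: closed_Compl)
    have "\<not> U \<subseteq> cball (\<psi> 1) \<eta>" using one[OF H \<psi> F UV(1) cl(1) _ J(1)] by blast
    moreover have "\<not> V \<subseteq> cball (\<psi> 1) \<eta>" using one[OF H \<psi> F UV(2) cl(2) _ J(2)] by blast
    ultimately have "- cball (\<psi> 1) \<eta> \<subseteq> U" "\<not> V \<subseteq> cball (\<psi> 1) \<eta>"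
      using small_frontier_dichotomy[OF \<eta>(1) UV(1) cl(1) C] by blast+
    then show False using UV(3) by blast
  qed
qed

end

section \<open>The core curve separates the complementary components\<close>

text \<open>The chordal formulas solved for the Euclidean distance, which shows that the finite
  chart is continuous off infinity.\<close>

lemma dist_chart_plane:
  assumes "x \<noteq> Infty" "y \<noteq> Infty"
  shows "dist (chart_plane x) (chart_plane y) = 2 * dist x y / (dist x Infty * dist y Infty)"
proof -
  obtain z w where "x = Fin z" "y = Fin w" using assms by (metis rsphere.exhaust)
  then show ?thesis
    using one_plus_cmod_pos[of z] one_plus_cmod_pos[of w]
    by (simp add: dist_Fin_Fin dist_Fin_Infty dist_norm)
qed

lemma continuous_on_chart_plane: "continuous_on (- {Infty}) chart_plane"
  unfolding continuous_on_def
proof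
  fix x :: rsphere assume x: "x \<in> - {Infty}"
  have "((\<lambda>y. 2 * dist y x / (dist y Infty * dist x Infty)) \<longlongrightarrow> 2 * dist x x / (dist x Infty * dist x Infty)) (at x within - {Infty})"
    using x by (intro tendsto_intros) auto
  then have "((\<lambda>y. 2 * dist y x / (dist y Infty * dist x Infty)) \<longlongrightarrow> 0) (at x within - {Infty})"
    by simp
  moreover have "\<forall>\<^sub>F y in at x within - {Infty}. 2 * dist y x / (dist y Infty * dist x Infty) = dist (chart_plane y) (chart_plane x)"
    unfolding eventually_at_filter using dist_chart_plane x by (intro always_eventually) auto
  ultimately have "((\<lambda>y. dist (chart_plane y) (chart_plane x)) \<longlongrightarrow> 0) (at x within - {Infty})"
    by (rule Lim_transform_eventually)
  then show "(chart_plane \<longlongrightarrow> chart_plane x) (at x within - {Infty})"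
    by (subst tendsto_dist_iff)
qed

lemma open_Fin_image:
  assumes "open U"
  shows "open (Fin ` U)"
proof -
  have "openin (top_of_set (- {Infty})) (- {Infty} \<inter> chart_plane -` U)"
    by (rule continuous_openin_preimage_gen[OF continuous_on_chart_plane assms])
  then have "open (- {Infty} \<inter> chart_plane -` U)"
    using openin_open_trans open_Compl closed_singleton by blast
  moreover have "- {Infty} \<inter> chart_plane -` U = Fin ` U"
  proof (intro equalityI subsetI)
    fix x assume "x \<in> - {Infty} \<inter> chart_plane -` U"
    then show "x \<in> Fin ` U" by (cases x) auto
  qed auto
  ultimately show ?thesis by simp
qed

definition annulus :: "real \<Rightarrow> ereal \<Rightarrow> complex set"
  where "annulus r1 r2 = {z. r1 < cmod z \<and> ereal (cmod z) < r2}"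

lemma connected_annulus_ereal:
  assumes "0 \<le> r1"
  shows "connected (annulus r1 r2)"
proof -
  define I where "I = {t. r1 < exp t \<and> ereal (exp t) < r2}"
  have "is_interval I"
    unfolding is_interval_1
  proof (intro ballI allI impI)
    fix a b t assume "a \<in> I" "b \<in> I" "a \<le> t \<and> t \<le> b"
    then have t: "a \<in> I" "b \<in> I" "a \<le> t" "t \<le> b" by simp_all
    have "exp a \<le> exp t" using t(3) by simp
    moreover have "r1 < exp a" using t(1) by (simp add: I_def)
    ultimately have "r1 < exp t" by linarith
    moreover have "ereal (exp t) \<le> ereal (exp b)" using t(4) by simp
    ultimately show "t \<in> I" using t(2) unfolding I_def by (metis (mono_tags) le_less_trans mem_Collect_eq)
  qed
  then have "convex I" by (simp add: is_interval_convex_1)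
  then have "convex (Re -` I)" by (intro convex_linear_vimage) (auto intro: linearI)
  then have "connected (exp ` (Re -` I))"
    by (intro connected_continuous_image continuous_intros convex_connected)
  moreover have "exp ` (Re -` I) = annulus r1 r2"
  proof (intro equalityI subsetI)
    fix z assume "z \<in> annulus r1 r2"
    then have z: "r1 < cmod z" "ereal (cmod z) < r2" by (auto simp: annulus_def)
    then have "z \<noteq> 0" using assms by auto
    then have "z = exp (Ln z)" by simp
    moreover have "Ln z \<in> Re -` I" using z \<open>z \<noteq> 0\<close> by (simp add: I_def)
    ultimately show "z \<in> exp ` (Re -` I)" by blast
  qed (auto simp: I_def annulus_def)
  ultimately show ?thesis by simp
qed

lemma open_annulus: "open (annulus r1 r2)"
proof -
  have "annulus r1 r2 = (\<lambda>z. ereal (cmod z)) -` {ereal r1<..<r2}"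
    by (auto simp: annulus_def)
  moreover have "open ((\<lambda>z. ereal (cmod z)) -` {ereal r1<..<r2})"
    by (intro open_vimage continuous_intros open_greaterThanLessThan)
  ultimately show ?thesis by simp
qed

lemma partition_complement:
  assumes "J1 \<inter> J2 = {}" "X1 \<inter> X2 = {}" "X1 \<inter> C = {}" "X2 \<inter> C = {}" "A = X1 \<union> X2 \<union> C" "- A = J1 \<union> J2"
  shows "(J1 \<union> X1) \<inter> (J2 \<union> X2) = {}" "(J1 \<union> X1) \<union> (J2 \<union> X2) = - C"
proof -
  have J: "x \<in> J1 \<or> x \<in> J2 \<longleftrightarrow> x \<notin> A" for x using assms(6) by (metis ComplD ComplI Un_iff)
  show "(J1 \<union> X1) \<inter> (J2 \<union> X2) = {}" "(J1 \<union> X1) \<union> (J2 \<union> X2) = - C"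
    using assms(1-4) J unfolding assms(5) by blast+
qed

text \<open>The two ends of an annulus embedded with complement \<open>K1 \<union> K2\<close> accumulate on different \<open>K\<^sub>i\<close>.\<close>
lemma annulus_curve_separates:
  fixes \<psi> :: "complex \<Rightarrow> rsphere" and \<phi> :: "rsphere \<Rightarrow> complex"
  assumes r: "0 \<le> r1" "r1 < s" "ereal s < r2"
    and K: "closed K1" "closed K2" "K1 \<inter> K2 = {}" "K1 \<noteq> {}" "K2 \<noteq> {}" and A: "- A = K1 \<union> K2"
    and \<psi>: "continuous_on (annulus r1 r2) \<psi>" "\<psi> ` annulus r1 r2 = A" and \<phi>: "continuous_on A \<phi>"
    "\<And>z. z \<in> annulus r1 r2 \<Longrightarrow> \<phi> (\<psi> z) = z"
  obtains U V where "open U" "open V" "U \<inter> V = {}" "U \<union> V = - \<psi> ` sphere 0 s" "K1 \<subseteq> U" "K2 \<subseteq> V"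
proof -
  let ?R = "annulus r1 r2"
  have oA: "open A" using K(1,2) A by (metis closed_Un closed_def double_complement)
  \<comment> \<open>Disjoint open neighbourhoods of the two complementary sets. The points in
    neither form a compact subset of A.\<close>
  define V1 where "V1 = {x. infdist x K1 < infdist x K2}"
  define V2 where "V2 = {x. infdist x K2 < infdist x K1}"
  have "open V1" "open V2"
    unfolding V1_def V2_def by (intro open_Collect_less continuous_intros)+
  moreover have "V1 \<inter> V2 = {}" by (auto simp: V1_def V2_def)
  ultimately have V: "open V1" "open V2" "V1 \<inter> V2 = {}" by blast+
  have pos: "infdist x J' > infdist x J" if "x \<in> J" "closed J" "closed J'" "J' \<noteq> {}" "x \<notin> J'" for x :: rsphere and J J'
  proof -
    have "infdist x J' \<noteq> 0" using in_closed_iff_infdist_zero[of J' x] that(3-5) by simp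
    moreover have "infdist x J' \<ge> 0" by (rule infdist_nonneg)
    moreover have "infdist x J = 0" using that(1) by (rule infdist_zero)
    ultimately show ?thesis by linarith
  qed
  have KV: "K1 \<subseteq> V1" "K2 \<subseteq> V2"
    unfolding V1_def V2_def using pos[OF _ K(1,2,5)] pos[OF _ K(2,1,4)] K(3) by blast+
  \<comment> \<open>The moduli of these points span the closed band T, outside which \<psi> takes
    values in V1 or V2 only. Including s makes the set nonempty and puts the circle of radius s into
    T.\<close>
  define Q where "Q = insert (of_real s) (\<phi> ` (- (V1 \<union> V2)))"
  have PA: "- (V1 \<union> V2) \<subseteq> A" using KV A by blast
  have "compact (- (V1 \<union> V2))" unfolding compact_rsphere_iff_closed using V(1,2) by (intro closed_Compl open_Un)
  then have cQ: "compact Q" unfolding Q_def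
    by (intro compact_insert compact_continuous_image continuous_on_subset[OF \<phi>(1) PA])
  have QR: "Q \<subseteq> ?R"
  proof -
    have "\<phi> ` A \<subseteq> ?R" using \<phi>(2) \<psi>(2) by auto
    moreover have "of_real s \<in> ?R" using r by (simp add: annulus_def)
    ultimately show ?thesis using PA unfolding Q_def by blast
  qed
  have cn: "compact (cmod ` Q)" by (intro compact_continuous_image continuous_intros cQ)
  have ne: "cmod ` Q \<noteq> {}" by (simp add: Q_def)
  obtain a where a: "a \<in> cmod ` Q" "\<And>t. t \<in> cmod ` Q \<Longrightarrow> a \<le> t" using compact_attains_inf[OF cn ne] by blast
  obtain b where b: "b \<in> cmod ` Q" "\<And>t. t \<in> cmod ` Q \<Longrightarrow> t \<le> b" using compact_attains_sup[OF cn ne] by blast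
  have sQ: "s \<in> cmod ` Q" using r unfolding Q_def by (simp add: image_iff)
  have ab: "r1 < a" "a \<le> s" "s \<le> b" "ereal b < r2"
    using a b sQ QR by (auto simp: annulus_def)
  define T where "T = {z::complex. a \<le> cmod z \<and> cmod z \<le> b}"
  have TR: "T \<subseteq> ?R"
  proof
    fix z assume z: "z \<in> T"
    then have "ereal (cmod z) \<le> ereal b" by (simp add: T_def)
    also have "\<dots> < r2" by (rule ab(4))
    finally show "z \<in> ?R" using z ab by (simp add: T_def annulus_def)
  qed
  have "compact T"
  proof -
    have "closed T" unfolding T_def by (intro closed_Collect_conj closed_Collect_le continuous_intros)
    moreover have "bounded T" unfolding T_def bounded_iff by blast
    ultimately show ?thesis by (simp add: compact_eq_bounded_closed)
  qed
  then have cT: "closed (\<psi> ` T)"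
    by (intro compact_imp_closed compact_continuous_image continuous_on_subset[OF \<psi>(1) TR])
  have end_in: "\<psi> z \<in> V1 \<union> V2" if z: "z \<in> ?R" "z \<notin> T" for z
  proof (rule ccontr)
    assume "\<psi> z \<notin> V1 \<union> V2"
    then have "\<phi> (\<psi> z) \<in> Q" by (auto simp: Q_def)
    then have "cmod z \<in> cmod ` Q" using \<phi>(2)[OF z(1)] by simp
    then show False using a(2) b(2) z(2) by (auto simp: T_def)
  qed
  define E1 where "E1 = annulus r1 (ereal a)"
  define E2 where "E2 = annulus b r2"
  have E: "E1 \<subseteq> ?R" "E2 \<subseteq> ?R" "E1 \<inter> T = {}" "E2 \<inter> T = {}" "?R \<subseteq> E1 \<union> T \<union> E2"
  proof -
    show "E1 \<subseteq> ?R"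
    proof
      fix z assume z: "z \<in> E1"
      then have "ereal (cmod z) < ereal s" using ab by (simp add: E1_def annulus_def)
      then have "ereal (cmod z) < r2" using r(3) by (rule less_trans)
      then show "z \<in> ?R" using z by (simp add: E1_def annulus_def)
    qed
  qed (use ab in \<open>auto simp: E1_def E2_def T_def annulus_def\<close>)
  have side: "\<psi> ` E1 \<subseteq> V1 \<or> \<psi> ` E1 \<subseteq> V2" "\<psi> ` E2 \<subseteq> V1 \<or> \<psi> ` E2 \<subseteq> V2"
  proof -
    have *: "\<psi> ` S \<subseteq> V1 \<or> \<psi> ` S \<subseteq> V2" if "connected S" "S \<subseteq> ?R" "S \<inter> T = {}" for S
    proof (rule ccontr)
      assume n: "\<not> ?thesis"
      have c: "connected (\<psi> ` S)" by (intro connected_continuous_image continuous_on_subset[OF \<psi>(1)] that)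
      have "\<psi> ` S \<subseteq> V1 \<union> V2" using end_in that by blast
      moreover have "V1 \<inter> V2 \<inter> \<psi> ` S = {}" using V(3) by blast
      ultimately show False using connectedD[OF c V(1,2)] n by blast
    qed
    show "\<psi> ` E1 \<subseteq> V1 \<or> \<psi> ` E1 \<subseteq> V2"
      by (intro * E) (use r in \<open>auto simp: E1_def intro!: connected_annulus_ereal\<close>)
    show "\<psi> ` E2 \<subseteq> V1 \<or> \<psi> ` E2 \<subseteq> V2"
      by (intro * E) (use r ab in \<open>auto simp: E2_def intro!: connected_annulus_ereal\<close>)
  qed
  \<comment> \<open>If neither end runs into W, then K is W without the compact set \<psi> (T): open
    as well as closed, contrary to connectedness of the sphere.\<close>
  have clopen: False
    if W: "open W" "K \<subseteq> W" "W \<inter> \<psi> ` E1 = {}" "W \<inter> \<psi> ` E2 = {}" "W \<inter> K' = {}" "closed K" "K \<noteq> {}" "K' \<noteq> {}"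
      "K \<inter> K' = {}" "- A = K \<union> K'" for W K K'
  proof -
    have "K = W \<inter> - \<psi> ` T"
    proof (intro equalityI subsetI)
      fix x assume "x \<in> K"
      then have "x \<in> W" "x \<in> - A" using W(2) unfolding W(10) by blast+
      moreover have "\<psi> ` T \<subseteq> A" using TR \<psi>(2) by blast
      ultimately show "x \<in> W \<inter> - \<psi> ` T" by blast
    next
      fix x assume x: "x \<in> W \<inter> - \<psi> ` T"
      have "x \<notin> A"
      proof
        assume "x \<in> A"
        then obtain z where "z \<in> ?R" "x = \<psi> z" using \<psi>(2) by blast
        then show False using E(5) x W(3,4) by blast
      qed
      then have "x \<in> K \<union> K'" unfolding W(10)[symmetric] by simp
      then show "x \<in> K" using W(5) x by blast
    qed
    then have "open K" using W(1) cT by (metis open_Compl open_Int)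
    then have "K = UNIV" using connected_UNIV_rsphere W(6,7) unfolding connected_clopen by auto
    then show False using W(8,9) by blast
  qed
  have core: "\<exists>U V. open U \<and> open V \<and> U \<inter> V = {} \<and> U \<union> V = - \<psi> ` sphere 0 s \<and> J1 \<subseteq> U \<and> J2 \<subseteq> V"
    if W: "open W1" "open W2" "W1 \<inter> W2 = {}" "J1 \<subseteq> W1" "J2 \<subseteq> W2" "\<psi> ` E1 \<subseteq> W1" "\<psi> ` E2 \<subseteq> W2" "- A = J1 \<union> J2" for W1 W2 J1 J2
  proof -
    define I1 where "I1 = annulus r1 (ereal s)"
    define I2 where "I2 = annulus s r2"
    have I: "I1 \<subseteq> ?R" "I2 \<subseteq> ?R" "E1 \<subseteq> I1" "E2 \<subseteq> I2" "I1 \<inter> I2 = {}" "?R = I1 \<union> I2 \<union> sphere 0 s"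
    proof -
      show R: "?R = I1 \<union> I2 \<union> sphere 0 s"
      proof (intro equalityI subsetI)
        fix z assume z: "z \<in> I1 \<union> I2 \<union> sphere 0 s"
        show "z \<in> ?R"
        proof (cases "z \<in> I2")
          case False
          then have "ereal (cmod z) \<le> ereal s" using z by (auto simp: I1_def annulus_def)
          then have "ereal (cmod z) < r2" using r(3) by (rule le_less_trans)
          then show ?thesis using z False r by (auto simp: I1_def annulus_def)
        qed (use r in \<open>auto simp: I2_def annulus_def\<close>)
      qed (auto simp: I1_def I2_def annulus_def)
      show "I1 \<subseteq> ?R" "I2 \<subseteq> ?R" using R by blast+
    qed (use ab in \<open>auto simp: E1_def E2_def I1_def I2_def annulus_def\<close>)
    have im_open: "open (\<psi> ` S)" if S: "open S" "S \<subseteq> ?R" for S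
    proof -
      have "\<psi> ` S = A \<inter> \<phi> -` S"
      proof (intro equalityI subsetI)
        fix x assume "x \<in> A \<inter> \<phi> -` S"
        then obtain z where "z \<in> ?R" "x = \<psi> z" "\<phi> x \<in> S" using \<psi>(2) by blast
        then show "x \<in> \<psi> ` S" using \<phi>(2) by auto
      next
        fix x assume "x \<in> \<psi> ` S"
        then obtain z where z: "z \<in> S" "x = \<psi> z" by blast
        then have "z \<in> ?R" using S by blast
        then show "x \<in> A \<inter> \<phi> -` S" using \<psi>(2) \<phi>(2) z by auto
      qed
      moreover have "open (A \<inter> \<phi> -` S)"
        using continuous_openin_preimage_gen[OF \<phi>(1) S(1)] oA openin_open_trans by blast
      ultimately show ?thesis by simp
    qed
    \<comment> \<open>The right side is visibly open, although J itself is closed: near J there are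
      only points of J and of the end that runs into W.\<close>
    have split: "J \<union> \<psi> ` I = (W \<inter> - \<psi> ` T) \<union> \<psi> ` I"
      if "J \<subseteq> W" "J \<subseteq> - A" "- A - J \<subseteq> - W" "E \<subseteq> I" "\<psi> ` E' \<inter> W = {}" "E1 \<union> E2 = E \<union> E'" for J I W E E'
    proof (intro equalityI subsetI)
      fix x assume "x \<in> J \<union> \<psi> ` I"
      then show "x \<in> (W \<inter> - \<psi> ` T) \<union> \<psi> ` I" using that TR \<psi>(2) by blast
    next
      fix x assume x: "x \<in> (W \<inter> - \<psi> ` T) \<union> \<psi> ` I"
      show "x \<in> J \<union> \<psi> ` I"
      proof (cases "x \<in> A")
        case True
        then obtain z where "z \<in> ?R" "x = \<psi> z" using \<psi>(2) by blast
        then show ?thesis using E(5) x that by blast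
      next
        case False
        then show ?thesis using x that by blast
      qed
    qed
    have 1: "J1 \<union> \<psi> ` I1 = (W1 \<inter> - \<psi> ` T) \<union> \<psi> ` I1"
      by (rule split[of J1 W1 E1 I1 E2]) (use W I in auto)
    have 2: "J2 \<union> \<psi> ` I2 = (W2 \<inter> - \<psi> ` T) \<union> \<psi> ` I2"
      by (rule split[of J2 W2 E2 I2 E1]) (use W I in auto)
    have "open I1" "open I2" by (simp_all add: I1_def I2_def open_annulus)
    then have "open ((W1 \<inter> - \<psi> ` T) \<union> \<psi> ` I1)" "open ((W2 \<inter> - \<psi> ` T) \<union> \<psi> ` I2)"
      using W(1,2) cT I(1,2) by (auto intro!: open_Un open_Int open_Compl im_open)
    then have op: "open (J1 \<union> \<psi> ` I1)" "open (J2 \<union> \<psi> ` I2)"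
      by (simp_all only: 1 2)
    have inj: "\<psi> z \<noteq> \<psi> w" if "z \<in> ?R" "w \<in> ?R" "z \<noteq> w" for z w
    proof
      assume "\<psi> z = \<psi> w"
      then have "\<phi> (\<psi> z) = \<phi> (\<psi> w)" by (rule arg_cong)
      then show False using \<phi>(2)[OF that(1)] \<phi>(2)[OF that(2)] that(3) by simp
    qed
    have X: "\<psi> ` I1 \<inter> \<psi> ` I2 = {}" "\<psi> ` I1 \<inter> \<psi> ` sphere 0 s = {}" "\<psi> ` I2 \<inter> \<psi> ` sphere 0 s = {}"
    proof -
      have *: "\<psi> ` S \<inter> \<psi> ` S' = {}" if "S \<subseteq> ?R" "S' \<subseteq> ?R" "S \<inter> S' = {}" for S S'
        using inj that by blast
      have S: "sphere 0 s \<subseteq> ?R" using I(6) by blast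
      have dis: "I1 \<inter> sphere 0 s = {}" "I2 \<inter> sphere 0 s = {}"
        by (auto simp: I1_def I2_def annulus_def)
      show "\<psi> ` I1 \<inter> \<psi> ` I2 = {}" "\<psi> ` I1 \<inter> \<psi> ` sphere 0 s = {}" "\<psi> ` I2 \<inter> \<psi> ` sphere 0 s = {}"
        by (rule *[OF I(1,2,5)], rule *[OF I(1) S dis(1)], rule *[OF I(2) S dis(2)])
    qed
    have J: "J1 \<inter> J2 = {}" using W(3,4,5) by blast
    have AX: "A = \<psi> ` I1 \<union> \<psi> ` I2 \<union> \<psi> ` sphere 0 s"
      unfolding \<psi>(2)[symmetric] I(6) by (simp only: image_Un)
    note pc = partition_complement[OF J X AX W(8)]
    show ?thesis
      by (intro exI[of _ "J1 \<union> \<psi> ` I1"] exI[of _ "J2 \<union> \<psi> ` I2"] conjI op pc Un_upper1)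
  qed
  \<comment> \<open>If both ends went to the same side, the other complementary set would be
    clopen.\<close>
  consider "\<psi> ` E1 \<subseteq> V1" "\<psi> ` E2 \<subseteq> V2" | "\<psi> ` E1 \<subseteq> V2" "\<psi> ` E2 \<subseteq> V1"
    | "\<psi> ` E1 \<subseteq> V1" "\<psi> ` E2 \<subseteq> V1" | "\<psi> ` E1 \<subseteq> V2" "\<psi> ` E2 \<subseteq> V2"
    using side by blast
  then show thesis
  proof cases
    case 1
    obtain U W where "open U" "open W" "U \<inter> W = {}" "U \<union> W = - \<psi> ` sphere 0 s" "K1 \<subseteq> U" "K2 \<subseteq> W"
      using core[OF V KV 1 A] by blast
    then show thesis by (rule that)
  next
    case 2
    have V': "V2 \<inter> V1 = {}" "- A = K2 \<union> K1"
      using V(3) A by (simp_all add: Int_commute Un_commute)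
    obtain U W where "open U" "open W" "U \<inter> W = {}" "U \<union> W = - \<psi> ` sphere 0 s" "K2 \<subseteq> U" "K1 \<subseteq> W"
      using core[OF V(2,1) V'(1) KV(2,1) 2 V'(2)] by blast
    then show thesis
      by (intro that[of W U]) (simp_all add: Int_commute Un_commute)
  next
    case 3
    have "V2 \<inter> \<psi> ` E1 = {}" "V2 \<inter> \<psi> ` E2 = {}" "V2 \<inter> K1 = {}"
      using 3 V(3) KV(1) by blast+
    moreover have "- A = K2 \<union> K1" "K2 \<inter> K1 = {}" using A K(3) by (simp_all add: Int_commute Un_commute)
    ultimately have False by (intro clopen[of V2 K2 K1] V KV K)
    then show thesis ..
  next
    case 4
    have "V1 \<inter> \<psi> ` E1 = {}" "V1 \<inter> \<psi> ` E2 = {}" "V1 \<inter> K2 = {}"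
      using 4 V(3) KV(2) by blast+
    then have False by (intro clopen[of V1 K1 K2] V KV K A)
    then show thesis ..
  qed
qed

text \<open>A modulus above ln M / pi means a ratio of radii above M^2, which leaves room for a copy
  of \<open>ann M\<close> scaled by t. If the inner radius is 0 or the outer one infinite, t only
  has to respect the other end.\<close>

lemma wide_round_modulus:
  assumes M: "M > 1" and r: "0 \<le> r1" "ereal r1 < r2" and wide: "\<not> round_modulus r1 r2 \<le> ereal (ln M / pi)"
  obtains t where "t > 0" "r1 \<le> t / M" "ereal (t * M) \<le> r2"
proof (cases r2)
  case (real b)
  have b: "r1 < b" using r(2) real by simp
  show thesis
  proof (cases "r1 = 0")
    case True
    then show thesis using that[of "b / M"] real b M by simp
  next
    case False
    then have r1: "r1 > 0" using r by simp
    have "ln M / pi < ln (b / r1) / (2 * pi)"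
      using wide False real by (simp add: round_modulus_def not_le)
    then have "2 * ln M < ln (b / r1)" by (simp add: field_simps)
    moreover have "ln (M * M) = 2 * ln M" using M by (simp add: ln_mult)
    ultimately have "M * M < b / r1" using M r1 b by (metis ln_less_cancel_iff mult_pos_pos divide_pos_pos less_trans zero_less_one)
    then have "r1 * M * M < b" using r1 by (simp add: field_simps)
    then show thesis using that[of "r1 * M"] real r1 M by simp
  qed
next
  case PInf
  show thesis
  proof (cases "r1 = 0")
    case True
    then show thesis using that[of 1] PInf M by simp
  next
    case False
    then show thesis using that[of "r1 * M"] PInf M r by simp
  qed
next
  case MInf
  then show thesis using r by simp
qed

context branched_family
begin

lemma julia_uniformly_perfect:
  "\<exists>C>0. \<forall>H. subsemigroup H G \<longrightarrow> uniformly_perfect C (julia H)"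
proof -
  obtain \<delta> where \<delta>: "\<delta> > 0" "\<forall>H. subsemigroup H G \<longrightarrow> sep3 \<delta> (julia H)"
    by (rule julia_three_points)
  obtain M where M: "M > 1" and nw: "excludes_wide_annuli M"
    by (rule no_wide_annulus)
  have main: "round_modulus r1 r2 \<le> ereal (ln M / pi)"
    if H: "subsemigroup H G" and A: "doubly_connected_domain A" "A \<subseteq> - julia H"
      and comp: "\<And>c. c \<in> components (- A) \<Longrightarrow> c \<inter> julia H \<noteq> {}"
      and r: "0 \<le> r1" "ereal r1 < r2" and ce: "conformally_equivalent A (round_annulus r1 r2)" for H A r1 r2
  proof (rule ccontr)
    assume wide: "\<not> round_modulus r1 r2 \<le> ereal (ln M / pi)"
    obtain t where t: "t > 0" "r1 \<le> t / M" "ereal (t * M) \<le> r2"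
      by (rule wide_round_modulus[OF M r wide])
    obtain K1 K2 where K12: "components (- A) = {K1, K2}" "K1 \<noteq> K2"
      using A(1) unfolding doubly_connected_domain_def by (auto simp: card_2_iff)
    have clA: "closed (- A)" using A(1) by (simp add: doubly_connected_domain_def closed_Compl)
    have K: "K1 \<in> components (- A)" "K2 \<in> components (- A)" using K12 by auto
    have clK: "closed K1" "closed K2" using closed_components[OF clA] K by auto
    have disK: "K1 \<inter> K2 = {}" using components_nonoverlap[OF K] K12(2) by blast
    have neK: "K1 \<noteq> {}" "K2 \<noteq> {}" using K in_components_nonempty by blast+
    have unK: "- A = K1 \<union> K2" using Union_components[of "- A"] K12(1) by simp
    obtain \<phi> \<psi> where \<phi>: "sphere_holomorphic_on \<phi> A" "\<phi> ` A = round_annulus r1 r2"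
      and \<psi>: "sphere_holomorphic_on \<psi> (round_annulus r1 r2)" "\<psi> ` round_annulus r1 r2 = A"
      and inv: "\<And>w. w \<in> round_annulus r1 r2 \<Longrightarrow> \<phi> (\<psi> w) = w"
      using ce unfolding conformally_equivalent_def by auto
    have ra: "round_annulus r1 r2 = Fin ` annulus r1 r2" by (simp add: round_annulus_def annulus_def)
    define \<psi>0 where "\<psi>0 = (\<lambda>z. \<psi> (Fin z))"
    have hol0: "sph_hol \<psi>0 (annulus r1 r2)"
      unfolding \<psi>0_def
      by (rule sph_hol_compose[OF \<psi>(1) sph_hol_Fin[OF open_annulus]]) (auto simp: ra open_annulus holomorphic_on_ident)
    have im0: "\<psi>0 ` annulus r1 r2 = A" unfolding \<psi>0_def \<psi>(2)[symmetric] ra by (simp add: image_image)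
    have c0: "continuous_on (annulus r1 r2) \<psi>0" using hol0 by (simp add: sph_hol_def)
    have cp: "continuous_on A (\<lambda>x. chart_plane (\<phi> x))"
    proof (rule continuous_on_compose2[OF continuous_on_chart_plane])
      show "continuous_on A \<phi>" using \<phi>(1) by (simp add: sphere_holomorphic_on_def)
      show "\<phi> ` A \<subseteq> - {Infty}" unfolding \<phi>(2) ra by auto
    qed
    have inv0: "chart_plane (\<phi> (\<psi>0 z)) = z" if "z \<in> annulus r1 r2" for z
      using inv[of "Fin z"] that by (simp add: \<psi>0_def ra)
    have M1: "t / M < t" "t < t * M" using t M by (simp_all add: field_simps)
    have s: "r1 < t" using t(2) M1(1) by linarith
    have "ereal t < ereal (t * M)" using M1(2) by simp
    then have s': "ereal t < r2" using t(3) by (rule less_le_trans)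
    obtain U V where UV: "open U" "open V" "U \<inter> V = {}" "U \<union> V = - \<psi>0 ` sphere 0 t" "K1 \<subseteq> U" "K2 \<subseteq> V"
      by (rule annulus_curve_separates[OF r(1) s s' clK disK neK unK c0 im0 cp inv0])
    define \<psi>1 where "\<psi>1 = (\<lambda>z. \<psi>0 (of_real t * z))"
    have sub: "(\<lambda>z. of_real t * z) ` ann M \<subseteq> annulus r1 r2"
    proof
      fix w assume "w \<in> (\<lambda>z. of_real t * z) ` ann M"
      then obtain z where z: "w = of_real t * z" "1 / M < cmod z" "cmod z < M" by auto
      have n: "cmod w = t * cmod z" using t(1) by (simp add: z(1) norm_mult)
      have "t / M < t * cmod z" using mult_strict_left_mono[OF z(2) t(1)] by simp
      then have "r1 < cmod w" using t(2) n by linarith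
      moreover have "cmod w < t * M" using n z(3) t(1) by simp
      then have "ereal (cmod w) < ereal (t * M)" by simp
      then have "ereal (cmod w) < r2" using t(3) by (rule less_le_trans)
      ultimately show "w \<in> annulus r1 r2" by (simp add: annulus_def)
    qed
    have hol1: "sph_hol \<psi>1 (ann M)"
      unfolding \<psi>1_def by (rule sph_hol_reparam[OF hol0 _ sub open_ann]) (intro holomorphic_intros)
    have F1: "\<psi>1 ` ann M \<subseteq> fatou H"
    proof
      fix y assume "y \<in> \<psi>1 ` ann M"
      then have "y \<in> \<psi>0 ` annulus r1 r2" using sub by (auto simp: \<psi>1_def)
      then show "y \<in> fatou H" using im0 A(2) by (auto simp: julia_def)
    qed
    have "\<psi>0 ` sphere 0 t = \<psi>1 ` sphere 0 1"
      unfolding sphere_scale[OF t(1), symmetric] \<psi>1_def image_image ..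
    then have un: "U \<union> V = - \<psi>1 ` sphere 0 1" using UV(4) by simp
    have "U \<inter> julia H \<noteq> {}" "V \<inter> julia H \<noteq> {}"
      using comp[OF K(1)] comp[OF K(2)] UV(5,6) by blast+
    then show False
      using nw[unfolded excludes_wide_annuli_def, rule_format, OF H hol1 F1 UV(1,2,3) un] by blast
  qed
  \<comment> \<open>The summand 1 provides the strict inequality in the definition.\<close>
  have "uniformly_perfect (ln M / pi + 1) (julia H)" if H: "subsemigroup H G" for H
    unfolding uniformly_perfect_def
  proof (intro conjI allI impI)
    show "closed (julia H)" by (rule closed_julia)
    show "\<exists>a\<in>julia H. \<exists>b\<in>julia H. a \<noteq> b"
      using \<delta>(2)[rule_format, OF H] \<delta>(1) unfolding sep3_def by (metis dist_self not_le)
    fix A assume A: "doubly_connected_domain A \<and> A \<subseteq> - julia H \<and> (\<forall>c\<in>components (- A). c \<inter> julia H \<noteq> {})"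
    \<comment> \<open>All round models of A are bounded at once, so the uniqueness of the modulus
      does not enter.\<close>
    have "modulus A \<le> ereal (ln M / pi)"
      unfolding modulus_def
    proof (rule Sup_least)
      fix x assume "x \<in> {round_modulus r1 r2 |r1 r2. 0 \<le> r1 \<and> ereal r1 < r2 \<and> conformally_equivalent A (round_annulus r1 r2)}"
      then obtain r1 r2 where x: "x = round_modulus r1 r2" "0 \<le> r1" "ereal r1 < r2" "conformally_equivalent A (round_annulus r1 r2)"
        by blast
      show "x \<le> ereal (ln M / pi)"
        unfolding x(1) using A by (intro main[OF H _ _ _ x(2,3,4)]) auto
    qed
    also have "\<dots> < ereal (ln M / pi + 1)" by simp
    finally show "modulus A < ereal (ln M / pi + 1)" .
  qed
  moreover have "ln M / pi + 1 > 0"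
    using M ln_gt_zero[of M] pi_gt_zero by (intro add_pos_pos divide_pos_pos) auto
  ultimately show ?thesis by blast
qed

end

section \<open>Superattracting fixed points\<close>

text \<open>A preimage of y is a fixed point of v -> (y - S v) / n, a contraction with constant 1/4
  as n is at least 2. It maps the ball into itself since 3/2 + 1/2 is at most n.\<close>

lemma expanding_ball_image:
  fixes S :: "complex \<Rightarrow> complex"
  assumes n: "2 \<le> n" and lip: "\<And>v w. v \<in> cball u \<rho> \<Longrightarrow> w \<in> cball u \<rho> \<Longrightarrow> cmod (S v - S w) \<le> 1 / 2 * cmod (v - w)"
    and \<rho>: "0 \<le> \<rho>"
  shows "cball (of_nat n * u + S u) (3 / 2 * \<rho>) \<subseteq> (\<lambda>v. of_nat n * v + S v) ` cball u \<rho>"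
proof
  fix y assume "y \<in> cball (of_nat n * u + S u) (3 / 2 * \<rho>)"
  then have y: "cmod (of_nat n * u + S u - y) \<le> 3 / 2 * \<rho>" by (simp add: dist_norm)
  have n0: "of_nat n \<noteq> (0::complex)" "real n > 0" using n by auto
  have "\<exists>!v\<in>cball u \<rho>. (y - S v) / of_nat n = v"
  proof (rule Banach_fix[where c="1/4"])
    show "complete (cball u \<rho>)" by (simp add: compact_imp_complete)
    show "cball u \<rho> \<noteq> {}" using \<rho> by simp
    show "(\<lambda>v. (y - S v) / of_nat n) ` cball u \<rho> \<subseteq> cball u \<rho>"
    proof
      fix w assume "w \<in> (\<lambda>v. (y - S v) / of_nat n) ` cball u \<rho>"
      then obtain v where v: "v \<in> cball u \<rho>" "w = (y - S v) / of_nat n" by blast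
      have "u - w = ((of_nat n * u + S u - y) + (S v - S u)) / of_nat n"
        using n0 v(2) by (simp add: field_simps)
      then have "cmod (u - w) = cmod ((of_nat n * u + S u - y) + (S v - S u)) / real n"
        by (simp add: norm_divide)
      also have "\<dots> \<le> (3 / 2 * \<rho> + 1 / 2 * \<rho>) / real n"
      proof (rule divide_right_mono)
        have "cmod (S v - S u) \<le> 1 / 2 * cmod (v - u)" using lip v(1) \<rho> by simp
        also have "\<dots> \<le> 1 / 2 * \<rho>" using v(1) by (simp add: dist_norm norm_minus_commute)
        finally show "cmod ((of_nat n * u + S u - y) + (S v - S u)) \<le> 3 / 2 * \<rho> + 1 / 2 * \<rho>"
          using y norm_triangle_ineq[of "of_nat n * u + S u - y" "S v - S u"] by linarith
      qed simp
      also have "\<dots> \<le> \<rho>" using n n0 mult_left_mono[of 2 "real n" \<rho>] \<rho> by (simp add: divide_le_eq)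
      finally show "w \<in> cball u \<rho>" by (simp add: dist_norm)
    qed
    show "dist ((y - S v) / of_nat n) ((y - S w) / of_nat n) \<le> 1 / 4 * dist v w"
      if "v \<in> cball u \<rho>" "w \<in> cball u \<rho>" for v w
    proof -
      have "dist ((y - S v) / of_nat n) ((y - S w) / of_nat n) = cmod (S v - S w) / real n"
        by (simp add: dist_norm diff_divide_distrib[symmetric] norm_divide norm_minus_commute)
      also have "\<dots> \<le> (1 / 2 * cmod (v - w)) / 2"
        using lip[OF that] n by (intro frac_le) auto
      finally show ?thesis by (simp add: dist_norm)
    qed
  qed auto
  then obtain v where v: "v \<in> cball u \<rho>" "(y - S v) / of_nat n = v" by blast
  then have "y = of_nat n * v + S v" using n0 by (simp add: field_simps)
  then show "y \<in> (\<lambda>v. of_nat n * v + S v) ` cball u \<rho>" using v(1) by blast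
qed

text \<open>Iteration inflates the small disc, and \<open>exp\<close> wraps a disc of radius \<open>ln M + \<pi>\<close> around the annulus.\<close>
lemma invariant_set_contains_wide_annulus:
  fixes S :: "complex \<Rightarrow> complex" and X :: "complex set"
  assumes n: "2 \<le> n"
    and lip: "\<And>v w. Re v < b \<Longrightarrow> Re w < b \<Longrightarrow> cmod (S v - S w) \<le> 1 / 2 * cmod (v - w)"
    and inv: "\<And>v. Re v < b \<Longrightarrow> v \<in> X \<Longrightarrow> Re (of_nat n * v + S v) < b \<and> of_nat n * v + S v \<in> X"
    and start: "0 < \<rho>" "cball u \<rho> \<subseteq> X \<inter> {v. Re v < b}" and M: "M > 1"
  obtains t where "0 < t" "t < exp b" "\<And>z. t / M < cmod z \<Longrightarrow> cmod z < t * M \<Longrightarrow> \<exists>v\<in>X. z = exp v"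
proof -
  define T where "T = (\<lambda>v. of_nat n * v + S v)"
  have grow: "cball ((T ^^ k) u) ((3 / 2) ^ k * \<rho>) \<subseteq> X \<inter> {v. Re v < b}" for k
  proof (induction k)
    case 0
    then show ?case using start by simp
  next
    case (Suc k)
    let ?u = "(T ^^ k) u" let ?r = "(3 / 2) ^ k * \<rho>"
    have "cball (of_nat n * ?u + S ?u) (3 / 2 * ?r) \<subseteq> (\<lambda>v. of_nat n * v + S v) ` cball ?u ?r"
    proof (rule expanding_ball_image[OF n])
      show "cmod (S v - S w) \<le> 1 / 2 * cmod (v - w)" if "v \<in> cball ?u ?r" "w \<in> cball ?u ?r" for v w
        using that Suc by (intro lip) blast+
    qed (use start in simp)
    also have "\<dots> \<subseteq> X \<inter> {v. Re v < b}" using inv Suc by blast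
    finally show ?case by (simp add: T_def mult.assoc)
  qed
  obtain k where k: "(ln M + pi) / \<rho> < (3 / 2) ^ k" using real_arch_pow[of "3/2"] by auto
  define c where "c = (T ^^ k) u"
  define R where "R = (3 / 2) ^ k * \<rho>"
  have R: "ln M + pi < R" using k start(1) by (simp add: R_def field_simps)
  have cR: "cball c R \<subseteq> X \<inter> {v. Re v < b}" using grow[of k] by (simp add: c_def R_def)
  have R0: "R > 0" using start(1) by (simp add: R_def)
  then have "c \<in> cball c R" by simp
  then have cb: "Re c < b" using cR by blast
  show thesis
  proof (rule that[of "exp (Re c)"])
    fix z assume z: "exp (Re c) / M < cmod z" "cmod z < exp (Re c) * M"
    have z0: "z \<noteq> 0"
    proof
      assume "z = 0"
      then have "exp (Re c) / M < 0" using z(1) by simp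
      moreover have "exp (Re c) / M > 0" using M by simp
      ultimately show False by linarith
    qed
    \<comment> \<open>The argument of z is measured from the direction \<open>Im c\<close>, so that
      the logarithm v of z has imaginary part within pi of \<open>Im c\<close>.\<close>
    obtain \<theta> where \<theta>: "- pi < \<theta>" "\<theta> \<le> pi" "z * exp (- \<i> * of_real (Im c)) = of_real (cmod z) * exp (\<i> * of_real \<theta>)"
    proof -
      let ?w = "z * exp (- \<i> * of_real (Im c))"
      have w: "cmod ?w = cmod z" by (simp add: norm_mult)
      have "?w \<noteq> 0" using z0 by simp
      then have "?w = of_real (cmod z) * exp (\<i> * of_real (Arg ?w))" using Arg_eq[of ?w] w by simp
      then show thesis using that[of "Arg ?w"] Arg_bounded[of ?w] by blast
    qed
    define v where "v = Complex (ln (cmod z)) (Im c + \<theta>)"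
    have "exp v = exp (of_real (ln (cmod z)) + \<i> * of_real \<theta> + \<i> * of_real (Im c))"
      by (rule arg_cong[where f=exp]) (simp add: v_def complex_eq_iff)
    also have "\<dots> = of_real (cmod z) * exp (\<i> * of_real \<theta>) * exp (\<i> * of_real (Im c))"
      using z0 by (simp add: exp_add exp_of_real)
    also have "\<dots> = z * (exp (- \<i> * of_real (Im c)) * exp (\<i> * of_real (Im c)))"
      unfolding \<theta>(3)[symmetric] by (simp add: mult.assoc)
    also have "\<dots> = z" by (simp add: exp_minus)
    finally have ev: "z = exp v" by simp
    have "ln (exp (Re c) / M) < ln (cmod z)" using z(1) z0 M by (subst ln_less_cancel_iff) auto
    then have l1: "Re c - ln M < ln (cmod z)" using M by (simp add: ln_div)
    have "ln (cmod z) < ln (exp (Re c) * M)" using z(2) z0 M by (subst ln_less_cancel_iff) auto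
    then have l2: "ln (cmod z) < Re c + ln M" using M by (simp add: ln_mult)
    have "cmod (c - v) \<le> \<bar>Re (c - v)\<bar> + \<bar>Im (c - v)\<bar>" by (rule cmod_le)
    also have "\<dots> \<le> ln M + pi" using l1 l2 \<theta>(1,2) by (simp add: v_def abs_if)
    finally have "v \<in> cball c R" using R by (simp add: dist_norm)
    then show "\<exists>v\<in>X. z = exp v" using cR ev by blast
  qed (use cb in auto)
qed

text \<open>The coordinate in which \<^const>\<open>local_rep\<close> is written, translated to have its centre at the origin.\<close>
definition centred :: "rsphere \<Rightarrow> complex \<Rightarrow> rsphere"
  where "centred z0 \<zeta> = param z0 (chart z0 z0 + \<zeta>)"

lemma centred_param:
  shows "sph_hol (centred z0) UNIV" "centred z0 0 = z0" "dist (centred z0 z) (centred z0 w) \<le> 2 * cmod (z - w)" "inj (centred z0)" "open U \<Longrightarrow> open (centred z0 ` U)"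
proof -
  have inf: "centred z0 = (\<lambda>\<zeta>. sphere_inv (Fin \<zeta>))" if "z0 = Infty"
    using that by (auto simp: centred_def sphere_inv_def fun_eq_iff)
  have fin: "centred z0 = (\<lambda>\<zeta>. Fin (c + \<zeta>))" if "z0 = Fin c" for c
    using that by (auto simp: centred_def)
  show "sph_hol (centred z0) UNIV"
  proof (cases z0)
    case (Fin c)
    show ?thesis unfolding fin[OF Fin] by (intro sph_hol_Fin holomorphic_intros open_UNIV)
  next
    case Infty
    show ?thesis unfolding inf[OF Infty]
      by (rule sphere_mapD[OF rotation_map[OF rotation_sphere_inv]]) (auto intro!: sph_hol_Fin holomorphic_intros)
  qed
  show "centred z0 0 = z0" by (cases z0) (auto simp: centred_def)
  show "dist (centred z0 z) (centred z0 w) \<le> 2 * cmod (z - w)"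
  proof (cases z0)
    case (Fin c)
    show ?thesis unfolding fin[OF Fin] using dist_Fin_le[of "c + z" "c + w"] by simp
  next
    case Infty
    show ?thesis unfolding inf[OF Infty] dist_sphere_inv by (rule dist_Fin_le)
  qed
  show "inj (centred z0)"
  proof (cases z0)
    case (Fin c)
    show ?thesis unfolding fin[OF Fin] by (auto intro: injI)
  next
    case Infty
    show ?thesis unfolding inf[OF Infty] by (rule injI) (metis rsphere.inject sphere_inv_inv)
  qed
  show "open (centred z0 ` U)" if U: "open U"
  proof (cases z0)
    case (Fin c)
    have "centred z0 ` U = Fin ` ((+) c ` U)" unfolding fin[OF Fin] by (simp add: image_image)
    then show ?thesis using U by (simp add: open_Fin_image open_translation)
  next
    case Infty
    have "centred z0 ` U = sphere_inv -` (Fin ` U)"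
    proof (intro equalityI subsetI)
      fix x assume "x \<in> sphere_inv -` (Fin ` U)"
      then obtain z where "sphere_inv x = Fin z" "z \<in> U" by blast
      then show "x \<in> (centred z0) ` U" unfolding inf[OF Infty] by (metis image_eqI sphere_inv_inv)
    qed (auto simp: inf[OF Infty])
    then show ?thesis using open_Fin_image[OF U] continuous_on_sphere_inv[of UNIV] by (simp add: open_vimage)
  qed
qed

text \<open>In the coordinate centred at the fixed point the map is w^n times a zero-free function,
  which has a holomorphic logarithm l on a disc. The vanishing multiplier forces n to be at least
  2.\<close>

lemma superattracting_local_form:
  assumes h: "open_sphere_map h" and fp: "h z0 = z0" and d0: "sphere_deriv h z0 = 0"
  obtains n r l where "2 \<le> n" "0 < r" "l holomorphic_on ball 0 r"
    "\<And>w. w \<in> ball 0 r \<Longrightarrow> h (centred z0 w) = centred z0 (w ^ n * exp (l w))"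
proof -
  define p where "p = centred z0"
  note p = centred_param[where ?z0.0=z0, folded p_def]
  define a where "a = chart z0 z0"
  define g where "g = (\<lambda>w. chart z0 (h (p w)) - a)"
  have hp: "sph_hol (\<lambda>w. h (p w)) UNIV"
    by (rule sphere_mapD[OF open_sphere_mapD(1)[OF h] open_UNIV p(1)])
  have "(\<lambda>w. chart (h (p 0)) (h (p w))) analytic_on {0}" using hp by (simp add: sph_hol_def)
  then have "(\<lambda>w. chart z0 (h (p w))) analytic_on {0}" using p(2) fp by simp
  then have g_an: "g analytic_on {0}" unfolding g_def by (intro analytic_intros)
  have g0: "g 0 = 0" using p(2) fp by (simp add: g_def a_def)
  have dg: "deriv g 0 = 0"
  proof -
    have "(g has_field_derivative deriv g 0) (at 0)"
      using analytic_on_imp_differentiable_at[OF g_an] field_differentiable_derivI by blast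
    then have "((\<lambda>w. g w + a) has_field_derivative deriv g 0) (at 0)"
      by (auto intro!: derivative_eq_intros)
    moreover have "(\<lambda>w. g w + a) = (\<lambda>w. local_rep h z0 (w + a))"
      by (simp add: g_def local_rep_def p_def centred_def a_def fp add.commute fun_eq_iff)
    ultimately have "(local_rep h z0 has_field_derivative deriv g 0) (at (0 + a))"
      by (simp only: DERIV_shift)
    then have "sphere_deriv h z0 = deriv g 0"
      using DERIV_imp_deriv by (simp add: sphere_deriv_def a_def[symmetric])
    then show ?thesis using d0 by simp
  qed
  have "isCont (\<lambda>w. h (p w)) 0"
    using hp by (simp add: sph_hol_def continuous_on_eq_continuous_at)
  then have lim: "((\<lambda>w. h (p w)) \<longlongrightarrow> z0) (nhds 0)"
    using p(2) fp by (metis isCont_def tendsto_at_iff_tendsto_nhds)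
  have "\<forall>\<^sub>F w in nhds 0. h (p w) = p (g w)"
  proof -
    have "\<forall>\<^sub>F w in nhds 0. (z0 \<noteq> Infty \<longrightarrow> h (p w) \<noteq> Infty) \<and> (z0 = Infty \<longrightarrow> h (p w) \<noteq> Fin 0)"
    proof (cases "z0 = Infty")
      case True
      then show ?thesis using tendsto_imp_eventually_ne[OF lim, of "Fin 0"] by simp
    next
      case False
      then show ?thesis using tendsto_imp_eventually_ne[OF lim, of Infty] by simp
    qed
    then show ?thesis
      by eventually_elim (simp add: p_def centred_def g_def a_def param_chart)
  qed
  then obtain r1 where r1: "r1 > 0" "\<And>w. dist w 0 < r1 \<Longrightarrow> h (p w) = p (g w)"
    unfolding eventually_nhds_metric by blast
  obtain S where S: "open S" "0 \<in> S" "g holomorphic_on S"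
    using g_an unfolding analytic_at by blast
  then obtain r2 where r2: "r2 > 0" "ball 0 r2 \<subseteq> S" using open_contains_ball by blast
  define r where "r = min r1 r2"
  have r: "r > 0" using r1 r2 by (simp add: r_def)
  have hg: "g holomorphic_on ball 0 r" using S(3) r2(2) by (rule holomorphic_on_subset[OF _ order_trans[rotated]]) (auto simp: r_def)
  have eq: "h (p w) = p (g w)" if "w \<in> ball 0 r" for w using r1(2)[of w] that by (simp add: r_def)
  \<comment> \<open>Were h constant near z0, its openness would make {z0} open and closed in the
    connected sphere.\<close>
  have nc: "\<not> g constant_on ball 0 r"
  proof
    assume "g constant_on ball 0 r"
    then have "g w = 0" if "w \<in> ball 0 r" for w
      using that g0 r unfolding constant_on_def by (metis centre_in_ball)
    then have e: "h (p w) = z0" if "w \<in> ball 0 r" for w using eq[OF that] p(2) that by simp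
    have "(\<lambda>w. h (p w)) ` ball 0 r = (\<lambda>w::complex. z0) ` ball 0 r" by (rule image_cong) (auto intro: e)
    also have "\<dots> = {z0}" using r by (simp add: image_constant_conv)
    finally have "(\<lambda>w. h (p w)) ` ball 0 r = {z0}" .
    then have "h ` p ` ball 0 r = {z0}" by (simp add: image_image)
    then have "open {z0}" using open_sphere_mapD(2)[OF h p(5)[OF open_ball]] by metis
    moreover have "{z0} \<noteq> UNIV" by (metis UNIV_I rsphere.distinct(1) singletonD)
    ultimately show False using connected_UNIV_rsphere closed_singleton[of z0] unfolding connected_clopen by auto
  qed
  have "0 \<in> ball (0::complex) r" using r by simp
  note factor = holomorphic_factor_zero_nonconstant[OF hg open_ball connected_ball this g0 nc]
  have "\<exists>G r3 n. 0 < n \<and> 0 < r3 \<and> ball (0::complex) r3 \<subseteq> ball 0 r \<and> G holomorphic_on ball 0 r3 \<and>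
      (\<forall>w\<in>ball 0 r3. g w = (w - 0) ^ n * G w) \<and> (\<forall>w\<in>ball 0 r3. G w \<noteq> 0)"
  proof (rule factor, goal_cases)
    case (1 G r3 n)
    then show ?case by (intro exI[of _ G] exI[of _ r3] exI[of _ n] conjI ballI)
  qed
  then obtain G r3 n where G: "0 < n" "0 < r3" "ball (0::complex) r3 \<subseteq> ball 0 r" "G holomorphic_on ball 0 r3"
    "\<forall>w\<in>ball 0 r3. g w = (w - 0) ^ n * G w" "\<forall>w\<in>ball 0 r3. G w \<noteq> 0"
    by metis
  note G = G(1-4) G(5,6)[rule_format]
  have "n \<noteq> 1"
  proof
    assume n: "n = 1"
    have "(G has_field_derivative deriv G 0) (at 0)"
      using holomorphic_derivI[OF G(4) open_ball] G(2) by simp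
    then have "((\<lambda>w. w * G w) has_field_derivative G 0) (at 0)"
      by (auto intro!: derivative_eq_intros)
    moreover have "\<forall>\<^sub>F w in nhds 0. g w = w * G w"
      using eventually_nhds_in_open[of "ball 0 r3" 0] G(2,5) n by (auto elim!: eventually_mono)
    ultimately have "(g has_field_derivative G 0) (at 0)"
      by (subst DERIV_cong_ev[OF refl _ refl])
    then have "deriv g 0 = G 0" by (rule DERIV_imp_deriv)
    then have "G 0 = 0" using dg by simp
    then show False using G(6)[of 0] G(2) by simp
  qed
  then have n2: "2 \<le> n" using G(1) by simp
  obtain l where l: "l holomorphic_on ball 0 r3" "\<And>w. w \<in> ball 0 r3 \<Longrightarrow> G w = exp (l w)"
    using contractible_imp_holomorphic_log[OF G(4) convex_imp_contractible[OF convex_ball] G(6)] by blast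
  have "h (p w) = p (w ^ n * exp (l w))" if "w \<in> ball 0 r3" for w
    using eq[of w] G(3,5) l(2) that by auto
  then show thesis using that n2 G(2) l(1) unfolding p_def by blast
qed

context branched_family
begin

lemma fatou_forward:
  assumes H: "subsemigroup H G" and h: "h \<in> H" and y: "y \<in> fatou H"
  shows "h y \<in> fatou H"
proof -
  have sub: "H \<subseteq> G" and cl: "\<And>f g. f \<in> H \<Longrightarrow> g \<in> H \<Longrightarrow> f \<circ> g \<in> H"
    using H unfolding subsemigroup_def by blast+
  have "open (h ` fatou H)" using open_sphere_mapD(2)[OF generated_open_map open_fatou] sub h by blast
  moreover have "h y \<in> h ` fatou H" using y by blast
  moreover have "eqc H x" if "x \<in> h ` fatou H" for x
    using eqc_forward[OF sub cl fatou_eqc[OF sub] h] that by blast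
  ultimately show ?thesis by (rule eqc_imp_fatou)
qed

lemma superattracting_imp_interior:
  assumes H: "subsemigroup H G" and z0: "z0 \<in> julia H"
    and h: "h \<in> H" "h z0 = z0" "sphere_deriv h z0 = 0"
  shows "z0 \<in> interior (julia H)"
proof (rule ccontr)
  assume not_int: "z0 \<notin> interior (julia H)"
  have "open_sphere_map h" using H h(1) generated_open_map unfolding subsemigroup_def by blast
  from superattracting_local_form[OF this h(2,3)] obtain n r l where n: "2 \<le> n" and r: "0 < r"
    and l: "l holomorphic_on ball 0 r" and loc: "\<forall>w\<in>ball 0 r. h (centred z0 w) = centred z0 (w ^ n * exp (l w))"
    by metis
  define p where "p = centred z0"
  note p = centred_param[where ?z0.0=z0, folded p_def]
  obtain \<delta> where \<delta>: "\<delta> > 0" "\<forall>H. subsemigroup H G \<longrightarrow> sep3 \<delta> (julia H)"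
    by (rule julia_three_points)
  obtain M where M: "M > 1" and nw: "excludes_wide_annuli M"
    by (rule no_wide_annulus)
  have "compact (cball (0::complex) (r / 2))" by simp
  moreover have "continuous_on (cball 0 (r / 2)) l"
    by (rule continuous_on_subset[OF holomorphic_on_imp_continuous_on[OF l]]) (use r in auto)
  ultimately have "bounded (l ` cball 0 (r / 2))" by (intro compact_imp_bounded compact_continuous_image)
  then obtain N where N: "N > 0" "\<And>w. w \<in> cball 0 (r / 2) \<Longrightarrow> cmod (l w) \<le> N"
    unfolding bounded_pos by auto
  \<comment> \<open>The first entry keeps exp u well inside the domain of l, the second bounds the
    derivative of \<open>l (exp u)\<close> by 1/2, the third prevents J(H) from fitting into a disc
    of radius e, and the last makes the half-plane invariant.\<close>
  define e where "e = min (r / 16) (min (r / (32 * N)) (min (\<delta> / 8) (exp (- N))))"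
  have e: "e > 0" "e \<le> r / 16" "32 * N * e \<le> r" "e \<le> \<delta> / 8" "e \<le> exp (- N)"
  proof -
    show "e > 0" using r N(1) \<delta>(1) by (simp add: e_def)
    have "e \<le> r / (32 * N)" by (simp add: e_def)
    then show "32 * N * e \<le> r" using N(1) by (simp add: field_simps)
  qed (simp_all add: e_def)
  define b where "b = ln e"
  have b: "exp b = e" "b \<le> - N"
    using e by (simp_all add: b_def ln_le_cancel_iff[of e "exp (- N)", simplified])
  define S where "S = (\<lambda>u. l (exp u))"
  have small: "cmod (exp u) < e" if "Re u < b" for u
    using that b(1) by (metis exp_less_cancel_iff norm_exp_eq_Re)
  have in_ball: "exp u \<in> ball 0 (r / 2 / 2)" "exp u \<in> ball 0 r" "exp u \<in> cball 0 (r / 2)" if "Re u < b" for u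
    using small[OF that] e(2) r by auto
  have dl: "cmod (deriv l w) \<le> 8 * N / r" if "w \<in> ball 0 (r / 2 / 2)" for w
  proof -
    have "l holomorphic_on ball 0 (r / 2)" by (rule holomorphic_on_subset[OF l]) (use r in auto)
    from bounded_holomorphic_deriv[OF this, of N w] show ?thesis using N(2) that by simp
  qed
  have lip: "cmod (S v - S w) \<le> 1 / 2 * cmod (v - w)" if "Re v < b" "Re w < b" for v w
  proof (rule field_differentiable_bound[where S="{u. Re u < b}" and f'="\<lambda>u. deriv l (exp u) * exp u"])
    show "convex {u. Re u < b}" by (rule convex_halfspace_Re_lt)
    show "(S has_field_derivative deriv l (exp u) * exp u) (at u within {u. Re u < b})" if "u \<in> {u. Re u < b}" for u
    proof -
      have "(l has_field_derivative deriv l (exp u)) (at (exp u))"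
        using holomorphic_derivI[OF l open_ball] in_ball(2) that by simp
      then show ?thesis
        unfolding S_def by (intro DERIV_chain2[OF _ DERIV_exp, THEN has_field_derivative_at_within])
    qed
    show "cmod (deriv l (exp u) * exp u) \<le> 1 / 2" if "u \<in> {u. Re u < b}" for u
    proof -
      have "cmod (deriv l (exp u) * exp u) \<le> (8 * N / r) * e"
        unfolding norm_mult using dl in_ball(1) small that N(1) r
        by (intro mult_mono) (auto simp: less_imp_le)
      also have "\<dots> \<le> 1 / 2" using e(3) N(1) e(1) r by (simp add: field_simps)
      finally show ?thesis .
    qed
  qed (use that in auto)
  define X where "X = {u. p (exp u) \<in> fatou H}"
  have inv: "Re (of_nat n * u + S u) < b \<and> of_nat n * u + S u \<in> X" if u: "Re u < b" "u \<in> X" for u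
  proof
    have "Re (S u) \<le> N" using N(2)[OF in_ball(3)[OF u(1)]] complex_Re_le_cmod[of "S u"] by (simp add: S_def)
    \<comment> \<open>As Re u < b and b is at most -N, the gain Re u outweighs the at most N
      contributed by S.\<close>
    moreover have "real n * Re u \<le> 2 * Re u" using n u(1) b(2) N(1) by (intro mult_right_mono_neg) auto
    ultimately show "Re (of_nat n * u + S u) < b" using u(1) b(2) by simp
    have "p (exp (of_nat n * u + S u)) = p (exp u ^ n * exp (l (exp u)))"
      by (simp add: exp_add exp_of_nat_mult S_def)
    also have "\<dots> = h (p (exp u))" using loc in_ball(2)[OF u(1)] by (simp add: p_def)
    finally show "of_nat n * u + S u \<in> X"
      using fatou_forward[OF H h(1)] u(2) by (simp add: X_def)
  qed
  have contp: "continuous_on UNIV p" using p(1) by (simp add: sph_hol_def)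
  have "open X"
  proof -
    have "X = (\<lambda>u. p (exp u)) -` fatou H" by (auto simp: X_def)
    moreover have "continuous_on UNIV (\<lambda>u. p (exp u))"
      by (rule continuous_on_compose2[OF contp]) (auto intro!: continuous_intros)
    ultimately show ?thesis using open_fatou by (simp add: open_vimage)
  qed
  moreover have "open {u. Re u < b}" by (rule open_halfspace_Re_lt)
  ultimately have oX: "open (X \<inter> {u. Re u < b})" by (rule open_Int)
  obtain u where u: "u \<in> X \<inter> {u. Re u < b}"
  proof -
    have "\<not> p ` ball 0 e \<subseteq> julia H"
    proof
      assume "p ` ball 0 e \<subseteq> julia H"
      moreover have "z0 \<in> p ` ball 0 e" using p(2) e(1) by (metis centre_in_ball image_eqI)
      ultimately show False using not_int p(5)[OF open_ball] interiorI by blast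
    qed
    then obtain w where w: "cmod w < e" "p w \<in> fatou H" by (auto simp: julia_def)
    \<comment> \<open>The centre is a Julia point, so Fatou points near it have logarithms.\<close>
    have "w \<noteq> 0" using w(2) z0 p(2) by (auto simp: julia_def)
    then have "w = exp (Ln w)" "Re (Ln w) < ln e" using w(1) e(1) by simp_all
    then show thesis using that[of "Ln w"] w(2) by (simp add: X_def b_def)
  qed
  then obtain \<rho> where \<rho>: "0 < \<rho>" "cball u \<rho> \<subseteq> X \<inter> {u. Re u < b}"
    using oX open_contains_cball by blast
  obtain t where t: "0 < t" "t < exp b" "\<And>z. t / M < cmod z \<Longrightarrow> cmod z < t * M \<Longrightarrow> \<exists>v\<in>X. z = exp v"
    using invariant_set_contains_wide_annulus[OF n lip inv \<rho> M] by metis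
  define \<psi> where "\<psi> = (\<lambda>z. p (of_real t * z))"
  have hol: "sph_hol \<psi> (ann M)"
    unfolding \<psi>_def by (rule sph_hol_reparam[OF p(1) _ subset_UNIV open_ann]) (intro holomorphic_intros)
  have F: "\<psi> ` ann M \<subseteq> fatou H"
  proof
    fix y assume "y \<in> \<psi> ` ann M"
    then obtain z where z: "y = p (of_real t * z)" "1 / M < cmod z" "cmod z < M" by (auto simp: \<psi>_def)
    have "t / M < cmod (of_real t * z)" "cmod (of_real t * z) < t * M"
      using mult_strict_left_mono[OF z(2) t(1)] mult_strict_left_mono[OF z(3) t(1)] t(1) by (simp_all add: norm_mult)
    then obtain v where "v \<in> X" "of_real t * z = exp v" using t(3) by blast
    then show "y \<in> fatou H" using z(1) by (simp add: X_def)
  qed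
  define U where "U = p ` ball 0 t"
  define V where "V = - p ` cball 0 t"
  have opU: "open U" unfolding U_def by (rule p(5)[OF open_ball])
  have opV: "open V" unfolding V_def
    by (intro open_Compl compact_imp_closed compact_continuous_image continuous_on_subset[OF contp]) auto
  have disj: "U \<inter> V = {}" unfolding U_def V_def by (auto simp: less_imp_le)
  have "\<psi> ` sphere 0 1 = p ` sphere 0 t"
    unfolding sphere_scale[OF t(1), symmetric] \<psi>_def image_image ..
  moreover have "U \<union> V = - p ` sphere 0 t"
  proof -
    have "p ` cball 0 t = p ` ball 0 t \<union> p ` sphere 0 t"
      unfolding image_Un[symmetric] by (rule arg_cong[where f="(`) p"]) auto
    moreover have "p ` ball 0 t \<inter> p ` sphere 0 t = {}"
      using p(4) by (auto simp: inj_eq)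
    ultimately show ?thesis unfolding U_def V_def by blast
  qed
  ultimately have un: "U \<union> V = - \<psi> ` sphere 0 1" by simp
  have "U \<inter> julia H \<noteq> {}" using z0 p(2) t(1) unfolding U_def by (metis IntI centre_in_ball empty_iff image_eqI)
  \<comment> \<open>Otherwise J(H) would lie in a set of diameter at most 4 t, which is less than
    \<delta>.\<close>
  moreover have "V \<inter> julia H \<noteq> {}"
  proof
    assume emp: "V \<inter> julia H = {}"
    obtain x y where xy: "x \<in> julia H" "y \<in> julia H" "\<delta> \<le> dist x y"
      using \<delta>(2)[rule_format, OF H] unfolding sep3_def by blast
    then have "x \<in> p ` cball 0 t" "y \<in> p ` cball 0 t" using emp unfolding V_def by blast+
    then obtain z w where zw: "x = p z" "y = p w" "cmod z \<le> t" "cmod w \<le> t" by auto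
    have "cmod (z - w) \<le> 2 * t" using norm_triangle_ineq4[of z w] zw by linarith
    then have "dist x y \<le> 4 * t" using p(3)[of z w] zw by simp
    then show False using xy(3) t(1,2) b(1) e(4) \<delta>(1) by linarith
  qed
  ultimately show False
    using nw[unfolded excludes_wide_annuli_def, rule_format, OF H hol F opU opV disj un] by blast
qed

end

section \<open>From compactness of the generating set to equicontinuity, and conclusion\<close>

lemma compactin_imp_equicontinuous:
  fixes \<Lambda> :: "(rsphere \<Rightarrow> rsphere) set"
  assumes c: "compactin (mtopology_of (cfunspace euclidean euclidean_metric)) \<Lambda>" and e: "e > 0"
  shows "\<exists>d>0. \<forall>h\<in>\<Lambda>. \<forall>x y. dist x y < d \<longrightarrow> dist (h x) (h y) < e"
proof -
  let ?m = "cfunspace (euclidean :: rsphere topology) (euclidean_metric :: rsphere metric)"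
  interpret Metric_space "mspace ?m" "mdist ?m" by (rule Metric_space_mspace_mdist)
  \<comment> \<open>A finite e/3-net, whose members are uniformly continuous with a common d,
    controls all of \<Lambda>.\<close>
  have "mtotally_bounded \<Lambda>"
    using c by (intro compactin_imp_mtotally_bounded) (simp add: mtopology_of_def)
  then obtain K where K: "finite K" "K \<subseteq> \<Lambda>" "\<Lambda> \<subseteq> (\<Union>x\<in>K. mball x (e / 3))"
    using e unfolding mtotally_bounded_def by (metis divide_pos_pos zero_less_numeral)
  have cont: "continuous_on UNIV f" if "f \<in> mspace ?m" for f
    using that by simp
  have sub: "\<Lambda> \<subseteq> mspace ?m" using compactin_subset_topspace[OF c] by (simp only: topspace_mtopology_of)
  have "\<exists>d>0. \<forall>h\<in>K. \<forall>x y. dist x y < d \<longrightarrow> dist (h x) (h y) < e / 3"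
    using K(1,2)
  proof (induction K rule: finite_induct)
    case empty
    show ?case by (auto intro: exI[of _ 1])
  next
    case (insert f K)
    obtain d1 where d1: "d1 > 0" "\<forall>h\<in>K. \<forall>x y. dist x y < d1 \<longrightarrow> dist (h x) (h y) < e / 3"
      using insert by auto
    have "uniformly_continuous_on UNIV f"
      using cont sub insert.prems compact_uniformly_continuous[OF _ compact_UNIV_rsphere] by blast
    then obtain d2 where d2: "d2 > 0" "\<forall>x y. dist x y < d2 \<longrightarrow> dist (f x) (f y) < e / 3"
      using e unfolding uniformly_continuous_on_def by (metis UNIV_I divide_pos_pos dist_commute zero_less_numeral)
    show ?case using d1 d2 by (intro exI[of _ "min d1 d2"]) auto
  qed
  then obtain d where d: "d > 0" "\<And>h x y. h \<in> K \<Longrightarrow> dist x y < d \<Longrightarrow> dist (h x) (h y) < e / 3" by blast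
  have "dist (h x) (h y) < e" if h: "h \<in> \<Lambda>" and xy: "dist x y < d" for h x y
  proof -
    obtain f where f: "f \<in> K" "h \<in> mball f (e / 3)" using K(3) h by blast
    then have m: "f \<in> mspace ?m" "h \<in> mspace ?m" "mdist ?m f h < e / 3" unfolding in_mball by blast+
    have close: "dist (f z) (h z) < e / 3" for z
      using cfunspace_mdist_lt[of euclidean f euclidean_metric h "e / 3" z] m compact_UNIV_rsphere by simp
    have "dist (h x) (h y) \<le> dist (h x) (f x) + dist (f x) (f y) + dist (f y) (h y)"
      using dist_triangle[of "h x" "h y" "f x"] dist_triangle[of "f x" "h y" "f y"] by linarith
    then show ?thesis using close[of x] close[of y] d(2)[OF f(1) xy] by (simp add: dist_commute)
  qed
  then show ?thesis using d(1) by blast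
qed

theorem theorem1p21:
  fixes \<Lambda> :: "(rsphere \<Rightarrow> rsphere) set"
  assumes "compactin
      (subtopology (mtopology_of (cfunspace euclidean euclidean_metric))
        {h. sphere_holomorphic_on h UNIV \<and> 2 \<le> sphere_degree h}) \<Lambda>"
  shows "(\<exists>C>0. \<forall>H. subsemigroup H (generated_semigroup \<Lambda>) \<longrightarrow> uniformly_perfect C (julia H)) \<and>
    (\<forall>H z0. subsemigroup H (generated_semigroup \<Lambda>) \<and> z0 \<in> julia H \<and>
        (\<exists>h\<in>H. h z0 = z0 \<and> sphere_deriv h z0 = 0) \<longrightarrow>
      z0 \<in> interior (julia H))"
proof -
  have c: "compactin (mtopology_of (cfunspace euclidean euclidean_metric)) \<Lambda>"
    and sub: "\<Lambda> \<subseteq> {h. sphere_holomorphic_on h UNIV \<and> 2 \<le> sphere_degree h}"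
    using assms by (simp_all add: compactin_subtopology)
  interpret branched_family \<Lambda>
  proof
    show "branched h" if "h \<in> \<Lambda>" for h using that sub by (intro rat_map_branched) auto
    show "\<exists>d>0. \<forall>h\<in>\<Lambda>. \<forall>x y. dist x y < d \<longrightarrow> dist (h x) (h y) < e" if "e > 0" for e
      by (rule compactin_imp_equicontinuous[OF c that])
  qed
  show ?thesis
    using julia_uniformly_perfect superattracting_imp_interior by blast
qed

end
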